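(* Let $\lambda_1,\ldots,\lambda_k\ge 0$ and let $B_i:\mathbb{R}^n\to\mathbb{R}^{n_i}$, $i=1,\ldots,k$, be linear maps such that $$\sum_{i=1}^k\lambda_iB_i^*B_i=I_n,\qquad B_iB_i^*=I_{n_i}\ \text{ for all } i,$$ and let $E_i=\mathrm{Im}(B_i^* )\subseteq\mathbb{R}^n$. For any $c\in(0,1)$ and Borel sets $A_i\subseteq E_i$, $i=1,\ldots,k$, we have $$\lambda_1\Phi_c^{-1}(\gamma_{n_1}(A_1))+\cdots+\lambda_k\Phi_c^{-1}(\gamma_{n_k}(A_k))\le\Phi_c^{-1}(\gamma_n(\lambda_1A_1+\cdots+\lambda_kA_k)).$$
   Context: $\gamma_m$ is the standard Gaussian measure on $\mathbb{R}^m$; $\gamma_{n_i}(A_i)$ for $A_i\subseteq E_i$ is understood by identifying $\gamma_{n_i}$ with the standard Gaussian measure on the $n_i$-dimensional subspace $E_i$, i.e. $\gamma_{n_i}(A_i)$ means $\gamma_{n_i}(\{x\in\mathbb{R}^{n_i}:B_i^*x\in A_i\})$. $\lambda_1A_1+\cdots+\lambda_kA_k:=\{\lambda_1x_1+\cdots+\lambda_kx_k:x_i\in A_i\}$ is the Minkowski sum; it is an analytic set, and $\gamma_n$ of it is understood as the value of the completion of $\gamma_n$. $\Phi(x):=\gamma_1((-\infty,x])$, and $\Phi^{-1}$ is its inverse, extended by $\Phi^{-1}(0)=-\infty$ and $\Phi^{-1}(1)=+\infty$. For $c\in(0,1)$, $\Phi_c^{-1}(x):=\Phi^{-1}(cx)-\Phi^{-1}(c)$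 for $x\in[0,1]$, with values in $[-\infty,0]$ and $\Phi_c^{-1}(0)=-\infty$. Products and sums are taken in $[-\infty,0]$, with the convention $\lambda\cdot(-\infty)=-\infty$ for all $\lambda\ge 0$ (including $\lambda=0$). $B^*$ denotes the adjoint (transpose) of $B$. *)

theory Defs
  imports "HOL-Probability.Probability"
begin

text \<open>
  The space R^n is the type \<open>real^'n\<close>. The dimensions n_i of the target spaces vary
  with i and may be zero, so R^m is represented by the functions \<open>nat \<Rightarrow> real\<close> on
  \<open>{..<m}\<close> (extensional, i.e. \<open>undefined\<close> elsewhere), with the inner product
  \<open>\<Sum>j<m. x j * y j\<close>.
\<close>

abbreviation coord_space :: "nat \<Rightarrow> (nat \<Rightarrow> real) set" where
  "coord_space m \<equiv> {..<m} \<rightarrow>\<^sub>E UNIV"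

definition coord_gauss :: "nat \<Rightarrow> (nat \<Rightarrow> real) measure" where
  "coord_gauss m = (\<Pi>\<^sub>M j\<in>{..<m}. std_normal_distribution)"

definition vec_gauss :: "(real^'n) measure" where
  "vec_gauss = distr (\<Pi>\<^sub>M a\<in>UNIV. std_normal_distribution) borel vec_lambda"

lemma space_coord_gauss: "space (coord_gauss m) = coord_space m"
  by (simp add: coord_gauss_def space_PiM)

lemma prob_space_coord_gauss: "prob_space (coord_gauss m)"
  unfolding coord_gauss_def
  by (intro prob_space_PiM prob_space_normal_density) simp

lemma measurable_vec_lambda_gauss:
  "vec_lambda \<in> (\<Pi>\<^sub>M a\<in>(UNIV :: 'n::finite set). std_normal_distribution) \<rightarrow>\<^sub>M borel"
proof (subst borel_measurable_euclidean_space, intro ballI)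
  fix b :: "real^'n" assume "b \<in> Basis"
  then obtain a where b: "b = axis a 1" by (auto simp: Basis_vec_def)
  have "(\<lambda>x. x a) \<in> (\<Pi>\<^sub>M a\<in>(UNIV :: 'n set). std_normal_distribution) \<rightarrow>\<^sub>M std_normal_distribution"
    by (rule measurable_component_singleton) simp
  then show "(\<lambda>x. vec_lambda x \<bullet> b) \<in>
      borel_measurable (\<Pi>\<^sub>M a\<in>(UNIV :: 'n set). std_normal_distribution)"
    by (simp add: b inner_axis)
qed

lemma prob_space_vec_gauss: "prob_space (vec_gauss :: (real^'n) measure)"
  unfolding vec_gauss_def
  by (intro prob_space.prob_space_distr prob_space_PiM prob_space_normal_density
      measurable_vec_lambda_gauss) simp

definition linear_coord :: "nat \<Rightarrow> (real^'n \<Rightarrow> nat \<Rightarrow> real) \<Rightarrow> bool" where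
  "linear_coord m f \<longleftrightarrow> (\<forall>x. f x \<in> coord_space m) \<and> (\<forall>j<m. linear (\<lambda>x. f x j))"

text \<open>The matrix entry in row \<open>j\<close> and column \<open>a\<close> of \<open>f\<close> is \<open>f (axis a 1) j\<close>.\<close>

definition adj :: "nat \<Rightarrow> (real^'n \<Rightarrow> nat \<Rightarrow> real) \<Rightarrow> (nat \<Rightarrow> real) \<Rightarrow> real^'n" where
  "adj m f y = (\<chi> a. \<Sum>j<m. f (axis a 1) j * y j)"

lemma adj_works:
  fixes f :: "real^'n \<Rightarrow> nat \<Rightarrow> real"
  assumes "linear_coord m f"
  shows "(\<Sum>j<m. f x j * y j) = x \<bullet> adj m f y"
proof -
  have f: "f x j = (\<Sum>a\<in>UNIV. x $ a * f (axis a 1) j)" if "j < m" for j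
  proof -
    interpret linear "\<lambda>x. f x j" using assms that by (simp add: linear_coord_def)
    have "f x j = f (\<Sum>a\<in>UNIV. (x $ a) *\<^sub>R axis a 1) j"
      using basis_expansion[of x] by (simp add: scalar_mult_eq_scaleR)
    then show ?thesis by (simp add: sum scale)
  qed
  have "(\<Sum>j<m. f x j * y j) = (\<Sum>j<m. \<Sum>a\<in>UNIV. x $ a * f (axis a 1) j * y j)"
    by (intro sum.cong refl) (simp add: f sum_distrib_right)
  also have "\<dots> = (\<Sum>a\<in>UNIV. \<Sum>j<m. x $ a * f (axis a 1) j * y j)"
    by (rule sum.swap)
  also have "\<dots> = x \<bullet> adj m f y"
    by (simp add: adj_def inner_vec_def sum_distrib_left mult.assoc)
  finally show ?thesis .
qed

text \<open>For \<open>A\<close> contained in the image of \<open>adj m f\<close> with \<open>f\<close> a coisometry, this is the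
  standard Gaussian measure of \<open>A\<close> inside that \<open>m\<close>-dimensional subspace.\<close>

definition subspace_gauss ::
    "nat \<Rightarrow> (real^'n \<Rightarrow> nat \<Rightarrow> real) \<Rightarrow> (real^'n) set \<Rightarrow> real" where
  "subspace_gauss m f A = measure (coord_gauss m) {y \<in> coord_space m. adj m f y \<in> A}"

definition minkowski_comb ::
    "nat \<Rightarrow> (nat \<Rightarrow> real) \<Rightarrow> (nat \<Rightarrow> (real^'n) set) \<Rightarrow> (real^'n) set" where
  "minkowski_comb k lam A = {\<Sum>i=1..k. lam i *\<^sub>R x i | x. \<forall>i\<in>{1..k}. x i \<in> A i}"

definition Phi :: "real \<Rightarrow> real" where
  "Phi x = measure std_normal_distribution {..x}"

text \<open>\<open>Phi_inv\<close> is only meaningful on \<open>[0, 1]\<close>.\<close>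

definition Phi_inv :: "real \<Rightarrow> ereal" where
  "Phi_inv p = (if p \<le> 0 then -\<infinity> else if p \<ge> 1 then \<infinity> else ereal (inv Phi p))"

definition Phi_c_inv :: "real \<Rightarrow> real \<Rightarrow> ereal" where
  "Phi_c_inv c x = Phi_inv (c * x) - Phi_inv c"

text \<open>In \<^typ>\<open>ereal\<close> the product \<open>0 * (-\<infinity>)\<close> is \<open>0\<close>; the intended convention is
  \<open>\<lambda> * (-\<infinity>) = -\<infinity>\<close> for all \<open>\<lambda> \<ge> 0\<close>, including \<open>\<lambda> = 0\<close>.\<close>

definition scale_ext :: "real \<Rightarrow> ereal \<Rightarrow> ereal" where
  "scale_ext l t = (if t = -\<infinity> then -\<infinity> else ereal l * t)"

end

theory Submission
  imports Defs
begin

text \<open>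
  Write \<open>P\<^sub>i = B\<^sub>i\<^sup>* B\<^sub>i\<close>. These are orthogonal projections of \<open>R\<^sup>n\<close> with
  \<open>(\<Sum>i. lam i * P\<^sub>i) = id\<close>, and the Gaussian measure of \<open>A\<^sub>i\<close> inside its subspace is the Gaussian
  measure of the set of all \<open>z\<close> with \<open>P\<^sub>i z \<in> A\<^sub>i\<close>. Let \<open>\<phi>\<close> be the quantile of \<open>c\<close>. The inequality
  for sets follows from one for functions: if functions \<open>f\<^sub>i\<close> and \<open>h\<close> with values in \<open>(0, 1]\<close> are
  such that \<open>u\<^sub>i = \<Phi>\<^sup>-\<^sup>1(c f\<^sub>i)\<close> and \<open>v = \<Phi>\<^sup>-\<^sup>1(c h)\<close> satisfy
  \<open>v(\<Sum>i. lam i * P\<^sub>i x\<^sub>i) - \<phi> \<ge> (\<Sum>i. lam i * (u\<^sub>i(x\<^sub>i) - \<phi>))\<close> for all \<open>x\<close>, then the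
  same holds with the functions replaced by their Gaussian means.

  The reason is a minimum principle for the heat flow. If \<open>f\<^sub>i\<close> and \<open>h\<close> evolve by the heat
  equation, then \<open>u\<^sub>i\<close> and \<open>v\<close> evolve by \<open>u_t = (\<Delta> u - u |\<nabla> u|^2) / 2\<close>. Let the gap,
  left side minus right side of the inequality, be minimal at \<open>x\<close>, and let \<open>g\<close> be the gradient of
  \<open>v\<close>. Moving one \<open>x\<^sub>i\<close> shows that the gradient of \<open>u\<^sub>i\<close> is \<open>P\<^sub>i g\<close>. Moving all \<open>x\<^sub>i\<close> by a
  common vector moves the argument of \<open>v\<close> by the same vector, so the Laplacians contribute a
  nonnegative amount. The remaining terms add up, by \<open>|g|^2 = (\<Sum>i. lam i * |P\<^sub>i g|^2)\<close>, to
  one half of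
  \<open>(\<Sum>i. lam i * (\<phi> - u\<^sub>i) * (|g|^2 - |P\<^sub>i g|^2)) - gap * |g|^2\<close>. The sum is nonnegative because
  \<open>f\<^sub>i \<le> 1\<close> means \<open>u\<^sub>i \<le> \<phi>\<close>; this is the place where the modified quantile
  function is essential. Hence a nonnegative gap cannot become negative.

  To avoid second derivatives and the behaviour at infinity, time is discretised: one step of
  duration \<open>s\<^sup>2\<close> lowers a nonpositive lower bound of the gap by \<open>O(s\<^sup>3)\<close> only
  (\<open>gap_heat_step\<close>), as long as the functions have Lipschitz gradients with fixed constants, a
  property that the flow preserves (\<open>C11_heat\<close>). Near-minima replace minima
  (\<open>near_minimum_gradients\<close>). Dividing unit time into \<open>N\<close> steps and letting \<open>N\<close> tend to infinity
  gives \<open>functional_inequality\<close>.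

  Cutoff functions turn this into the inequality for compact sets, and inner regularity extends it
  to Borel sets (\<open>gauss_borel_inequality\<close>). The Minkowski combination of Borel sets need not be
  Borel; it belongs to the domain of the completed measure by a capacity argument for analytic
  sets (\<open>minkowski_comb_completion\<close>).
\<close>

section \<open>Gaussian measure on Euclidean spaces\<close>

lemma linear_borel_measurable:
  fixes f :: "'a::euclidean_space \<Rightarrow> 'b::euclidean_space"
  assumes "linear f"
  shows "f \<in> borel_measurable borel"
  using assms
  by (intro borel_measurable_continuous_onI linear_continuous_on) (simp add: linear_conv_bounded_linear)

abbreviation N01 :: "real measure" where "N01 \<equiv> std_normal_distribution"

text \<open>
  The product form is the one that Fubini on coordinates uses; the form
  \<open>(2 \<pi>) powr (- n / 2) * exp (- |x|^2 / 2)\<close>, which shows the rotation invariance, is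
  derived below.
\<close>

definition gauss_dens :: "'a::euclidean_space \<Rightarrow> real" where
  "gauss_dens x = (\<Prod>b\<in>Basis. std_normal_density (x \<bullet> b))"

definition gauss :: "'a::euclidean_space measure" where
  "gauss = density lborel (\<lambda>x. ennreal (gauss_dens x))"

lemma gauss_dens_norm:
  "gauss_dens (x::'a::euclidean_space) = (1 / sqrt (2 * pi)) ^ DIM('a) * exp (- (norm x)\<^sup>2 / 2)"
proof -
  have "(norm x)\<^sup>2 = (\<Sum>b\<in>Basis. (x \<bullet> b)\<^sup>2)"
    by (subst power2_norm_eq_inner, subst euclidean_inner) (simp add: power2_eq_square)
  then have "exp (- (norm x)\<^sup>2 / 2) = (\<Prod>b\<in>Basis. exp (- (x \<bullet> b)\<^sup>2 / 2))"
    by (simp add: exp_sum[symmetric] sum_negf[symmetric] sum_divide_distrib)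
  then show ?thesis
    by (simp add: gauss_dens_def std_normal_density_def prod.distrib prod_dividef power_divide)
qed

lemma gauss_dens_nonneg [simp]: "0 \<le> gauss_dens x"
  by (simp add: gauss_dens_norm)

lemma gauss_dens_measurable [measurable]: "gauss_dens \<in> borel_measurable borel"
  unfolding gauss_dens_def by measurable

lemma sets_gauss [simp, measurable_cong]: "sets gauss = sets borel"
  by (simp add: gauss_def)

lemma space_gauss [simp]: "space gauss = UNIV"
  by (simp add: gauss_def)

lemma nn_integral_gauss_dens: "(\<integral>\<^sup>+x. ennreal (gauss_dens (x::'a::euclidean_space)) \<partial>lborel) = 1"
proof -
  have 1: "(\<integral>\<^sup>+x. ennreal (std_normal_density x) \<partial>lborel) = 1"
    using prob_space.emeasure_space_1[OF prob_space_normal_density[of 1 0]]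
    by (simp add: emeasure_density)
  have "(\<integral>\<^sup>+x. ennreal (gauss_dens (x::'a)) \<partial>lborel)
      = (\<integral>\<^sup>+x. (\<Prod>b\<in>Basis. ennreal (std_normal_density ((x::'a) \<bullet> b))) \<partial>lborel)"
    by (simp add: gauss_dens_def prod_ennreal)
  also have "\<dots> = (\<Prod>b\<in>(Basis::'a set). (\<integral>\<^sup>+x. ennreal (std_normal_density x) \<partial>lborel))"
    by (rule nn_integral_lborel_prod) auto
  finally show ?thesis by (simp add: 1)
qed

lemma prob_space_gauss: "prob_space gauss"
  by (rule prob_spaceI) (simp add: gauss_def emeasure_density nn_integral_gauss_dens)

lemma nn_integral_lborel_translate:
  fixes f :: "'a::euclidean_space \<Rightarrow> ennreal"
  assumes [measurable]: "f \<in> borel_measurable borel"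
  shows "(\<integral>\<^sup>+x. f (x + t) \<partial>lborel) = (\<integral>\<^sup>+x. f x \<partial>lborel)"
proof -
  have "(\<integral>\<^sup>+x. f x \<partial>lborel) = (\<integral>\<^sup>+x. f x \<partial>distr lborel borel ((+) t))"
    by (simp add: lborel_distr_plus)
  also have "\<dots> = (\<integral>\<^sup>+x. f (x + t) \<partial>lborel)"
    by (subst nn_integral_distr) (auto simp: add.commute)
  finally show ?thesis by simp
qed

text \<open>
  Lebesgue measure is rotation invariant because it is the only translation invariant
  measure up to a factor. The usual proof of that uniqueness is made concrete here:
  insert \<open>1 = \<integral> gauss_dens (y - Q x) dy\<close>, exchange the integrals, and translate \<open>x\<close> by
  \<open>inv Q y\<close>; the factor comes out as 1 since the density depends on the norm only.
\<close>

lemma nn_integral_lborel_orthogonal: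
  fixes f :: "'a::euclidean_space \<Rightarrow> ennreal" and Q :: "'a \<Rightarrow> 'a"
  assumes Q: "orthogonal_transformation Q" and f [measurable]: "f \<in> borel_measurable borel"
  shows "(\<integral>\<^sup>+x. f (Q x) \<partial>lborel) = (\<integral>\<^sup>+x. f x \<partial>lborel)"
proof -
  have lin: "linear Q" and nQ: "\<And>x. norm (Q x) = norm x"
    using Q by (auto simp: orthogonal_transformation)
  have Qm [measurable]: "Q \<in> borel_measurable borel"
    by (rule linear_borel_measurable[OF lin])
  have inv: "Q (inv Q y) = y" for y
    using orthogonal_transformation_surj[OF Q] by (simp add: surj_f_inv_f)
  have rho: "gauss_dens (- Q x) = gauss_dens x" for x by (simp add: gauss_dens_norm nQ)
  have "(\<integral>\<^sup>+x. f (Q x) \<partial>lborel) = (\<integral>\<^sup>+x. f (Q x) * (\<integral>\<^sup>+y. gauss_dens (y + - Q x) \<partial>lborel) \<partial>lborel)"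
    by (subst nn_integral_lborel_translate) (simp_all add: nn_integral_gauss_dens)
  also have "\<dots> = (\<integral>\<^sup>+x. (\<integral>\<^sup>+y. f (Q x) * gauss_dens (y + - Q x) \<partial>lborel) \<partial>lborel)"
    by (subst nn_integral_cmult) auto
  also have "\<dots> = (\<integral>\<^sup>+y. (\<integral>\<^sup>+x. f (Q x) * gauss_dens (y + - Q x) \<partial>lborel) \<partial>lborel)"
    by (rule lborel_pair.Fubini') measurable
  also have "\<dots> = (\<integral>\<^sup>+y. (\<integral>\<^sup>+x. f (Q (x + inv Q y)) * gauss_dens (y + - Q (x + inv Q y)) \<partial>lborel) \<partial>lborel)"
    by (intro nn_integral_cong nn_integral_lborel_translate[symmetric]) measurable
  also have "\<dots> = (\<integral>\<^sup>+y. (\<integral>\<^sup>+x. f (y + Q x) * gauss_dens x \<partial>lborel) \<partial>lborel)"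
    by (simp add: linear_add[OF lin] inv rho add.commute)
  also have "\<dots> = (\<integral>\<^sup>+x. (\<integral>\<^sup>+y. f (y + Q x) * gauss_dens x \<partial>lborel) \<partial>lborel)"
    by (rule lborel_pair.Fubini') measurable
  also have "\<dots> = (\<integral>\<^sup>+x. (\<integral>\<^sup>+y. f (y + Q x) \<partial>lborel) * gauss_dens x \<partial>lborel)"
    by (subst nn_integral_multc) auto
  also have "\<dots> = (\<integral>\<^sup>+x. (\<integral>\<^sup>+y. f y \<partial>lborel) * gauss_dens (x :: 'a) \<partial>lborel)"
    by (simp add: nn_integral_lborel_translate[OF f])
  also have "\<dots> = (\<integral>\<^sup>+x. f x \<partial>lborel)"
    by (subst nn_integral_cmult) (auto simp: nn_integral_gauss_dens)
  finally show ?thesis .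
qed

lemma distr_gauss_orthogonal:
  fixes Q :: "'a::euclidean_space \<Rightarrow> 'a"
  assumes Q: "orthogonal_transformation Q"
  shows "distr gauss borel Q = gauss"
proof (rule measure_eqI)
  fix A assume "A \<in> sets (distr gauss borel Q)"
  then have A [measurable]: "A \<in> sets borel" by simp
  have lin: "linear Q" and nQ: "\<And>x. norm (Q x) = norm x"
    using Q by (auto simp: orthogonal_transformation)
  have Qm [measurable]: "Q \<in> borel_measurable borel"
    by (rule linear_borel_measurable[OF lin])
  have rho: "gauss_dens (Q x) = gauss_dens x" for x by (simp add: gauss_dens_norm nQ)
  have "emeasure (distr gauss borel Q) A = (\<integral>\<^sup>+x. indicator A (Q x) \<partial>gauss)"
    by (subst nn_integral_distr[of Q gauss borel "indicator A", symmetric]) auto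
  also have "\<dots> = (\<integral>\<^sup>+x. ennreal (gauss_dens (Q x)) * indicator A (Q x) \<partial>lborel)"
    unfolding gauss_def by (subst nn_integral_density) (auto simp: rho)
  also have "\<dots> = (\<integral>\<^sup>+x. ennreal (gauss_dens x) * indicator A x \<partial>lborel)"
    by (rule nn_integral_lborel_orthogonal[OF Q, of "\<lambda>x. ennreal (gauss_dens x) * indicator A x"]) measurable
  also have "\<dots> = emeasure gauss A"
    unfolding gauss_def by (subst emeasure_density) auto
  finally show "emeasure (distr gauss borel Q) A = emeasure gauss A" .
qed simp

text \<open>
  The family is extended to an orthogonal basis and normalised; a bijection from the
  standard basis to the result is then extended linearly.
\<close>

lemma orthonormal_family_is_image_of_Basis:
  fixes b :: "'j \<Rightarrow> 'a::euclidean_space"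
  assumes J: "finite J" and b: "\<And>i j. i \<in> J \<Longrightarrow> j \<in> J \<Longrightarrow> b i \<bullet> b j = (if i = j then 1 else 0)"
  shows "\<exists>(Q :: 'a \<Rightarrow> 'a) (a :: 'j \<Rightarrow> 'a). orthogonal_transformation Q \<and> inj_on a J \<and> (\<forall>j\<in>J. a j \<in> Basis \<and> Q (a j) = b j)"
proof -
  have b1: "norm (b j) = 1" if "j \<in> J" for j
    using b[OF that that] by (simp add: norm_eq_1)
  have inj: "inj_on b J"
    by (rule inj_onI) (metis b one_neq_zero)
  have "pairwise orthogonal (b ` J)"
    unfolding pairwise_def orthogonal_def using b by auto
  then obtain U where U: "U \<inter> insert 0 (b ` J) = {}" "pairwise orthogonal (b ` J \<union> U)"
    "span (b ` J \<union> U) = span (b ` J \<union> UNIV)"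
    by (rule orthogonal_extension_strong)
  define W where "W = b ` J \<union> U"
  have W0: "0 \<notin> W" using U(1) b1 unfolding W_def by force
  have Wind: "independent W"
    using pairwise_orthogonal_independent[of W] U(2) W0 by (simp add: W_def)
  then have "card W = DIM('a)"
    using U(3) basis_card_eq_dim[of W UNIV] by (simp add: W_def)
  then obtain p where p: "bij_betw p (Basis :: 'a set) W"
    using finite_same_card_bij[of Basis W] independent_imp_finite[OF Wind] by auto
  define q where "q e = p e /\<^sub>R norm (p e)" for e :: 'a
  have pW: "p e \<in> W" if "e \<in> Basis" for e using p that by (auto simp: bij_betw_def)
  have q: "q e \<bullet> q f = (if e = f then 1 else 0)" if "e \<in> Basis" "f \<in> Basis" for e f
  proof (cases "e = f")
    case True
    have "p e \<noteq> 0" using pW[OF that(1)] W0 by auto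
    then show ?thesis using True by (simp add: q_def dot_square_norm power2_eq_square)
  next
    case False
    then have "p e \<noteq> p f" using p that by (auto simp: bij_betw_def inj_on_def)
    then have "p e \<bullet> p f = 0"
      using U(2) pW that unfolding W_def[symmetric] pairwise_def orthogonal_def by blast
    then show ?thesis using False by (simp add: q_def)
  qed
  define Q where "Q x = (\<Sum>e\<in>Basis. (x \<bullet> e) *\<^sub>R q e)" for x :: 'a
  have "linear Q"
    unfolding Q_def by (intro linear_compose_sum ballI linearI) (auto simp: inner_left_distrib scaleR_left_distrib)
  moreover have "Q x \<bullet> Q y = x \<bullet> y" for x y
  proof -
    have "Q x \<bullet> Q y = (\<Sum>f\<in>Basis. \<Sum>e\<in>Basis. (x \<bullet> e) * (y \<bullet> f) * (q e \<bullet> q f))"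
      unfolding Q_def inner_sum_left inner_sum_right by (simp add: mult_ac)
    also have "\<dots> = (\<Sum>f\<in>Basis. \<Sum>e\<in>Basis. if e = f then (x \<bullet> f) * (y \<bullet> f) else 0)"
      by (intro sum.cong refl) (auto simp: q)
    also have "\<dots> = x \<bullet> y" by (simp add: sum.delta euclidean_inner[of x y])
    finally show ?thesis .
  qed
  ultimately have "orthogonal_transformation Q" by (simp add: orthogonal_transformation_def)
  moreover define a where "a j = inv_into Basis p (b j)" for j
  have pa: "a j \<in> Basis \<and> p (a j) = b j" if "j \<in> J" for j
  proof -
    have "b j \<in> p ` Basis" using p that by (auto simp: bij_betw_def W_def)
    then show ?thesis by (simp add: a_def inv_into_into f_inv_into_f)
  qed
  have "inj_on a J" by (rule inj_onI) (metis pa inj inj_onD)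
  moreover have "Q (a j) = b j" if "j \<in> J" for j
  proof -
    have "Q (a j) = (\<Sum>e\<in>Basis. if e = a j then q e else 0)"
      unfolding Q_def using pa[OF that] by (intro sum.cong refl) (auto simp: inner_Basis)
    also have "\<dots> = b j" using pa[OF that] b1[OF that] by (simp add: sum.delta' q_def)
    finally show ?thesis .
  qed
  ultimately show ?thesis using pa by blast
qed

lemma measurable_frame_coords [measurable]:
  "(\<lambda>z :: 'a::euclidean_space. \<lambda>j\<in>J. b j \<bullet> z) \<in> borel \<rightarrow>\<^sub>M (\<Pi>\<^sub>M j\<in>J. N01)"
  by (rule measurable_restrict) simp

text \<open>
  Coordinates of a standard Gaussian vector in an orthonormal system are independent standard
  Gaussian variables: after a rotation the system consists of standard basis vectors, for
  which the density factorises.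
\<close>

lemma distr_gauss_orthonormal:
  fixes b :: "'j \<Rightarrow> 'a::euclidean_space"
  assumes J: "finite J" and b: "\<And>i j. i \<in> J \<Longrightarrow> j \<in> J \<Longrightarrow> b i \<bullet> b j = (if i = j then 1 else 0)"
  shows "distr gauss (\<Pi>\<^sub>M j\<in>J. N01) (\<lambda>z. \<lambda>j\<in>J. b j \<bullet> z) = (\<Pi>\<^sub>M j\<in>J. N01)"
proof -
  interpret N: prob_space N01 by (rule prob_space_normal_density) simp
  interpret product_sigma_finite "\<lambda>_::'j. N01"
    by (rule product_sigma_finite.intro) (rule N.sigma_finite_measure_axioms)
  have "\<exists>(Q :: 'a \<Rightarrow> 'a) (a :: 'j \<Rightarrow> 'a). orthogonal_transformation Q \<and> inj_on a J \<and>
      (\<forall>j\<in>J. a j \<in> Basis \<and> Q (a j) = b j)"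
    by (rule orthonormal_family_is_image_of_Basis[OF J]) (simp add: b)
  then obtain Q :: "'a \<Rightarrow> 'a" and a :: "'j \<Rightarrow> 'a" where Q: "orthogonal_transformation Q" and a: "inj_on a J"
    "\<And>j. j \<in> J \<Longrightarrow> a j \<in> Basis" "\<And>j. j \<in> J \<Longrightarrow> Q (a j) = b j"
    by auto
  have Qm [measurable]: "Q \<in> borel_measurable borel"
    using Q by (intro linear_borel_measurable) (simp add: orthogonal_transformation_def)
  show ?thesis
  proof (rule PiM_eqI[OF J])
    fix A :: "'j \<Rightarrow> real set" assume "\<And>j. j \<in> J \<Longrightarrow> A j \<in> sets N01"
    then have A [measurable]: "\<And>j. j \<in> J \<Longrightarrow> A j \<in> sets borel" by simp
    define f where "f e = (if e \<in> a ` J then indicator (A (inv_into J a e)) else (\<lambda>_. 1 :: ennreal))" for e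
    have fa: "f (a j) = indicator (A j)" if "j \<in> J" for j using that a(1) by (simp add: f_def)
    have fm [measurable]: "f e \<in> borel_measurable borel" for e
    proof (cases "e \<in> a ` J")
      case True then show ?thesis using fa A by auto
    qed (auto simp: f_def)
    have meas: "Pi\<^sub>E J A \<in> sets (\<Pi>\<^sub>M j\<in>J. N01)"
      using A J by (intro sets_PiM_I_finite) auto
    have frame: "a j \<bullet> x = b j \<bullet> Q x" if "j \<in> J" for j x
      using Q a(3)[OF that] unfolding orthogonal_transformation_def by metis
    have ind: "indicator (Pi\<^sub>E J A) (\<lambda>j\<in>J. b j \<bullet> Q x) = (\<Prod>e\<in>Basis. f e (x \<bullet> e))" for x
    proof -
      have "(\<Prod>e\<in>Basis. f e (x \<bullet> e)) = (\<Prod>e\<in>a ` J. f e (x \<bullet> e))"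
        using a(2) by (intro prod.mono_neutral_right) (auto simp: f_def)
      also have "\<dots> = (\<Prod>j\<in>J. indicator (A j) (a j \<bullet> x))"
        by (subst prod.reindex[OF a(1)]) (auto simp: fa inner_commute intro!: prod.cong)
      also have "\<dots> = indicator (Pi\<^sub>E J A) (\<lambda>j\<in>J. b j \<bullet> Q x)"
        using J by (auto simp: indicator_def PiE_iff frame prod_zero_iff)
      finally show ?thesis by simp
    qed
    have "emeasure (distr gauss (\<Pi>\<^sub>M j\<in>J. N01) (\<lambda>z. \<lambda>j\<in>J. b j \<bullet> z)) (Pi\<^sub>E J A)
        = (\<integral>\<^sup>+z. indicator (Pi\<^sub>E J A) (\<lambda>j\<in>J. b j \<bullet> z) \<partial>distr gauss borel Q)"
    proof -
      have "emeasure (distr gauss (\<Pi>\<^sub>M j\<in>J. N01) (\<lambda>z. \<lambda>j\<in>J. b j \<bullet> z)) (Pi\<^sub>E J A)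
        = (\<integral>\<^sup>+w. indicator (Pi\<^sub>E J A) w \<partial>distr gauss (\<Pi>\<^sub>M j\<in>J. N01) (\<lambda>z. \<lambda>j\<in>J. b j \<bullet> z))"
        using meas by simp
      also have "\<dots> = (\<integral>\<^sup>+z. indicator (Pi\<^sub>E J A) (\<lambda>j\<in>J. b j \<bullet> z) \<partial>gauss)"
        using meas by (intro nn_integral_distr) auto
      finally show ?thesis unfolding distr_gauss_orthogonal[OF Q] .
    qed
    also have "\<dots> = (\<integral>\<^sup>+x. indicator (Pi\<^sub>E J A) (\<lambda>j\<in>J. b j \<bullet> Q x) \<partial>gauss)"
      using meas by (subst nn_integral_distr) auto
    also have "\<dots> = (\<integral>\<^sup>+x. ennreal (gauss_dens x) * (\<Prod>e\<in>Basis. f e (x \<bullet> e)) \<partial>lborel)"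
      unfolding gauss_def ind by (subst nn_integral_density) auto
    also have "\<dots> = (\<integral>\<^sup>+x. (\<Prod>e\<in>Basis. ennreal (std_normal_density (x \<bullet> e)) * f e (x \<bullet> e)) \<partial>lborel)"
      by (simp add: gauss_dens_def prod_ennreal[symmetric] prod.distrib)
    also have "\<dots> = (\<Prod>e\<in>(Basis :: 'a set). \<integral>\<^sup>+t. ennreal (std_normal_density t) * f e t \<partial>lborel)"
      by (rule nn_integral_lborel_prod[where f="\<lambda>e t. ennreal (std_normal_density t) * f e t"]) auto
    also have "\<dots> = (\<Prod>e\<in>(Basis :: 'a set). \<integral>\<^sup>+t. f e t \<partial>N01)"
      by (intro prod.cong refl nn_integral_density[symmetric]) auto
    also have "\<dots> = (\<Prod>e\<in>a ` J. \<integral>\<^sup>+t. f e t \<partial>N01)"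
      using a(2) N.emeasure_space_1 by (intro prod.mono_neutral_right) (auto simp: f_def)
    also have "\<dots> = (\<Prod>j\<in>J. emeasure N01 (A j))"
      using A by (subst prod.reindex[OF a(1)]) (auto simp: fa intro!: prod.cong)
    finally show "emeasure (distr gauss (\<Pi>\<^sub>M j\<in>J. N01) (\<lambda>z. \<lambda>j\<in>J. b j \<bullet> z)) (Pi\<^sub>E J A) =
      (\<Prod>j\<in>J. emeasure N01 (A j))" .
  qed simp
qed

lemma vec_gauss_eq_gauss: "vec_gauss = (gauss :: (real^'n) measure)"
proof -
  let ?P = "\<Pi>\<^sub>M a\<in>(UNIV::'n set). N01"
  have m: "(\<lambda>z :: real^'n. \<lambda>a\<in>UNIV. axis a 1 \<bullet> z) \<in> gauss \<rightarrow>\<^sub>M ?P"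
    by measurable
  have "?P = distr gauss ?P (\<lambda>z :: real^'n. \<lambda>a\<in>UNIV. axis a 1 \<bullet> z)"
    by (rule distr_gauss_orthonormal[symmetric]) (auto simp: inner_axis_axis)
  then have "vec_gauss = distr (distr gauss ?P (\<lambda>z :: real^'n. \<lambda>a\<in>UNIV. axis a 1 \<bullet> z)) borel vec_lambda"
    unfolding vec_gauss_def by simp
  also have "\<dots> = distr gauss borel (\<lambda>z. z)"
    by (subst distr_distr[OF measurable_vec_lambda_gauss m]) (simp add: comp_def inner_axis' restrict_UNIV vec_nth_inverse)
  also have "\<dots> = gauss" by (rule distr_id2) simp
  finally show ?thesis .
qed

lemma distr_gauss_unit:
  fixes u :: "'a::euclidean_space"
  assumes "norm u = 1"
  shows "distr gauss borel (\<lambda>z. u \<bullet> z) = N01"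
proof -
  have N: "prob_space N01" by (rule prob_space_normal_density) simp
  have "distr (\<Pi>\<^sub>M j\<in>{()}. N01) N01 (\<lambda>w. w ()) = N01"
    by (rule distr_PiM_component) (auto simp: N)
  moreover have "(\<Pi>\<^sub>M j\<in>{()}. N01) = distr gauss (\<Pi>\<^sub>M j\<in>{()}. N01) (\<lambda>z. \<lambda>j\<in>{()}. u \<bullet> z)"
    using assms by (intro distr_gauss_orthonormal[symmetric]) (auto simp: norm_eq_1)
  ultimately have "N01 = distr (distr gauss (\<Pi>\<^sub>M j\<in>{()}. N01) (\<lambda>z. \<lambda>j\<in>{()}. u \<bullet> z)) N01 (\<lambda>w. w ())"
    by simp
  also have "\<dots> = distr gauss N01 (\<lambda>z. u \<bullet> z)"
    by (subst distr_distr) (auto simp: comp_def)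
  also have "\<dots> = distr gauss borel (\<lambda>z. u \<bullet> z)" by (intro distr_cong) auto
  finally show ?thesis by simp
qed

text \<open>
  If \<open>x\<close> and \<open>y\<close> are independent standard Gaussian vectors, then so is \<open>a x + b y\<close> for
  \<open>a\<^sup>2 + b\<^sup>2 = 1\<close>: it is the first component of a rotation of the pair \<open>(x, y)\<close>. This is
  the source of the semigroup property of the heat flow.
\<close>

lemma distr_gauss_pair:
  fixes a b :: real
  assumes ab: "a\<^sup>2 + b\<^sup>2 = 1"
  shows "distr (gauss \<Otimes>\<^sub>M gauss) borel (\<lambda>(x, y). a *\<^sub>R x + b *\<^sub>R y) = (gauss :: 'a::euclidean_space measure)"
proof -
  interpret G: prob_space "gauss :: 'a measure" by (rule prob_space_gauss)
  have fm [measurable]: "fst \<in> (borel :: ('a \<times> 'a) measure) \<rightarrow>\<^sub>M borel"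
    by (intro borel_measurable_continuous_onI continuous_intros)
  have sm [measurable]: "snd \<in> (borel :: ('a \<times> 'a) measure) \<rightarrow>\<^sub>M borel"
    by (intro borel_measurable_continuous_onI continuous_intros)
  have pair: "(gauss \<Otimes>\<^sub>M gauss :: ('a \<times> 'a) measure) = gauss"
  proof -
    have "(gauss \<Otimes>\<^sub>M gauss :: ('a \<times> 'a) measure)
        = density (lborel \<Otimes>\<^sub>M lborel) (\<lambda>(x, y). ennreal (gauss_dens x) * ennreal (gauss_dens y))"
      unfolding gauss_def
      by (rule pair_measure_density)
        (use G.sigma_finite_measure_axioms in \<open>auto simp: gauss_def sigma_finite_lborel\<close>)
    also have "\<dots> = gauss"
      unfolding lborel_prod gauss_def split_beta'
    proof (rule density_cong)
      show "AE p in lborel. ennreal (gauss_dens (fst p)) * ennreal (gauss_dens (snd p)) = ennreal (gauss_dens (p :: 'a \<times> 'a))"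
        by (auto simp: gauss_dens_norm norm_Pair ennreal_mult[symmetric] power_add exp_add[symmetric] add_divide_distrib)
    qed measurable
    finally show ?thesis .
  qed
  define Q where "Q p = (case p of (x, y) \<Rightarrow> (a *\<^sub>R x + b *\<^sub>R y, (- b) *\<^sub>R x + a *\<^sub>R y))" for p :: "'a \<times> 'a"
  have "linear Q"
    by (rule linearI) (auto simp: Q_def scaleR_add_right algebra_simps split: prod.splits)
  moreover have "Q p \<bullet> Q q = p \<bullet> q" for p q
  proof -
    obtain x y x' y' where [simp]: "p = (x, y)" "q = (x', y')" by (cases p, cases q)
    have "Q p \<bullet> Q q = (a\<^sup>2 + b\<^sup>2) * (x \<bullet> x') + (a\<^sup>2 + b\<^sup>2) * (y \<bullet> y')"
      by (simp add: Q_def inner_add_left inner_add_right inner_diff_left inner_diff_right algebra_simps power2_eq_square)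
    then show ?thesis by (simp add: ab)
  qed
  ultimately have Q: "orthogonal_transformation Q" by (simp add: orthogonal_transformation_def)
  have Qm [measurable]: "Q \<in> borel_measurable borel"
    by (rule linear_borel_measurable[OF \<open>linear Q\<close>])
  have "distr (gauss \<Otimes>\<^sub>M gauss) borel (\<lambda>(x, y). a *\<^sub>R x + b *\<^sub>R y) = distr gauss borel (\<lambda>p. fst (Q p))"
    unfolding pair by (intro distr_cong) (auto simp: Q_def)
  also have "\<dots> = distr (distr gauss borel Q) borel fst"
    by (subst distr_distr) (auto simp: comp_def)
  also have "\<dots> = distr (gauss \<Otimes>\<^sub>M gauss) borel (fst :: 'a \<times> 'a \<Rightarrow> 'a)"
    unfolding distr_gauss_orthogonal[OF Q] pair ..
  also have "\<dots> = distr (gauss \<Otimes>\<^sub>M gauss) gauss (fst :: 'a \<times> 'a \<Rightarrow> 'a)"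
    by (intro distr_cong) auto
  also have "\<dots> = gauss"
    by (rule G.distr_pair_fst)
  finally show ?thesis .
qed

lemma integral_gauss_unit:
  fixes u :: "'a::euclidean_space" and f :: "real \<Rightarrow> real"
  assumes u: "norm u = 1" and f [measurable]: "f \<in> borel_measurable borel"
    and int: "integrable lborel (\<lambda>t. std_normal_density t * f t)"
  shows "integrable gauss (\<lambda>z. f (u \<bullet> z))"
    and "(\<integral>z. f (u \<bullet> z) \<partial>gauss) = (\<integral>t. std_normal_density t * f t \<partial>lborel)"
proof -
  have um: "(\<lambda>z. u \<bullet> z) \<in> gauss \<rightarrow>\<^sub>M borel" by simp
  have "integrable N01 f"
    using int by (subst integrable_density) auto
  then show "integrable gauss (\<lambda>z. f (u \<bullet> z))"
    using integrable_distr_eq[OF um f] by (simp add: distr_gauss_unit[OF u])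
  have "(\<integral>z. f (u \<bullet> z) \<partial>gauss) = (\<integral>t. f t \<partial>N01)"
    using integral_distr[OF um f] by (simp add: distr_gauss_unit[OF u])
  then show "(\<integral>z. f (u \<bullet> z) \<partial>gauss) = (\<integral>t. std_normal_density t * f t \<partial>lborel)"
    by (subst (asm) integral_density) auto
qed

lemma gauss_mean:
  fixes v :: "'a::euclidean_space"
  shows "integrable gauss (\<lambda>z. v \<bullet> z)" "(\<integral>z. v \<bullet> z \<partial>gauss) = 0"
proof (atomize (full), cases "v = 0")
  case False
  define u where "u = v /\<^sub>R norm v"
  have u: "norm u = 1" using False by (simp add: u_def)
  have v: "v \<bullet> z = norm v * (u \<bullet> z)" for z using False by (simp add: u_def)
  have "integrable lborel (\<lambda>t. std_normal_density t * t)"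
    using integrable_std_normal_moment[of 1] by simp
  note I = integral_gauss_unit[OF u _ this]
  show "integrable gauss (\<lambda>z. v \<bullet> z) \<and> (\<integral>z. v \<bullet> z \<partial>gauss) = 0"
    unfolding v using I integral_std_normal_moment_odd[of 0] by simp
qed (simp add: inner_zero_left[abs_def])

lemma gauss_variance:
  fixes v :: "'a::euclidean_space"
  shows "integrable gauss (\<lambda>z. (v \<bullet> z)\<^sup>2)" "(\<integral>z. (v \<bullet> z)\<^sup>2 \<partial>gauss) = (norm v)\<^sup>2"
proof (atomize (full), cases "v = 0")
  case False
  define u where "u = v /\<^sub>R norm v"
  have u: "norm u = 1" using False by (simp add: u_def)
  have v: "v \<bullet> z = norm v * (u \<bullet> z)" for z using False by (simp add: u_def)
  have "integrable lborel (\<lambda>t. std_normal_density t * t\<^sup>2)"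
    using integrable_std_normal_moment[of 2] by simp
  note I = integral_gauss_unit[OF u _ this]
  show "integrable gauss (\<lambda>z. (v \<bullet> z)\<^sup>2) \<and> (\<integral>z. (v \<bullet> z)\<^sup>2 \<partial>gauss) = (norm v)\<^sup>2"
    unfolding v power_mult_distrib using I integral_std_normal_moment_even[of 1] by simp
qed simp

text \<open>
  Fourth powers are dominated coordinatewise by the Cauchy-Schwarz inequality for sums; lower
  powers are at most one plus the fourth.
\<close>

lemma integrable_gauss_norm_power:
  assumes "k \<le> 4"
  shows "integrable gauss (\<lambda>z::'a::euclidean_space. norm z ^ k)"
proof -
  interpret prob_space "gauss :: 'a measure" by (rule prob_space_gauss)
  have b4: "integrable gauss (\<lambda>z::'a. (b \<bullet> z)^4)" if "b \<in> Basis" for b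
    using integral_gauss_unit(1)[of b "\<lambda>t. t^4"] integrable_std_normal_moment[of 4] that by simp
  then have "integrable gauss (\<lambda>z::'a. 1 + (\<Sum>b\<in>Basis. (b \<bullet> z)^4) * real DIM('a))"
    by (intro Bochner_Integration.integrable_add integrable_mult_left Bochner_Integration.integrable_sum) auto
  then show ?thesis
  proof (rule Bochner_Integration.integrable_bound)
    show "AE z in gauss. norm (norm (z::'a) ^ k) \<le> norm (1 + (\<Sum>b\<in>Basis. (b \<bullet> z)^4) * real DIM('a))"
    proof (rule AE_I2)
      fix z :: 'a
      have "norm z ^ k \<le> 1 + norm z ^ 4"
      proof (cases "norm z \<le> 1")
        case True
        then have "norm z ^ k \<le> 1" by (simp add: power_le_one)
        then show ?thesis by (simp add: add_increasing2)
      next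
        case False
        then have "norm z ^ k \<le> norm z ^ 4" using assms by (intro power_increasing) auto
        then show ?thesis by simp
      qed
      also have "norm z ^ 4 = (\<Sum>b\<in>Basis. (b \<bullet> z)\<^sup>2)\<^sup>2"
      proof -
        have "(norm z)\<^sup>2 = (\<Sum>b\<in>Basis. (b \<bullet> z)\<^sup>2)"
          by (subst power2_norm_eq_inner, subst euclidean_inner) (simp add: power2_eq_square inner_commute)
        then show ?thesis by (metis power2_eq_square power4_eq_xxxx mult.assoc)
      qed
      also have "\<dots> \<le> (\<Sum>b\<in>Basis. ((b \<bullet> z)\<^sup>2)\<^sup>2) * real DIM('a)"
        by (rule sum_squared_le_sum_of_squares)
      finally show "norm (norm z ^ k) \<le> norm (1 + (\<Sum>b\<in>Basis. (b \<bullet> z)^4) * real DIM('a))"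
        by (simp add: power_mult[symmetric])
    qed
  qed measurable
qed

text \<open>
  Heat flow, run for the time \<open>s\<^sup>2\<close>: the parameter is the standard deviation of the Gaussian
  kernel.
\<close>

definition heat :: "real \<Rightarrow> ('a::euclidean_space \<Rightarrow> real) \<Rightarrow> 'a \<Rightarrow> real" where
  "heat s f x = (\<integral>z. f (x + s *\<^sub>R z) \<partial>gauss)"

lemma heat_0 [simp]:
  fixes x :: "'a::euclidean_space"
  shows "heat 0 f x = f x"
proof -
  interpret prob_space "gauss :: 'a measure" by (rule prob_space_gauss)
  show ?thesis using prob_space by (simp add: heat_def)
qed

lemma heat_measurable [measurable]:
  assumes [measurable]: "f \<in> borel_measurable borel"
  shows "heat s f \<in> borel_measurable borel"
proof -
  interpret prob_space "gauss :: 'a measure" by (rule prob_space_gauss)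
  show ?thesis unfolding heat_def[abs_def] by measurable
qed

lemma integrable_gauss_bounded:
  fixes f :: "'a::euclidean_space \<Rightarrow> real"
  assumes "f \<in> borel_measurable borel" "\<And>x. \<bar>f x\<bar> \<le> C"
  shows "integrable gauss f"
proof -
  interpret prob_space "gauss :: 'a measure" by (rule prob_space_gauss)
  show ?thesis by (rule integrable_const_bound[of _ C]) (use assms in auto)
qed

lemma heat_bounds:
  assumes [measurable]: "f \<in> borel_measurable borel" and f: "\<And>x. a \<le> f x" "\<And>x. f x \<le> b"
  shows "a \<le> heat s f x" "heat s f x \<le> b"
proof -
  interpret prob_space "gauss :: 'a measure" by (rule prob_space_gauss)
  have int: "integrable gauss (\<lambda>z. f (x + s *\<^sub>R z))"
    by (rule integrable_gauss_bounded[of _ "\<bar>a\<bar> + \<bar>b\<bar>"]) (measurable, smt (verit) f)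
  show "a \<le> heat s f x" unfolding heat_def by (rule integral_ge_const[OF int]) (simp add: f)
  show "heat s f x \<le> b" unfolding heat_def by (rule integral_le_const[OF int]) (simp add: f)
qed

lemma heat_heat:
  fixes f :: "'a::euclidean_space \<Rightarrow> real"
  assumes f [measurable]: "f \<in> borel_measurable borel" and b: "\<And>x. \<bar>f x\<bar> \<le> C"
  shows "heat s (heat t f) x = heat (sqrt (s\<^sup>2 + t\<^sup>2)) f x"
proof (cases "s\<^sup>2 + t\<^sup>2 = 0")
  case True
  then have "s = 0" "t = 0" by (auto simp: add_nonneg_eq_0_iff)
  then show ?thesis by simp
next
  case False
  define r where "r = sqrt (s\<^sup>2 + t\<^sup>2)"
  have r: "r > 0" "r\<^sup>2 = s\<^sup>2 + t\<^sup>2"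
    using False by (auto simp: r_def add_nonneg_pos dual_order.strict_iff_order intro: add_nonneg_nonneg)
  have "(s / r)\<^sup>2 + (t / r)\<^sup>2 = 1"
    using r False by (simp add: power_divide add_divide_distrib[symmetric])
  note D = distr_gauss_pair[OF this, where 'a='a]
  interpret prob_space "gauss :: 'a measure" by (rule prob_space_gauss)
  interpret P: pair_prob_space "gauss :: 'a measure" "gauss :: 'a measure" ..
  have m: "(\<lambda>(p, q). (s / r) *\<^sub>R p + (t / r) *\<^sub>R q) \<in> (gauss \<Otimes>\<^sub>M gauss) \<rightarrow>\<^sub>M (borel :: 'a measure)"
    by measurable
  have "heat r f x = (\<integral>w. f (x + r *\<^sub>R w) \<partial>distr (gauss \<Otimes>\<^sub>M gauss) borel (\<lambda>(p, q). (s / r) *\<^sub>R p + (t / r) *\<^sub>R q))"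
    unfolding D heat_def ..
  also have "\<dots> = (\<integral>pq. f (x + r *\<^sub>R (case pq of (p, q) \<Rightarrow> (s / r) *\<^sub>R p + (t / r) *\<^sub>R q)) \<partial>(gauss \<Otimes>\<^sub>M gauss))"
    by (rule integral_distr[OF m]) measurable
  also have "\<dots> = (\<integral>(p, q). f (x + s *\<^sub>R p + t *\<^sub>R q) \<partial>(gauss \<Otimes>\<^sub>M gauss))"
    using r(1) by (intro Bochner_Integration.integral_cong) (auto simp: scaleR_add_right add.assoc split: prod.splits)
  also have "\<dots> = (\<integral>p. (\<integral>q. f (x + s *\<^sub>R p + t *\<^sub>R q) \<partial>gauss) \<partial>gauss)"
  proof (rule P.integral_fst[symmetric])
    show "integrable (gauss \<Otimes>\<^sub>M gauss) (\<lambda>(p, q). f (x + s *\<^sub>R p + t *\<^sub>R q))"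
      by (rule P.P.integrable_const_bound[of _ C]) (use b in \<open>auto split: prod.splits\<close>)
  qed
  also have "\<dots> = heat s (heat t f) x" by (simp add: heat_def)
  finally show ?thesis by (simp add: r_def)
qed

section \<open>The Gaussian distribution function\<close>

abbreviation rho :: "real \<Rightarrow> real" where "rho \<equiv> std_normal_density"

lemma real_distribution_N01: "real_distribution std_normal_distribution"
  by (rule real_dist_normal_dist)

lemma Phi_cdf: "Phi x = cdf std_normal_distribution x"
  by (simp add: Phi_def cdf_def)

lemma rho_has_derivative: "(rho has_real_derivative - x * rho x) (at x)"
  unfolding std_normal_density_def
  by (auto intro!: derivative_eq_intros simp: power2_eq_square field_simps)

lemma rho_continuous: "continuous_on A rho"
  unfolding std_normal_density_def by (intro continuous_intros) auto

lemma Phi_has_derivative: "(Phi has_real_derivative rho x) (at x)"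
proof -
  interpret real_distribution std_normal_distribution by (rule real_distribution_N01)
  have eq: "Phi y = Phi (x - 1) + integral {x-1..y} rho" if "y \<in> {x-1..x+1}" for y
  proof -
    have "Phi y - Phi (x - 1) = measure std_normal_distribution {x-1<..y}"
      using that cdf_diff_eq[of "x-1" y] by (cases "x - 1 < y") (auto simp: Phi_cdf)
    also have "\<dots> = measure std_normal_distribution {x-1..y}"
    proof -
      have "AE t in lborel. t \<noteq> x - 1" by (rule AE_lborel_singleton)
      then have "AE t in std_normal_distribution. t \<noteq> x - 1"
        by (subst AE_density) auto
      then show ?thesis
        by (intro finite_measure_eq_AE) auto
    qed
    also have "\<dots> = set_lebesgue_integral lborel {x-1..y} rho"
      unfolding measure_def set_lebesgue_integral_def
      by (subst emeasure_density, simp, simp, subst integral_eq_nn_integral)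
         (auto intro!: arg_cong[where f=enn2real] nn_integral_cong simp: indicator_def)
    also have "\<dots> = integral {x-1..y} rho"
      by (rule set_borel_integral_eq_integral)
         (intro borel_integrable_compact[unfolded set_integrable_def[symmetric]] rho_continuous compact_Icc)
    finally show ?thesis by simp
  qed
  have "((\<lambda>y. Phi (x - 1) + integral {x-1..y} rho) has_real_derivative rho x) (at x within {x-1..x+1})"
    using DERIV_add[OF DERIV_const[of "Phi (x - 1)"] integral_has_real_derivative[OF rho_continuous, of x "x - 1" "x + 1"]]
    by simp
  then have "(Phi has_real_derivative rho x) (at x within {x-1..x+1})"
  proof (rule has_field_derivative_transform_within[of _ _ _ _ 1])
    fix y assume "y \<in> {x-1..x+1}"
    from eq[OF this] show "Phi (x - 1) + integral {x-1..y} rho = Phi y" by simp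
  qed auto
  moreover have "at x within {x-1..x+1} = at x"
    by (rule at_within_interior) (simp add: interior_atLeastAtMost_real)
  ultimately show ?thesis by simp
qed

lemma rho_pos [simp]: "0 < rho x"
  by (simp add: std_normal_density_def)

text \<open>
  The crude constant is enough to bound the second and third derivatives of \<open>Phi\<close>, which are
  \<open>- x * rho x\<close> and \<open>(x\<^sup>2 - 1) * rho x\<close>.
\<close>

lemma rho_bound: "(t\<^sup>2 + 1) * rho t \<le> 3"
proof -
  have "t\<^sup>2 / 2 \<le> exp (t\<^sup>2 / 2)" "1 \<le> exp (t\<^sup>2 / 2)"
    using exp_ge_add_one_self[of "t\<^sup>2/2"] zero_le_power2[of t] by linarith+
  then have "t\<^sup>2 + 1 \<le> 3 * exp (t\<^sup>2 / 2)" by linarith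
  then have "(t\<^sup>2 + 1) * exp (- t\<^sup>2 / 2) \<le> 3"
    by (simp add: exp_minus field_simps)
  moreover have "1 / sqrt (2 * pi) \<le> 1"
    using pi_gt3 by (simp add: field_simps)
  ultimately have "1 / sqrt (2 * pi) * ((t\<^sup>2 + 1) * exp (- t\<^sup>2 / 2)) \<le> 1 * 3"
    by (intro mult_mono) auto
  then show ?thesis by (simp add: std_normal_density_def mult_ac)
qed

lemma rho_le: "rho t \<le> 3"
proof -
  have "1 * rho t \<le> (t\<^sup>2 + 1) * rho t" by (intro mult_right_mono) auto
  then show ?thesis using rho_bound[of t] by linarith
qed

lemma Phi_taylor2: "\<bar>Phi b - Phi a - rho a * (b - a)\<bar> \<le> (b - a)\<^sup>2"
proof (cases "b = a")
  case False
  define df where "df m = (case m of 0 \<Rightarrow> Phi | Suc 0 \<Rightarrow> rho | _ \<Rightarrow> (\<lambda>x. - x * rho x))" for m :: nat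
  have "\<exists>t. (if b < a then b < t \<and> t < a else a < t \<and> t < b) \<and>
      Phi b = (\<Sum>m<2. (df m a / fact m) * (b - a) ^ m) + (df 2 t / fact 2) * (b - a) ^ 2"
  proof (rule Taylor[of 2 df Phi "min a b" "max a b"])
    show "\<forall>m t. m < 2 \<and> min a b \<le> t \<and> t \<le> max a b \<longrightarrow> (df m has_real_derivative df (Suc m) t) (at t)"
      using Phi_has_derivative rho_has_derivative
      by (auto simp: df_def numeral_2_eq_2 less_Suc_eq)
  qed (use False in \<open>auto simp: df_def\<close>)
  then obtain t where "Phi b = Phi a + rho a * (b - a) + (- t * rho t) / 2 * (b - a)\<^sup>2"
    by (auto simp: df_def numeral_2_eq_2)
  then have "\<bar>Phi b - Phi a - rho a * (b - a)\<bar> = \<bar>t\<bar> * rho t / 2 * (b - a)\<^sup>2"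
    by (simp add: abs_mult)
  also have "\<dots> \<le> 1 * (b - a)\<^sup>2"
  proof (rule mult_right_mono)
    have "2 * \<bar>t\<bar> \<le> t\<^sup>2 + 1" using zero_le_power2[of "\<bar>t\<bar> - 1"] by (simp add: power2_diff)
    then have "2 * \<bar>t\<bar> * rho t \<le> (t\<^sup>2 + 1) * rho t" by (intro mult_right_mono) auto
    then show "\<bar>t\<bar> * rho t / 2 \<le> 1" using rho_bound[of t] by linarith
  qed simp
  finally show ?thesis by simp
qed simp

lemma Phi_taylor3: "\<bar>Phi b - Phi a - rho a * (b - a) + a * rho a / 2 * (b - a)\<^sup>2\<bar> \<le> \<bar>b - a\<bar> ^ 3"
proof (cases "b = a")
  case False
  define df where "df m = (case m of 0 \<Rightarrow> Phi | Suc 0 \<Rightarrow> rho | Suc (Suc 0) \<Rightarrow> (\<lambda>x. - x * rho x)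
    | _ \<Rightarrow> (\<lambda>x. (x\<^sup>2 - 1) * rho x))" for m :: nat
  have d2: "((\<lambda>x. - x * rho x) has_real_derivative (x\<^sup>2 - 1) * rho x) (at x)" for x
    by (auto intro!: derivative_eq_intros rho_has_derivative simp: power2_eq_square algebra_simps)
  have "\<exists>t. (if b < a then b < t \<and> t < a else a < t \<and> t < b) \<and>
      Phi b = (\<Sum>m<3. (df m a / fact m) * (b - a) ^ m) + (df 3 t / fact 3) * (b - a) ^ 3"
  proof (rule Taylor[of 3 df Phi "min a b" "max a b"])
    show "\<forall>m t. m < 3 \<and> min a b \<le> t \<and> t \<le> max a b \<longrightarrow> (df m has_real_derivative df (Suc m) t) (at t)"
      using Phi_has_derivative rho_has_derivative d2
      by (auto simp: df_def numeral_3_eq_3 less_Suc_eq)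
  qed (use False in \<open>auto simp: df_def\<close>)
  then obtain t where "Phi b = Phi a + rho a * (b - a) + (- a * rho a) / 2 * (b - a)\<^sup>2 + ((t\<^sup>2 - 1) * rho t) / 6 * (b - a)^3"
    by (auto simp: df_def numeral_3_eq_3 numeral_2_eq_2 fact_numeral)
  then have "\<bar>Phi b - Phi a - rho a * (b - a) + a * rho a / 2 * (b - a)\<^sup>2\<bar> = \<bar>t\<^sup>2 - 1\<bar> * rho t / 6 * \<bar>b - a\<bar>^3"
    by (simp add: abs_mult power_abs)
  also have "\<dots> \<le> 1 * \<bar>b - a\<bar>^3"
  proof (rule mult_right_mono)
    have "\<bar>t\<^sup>2 - 1\<bar> * rho t \<le> (t\<^sup>2 + 1) * rho t"
      by (intro mult_right_mono) (auto simp: abs_le_iff)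
    then show "\<bar>t\<^sup>2 - 1\<bar> * rho t / 6 \<le> 1" using rho_bound[of t] by linarith
  qed simp
  finally show ?thesis by simp
qed simp

lemma Phi_strict_mono: "strict_mono Phi"
  by (rule strict_monoI, rule DERIV_pos_imp_increasing) (use Phi_has_derivative in \<open>auto intro!: exI[of _ "rho _"]\<close>)

lemma Phi_less_iff [simp]: "Phi a < Phi b \<longleftrightarrow> a < b"
  using strict_mono_less[OF Phi_strict_mono] .

lemma Phi_le_iff [simp]: "Phi a \<le> Phi b \<longleftrightarrow> a \<le> b"
  using strict_mono_less_eq[OF Phi_strict_mono] .

lemma Phi_continuous: "continuous_on A Phi"
  by (meson DERIV_continuous_on Phi_has_derivative has_field_derivative_at_within)

lemma Phi_measurable [measurable]: "Phi \<in> borel_measurable borel"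
  by (rule borel_measurable_continuous_onI[OF Phi_continuous])

lemma Phi_bot: "(Phi \<longlongrightarrow> 0) at_bot"
proof -
  interpret real_distribution std_normal_distribution by (rule real_distribution_N01)
  show ?thesis using cdf_lim_at_bot by (simp add: Phi_cdf[abs_def])
qed

lemma Phi_top: "(Phi \<longlongrightarrow> 1) at_top"
proof -
  interpret real_distribution std_normal_distribution by (rule real_distribution_N01)
  show ?thesis using cdf_lim_at_top_prob by (simp add: Phi_cdf[abs_def])
qed

lemma Phi_pos [simp]: "0 < Phi x"
proof -
  have "0 \<le> Phi (x - 1)" by (simp add: Phi_def)
  also have "\<dots> < Phi x" by simp
  finally show ?thesis .
qed

lemma Phi_less_1 [simp]: "Phi x < 1"
proof -
  interpret real_distribution std_normal_distribution by (rule real_distribution_N01)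
  have "Phi x < Phi (x + 1)" by simp
  also have "\<dots> \<le> 1" by (simp add: Phi_def)
  finally show ?thesis .
qed

lemma Phi_onto:
  assumes "0 < p" "p < 1" shows "\<exists>x. Phi x = p"
proof -
  obtain a where a: "Phi a < p"
    using order_tendstoD(2)[OF Phi_bot assms(1)] by (auto simp: eventually_at_bot_linorder)
  obtain b where b: "p < Phi b"
    using order_tendstoD(1)[OF Phi_top assms(2)] by (auto simp: eventually_at_top_linorder)
  have "a \<le> b" using a b Phi_le_iff[of b a] by linarith
  then show ?thesis
    using IVT'[of Phi a p b] a b Phi_continuous by auto
qed

definition Psi :: "real \<Rightarrow> real" where "Psi = inv Phi"

lemma Phi_Psi: "0 < p \<Longrightarrow> p < 1 \<Longrightarrow> Phi (Psi p) = p"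
  unfolding Psi_def by (rule f_inv_into_f) (use Phi_onto in fastforce)

lemma Psi_Phi [simp]: "Psi (Phi x) = x"
  unfolding Psi_def using strict_mono_imp_inj_on[OF Phi_strict_mono] by (rule inv_f_f)

lemma Psi_le_iff: "0 < p \<Longrightarrow> p < 1 \<Longrightarrow> 0 < q \<Longrightarrow> q < 1 \<Longrightarrow> Psi p \<le> Psi q \<longleftrightarrow> p \<le> q"
  by (metis Phi_Psi Phi_le_iff)

lemma Psi_mono: "0 < p \<Longrightarrow> p \<le> q \<Longrightarrow> q < 1 \<Longrightarrow> Psi p \<le> Psi q"
  by (subst Psi_le_iff) auto

lemma Psi_continuous:
  assumes "0 < p" "p < 1" shows "isCont Psi p"
proof -
  have "isCont Psi (Phi (Psi p))"
    by (rule isCont_inverse_function[of 1])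
       (auto intro: DERIV_isCont[OF Phi_has_derivative])
  then show ?thesis using assms by (simp add: Phi_Psi)
qed

text \<open>
  The density is smallest at the ends of the interval, so \<open>Phi\<close> grows there at the rate
  \<open>rho M\<close> at least; it turns errors in \<open>Phi u\<close> into errors in \<open>u\<close>.
\<close>

lemma Phi_diff_lower:
  assumes "\<bar>a\<bar> \<le> M" "\<bar>b\<bar> \<le> M" shows "rho M * \<bar>b - a\<bar> \<le> \<bar>Phi b - Phi a\<bar>"
proof -
  have *: "rho M * (b - a) \<le> Phi b - Phi a" if ab: "a < b" "\<bar>a\<bar> \<le> M" "\<bar>b\<bar> \<le> M" for a b
  proof -
    obtain z where z: "a < z" "z < b" "Phi b - Phi a = (b - a) * rho z"
      using MVT2[of a b Phi rho] ab Phi_has_derivative by blast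
    have "z\<^sup>2 \<le> M\<^sup>2" using z ab by (auto simp: abs_le_square_iff[symmetric])
    then have "rho M \<le> rho z" by (simp add: std_normal_density_def divide_right_mono)
    then show ?thesis using z ab by (simp add: mult.commute mult_left_mono)
  qed
  consider "a < b" | "a = b" | "b < a" by linarith
  then show ?thesis
  proof cases
    case 1 then show ?thesis using *[of a b] assms by simp
  next
    case 3
    then have "Phi b < Phi a" by simp
    then show ?thesis using *[of b a] assms 3 by simp
  qed simp
qed

section \<open>Functions with Lipschitz gradient\<close>

text \<open>
  \<open>f\<close> is Lipschitz and agrees with its linearisation up to a quadratic error, with one constant
  for both bounds. The gradient \<open>g\<close> is carried along explicitly, so that the class is visibly
  closed under averaging. This regularity, stable under the heat flow, takes the place of two
  derivatives.
\<close>

definition C11 :: "real \<Rightarrow> ('a::euclidean_space \<Rightarrow> real) \<Rightarrow> ('a \<Rightarrow> 'a) \<Rightarrow> bool" where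
  "C11 K f g \<longleftrightarrow> f \<in> borel_measurable borel \<and> g \<in> borel_measurable borel \<and>
    (\<forall>x. norm (g x) \<le> K) \<and> (\<forall>x h. \<bar>f (x + h) - f x\<bar> \<le> K * norm h) \<and>
    (\<forall>x h. \<bar>f (x + h) - f x - g x \<bullet> h\<bar> \<le> K * (norm h)\<^sup>2)"

lemma C11D:
  assumes "C11 K f g"
  shows "f \<in> borel_measurable borel" "g \<in> borel_measurable borel" "norm (g x) \<le> K"
    "\<bar>f (x + h) - f x\<bar> \<le> K * norm h" "\<bar>f (x + h) - f x - g x \<bullet> h\<bar> \<le> K * (norm h)\<^sup>2"
  using assms by (auto simp: C11_def)

lemma C11_mono: "C11 K f g \<Longrightarrow> K \<le> K' \<Longrightarrow> C11 K' f g"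
  unfolding C11_def by (meson mult_right_mono norm_ge_zero order_trans zero_le_power2)

text \<open>
  Averaging translates of \<open>f\<close> averages the three estimates, so that the constant does not
  deteriorate along the flow.
\<close>

lemma C11_heat:
  fixes f :: "'a::euclidean_space \<Rightarrow> real"
  assumes f: "C11 K f g" and b: "\<And>x. \<bar>f x\<bar> \<le> C"
  shows "C11 K (heat s f) (\<lambda>x. \<integral>z. g (x + s *\<^sub>R z) \<partial>gauss)"
proof -
  interpret prob_space "gauss :: 'a measure" by (rule prob_space_gauss)
  note [measurable] = C11D(1,2)[OF f]
  have If: "integrable gauss (\<lambda>z. f (x + s *\<^sub>R z))" for x
    by (rule integrable_gauss_bounded[of _ C]) (use b in auto)
  have Ig: "integrable gauss (\<lambda>z. g (x + s *\<^sub>R z))" for x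
    by (rule integrable_const_bound[of _ K]) (use C11D(3)[OF f] in auto)
  have If': "integrable gauss (\<lambda>z. f ((x + s *\<^sub>R z) + h))" for x h
    using If[of "x + h"] by (simp add: algebra_simps)
  have avg: "\<bar>\<integral>z. \<phi> z \<partial>gauss\<bar> \<le> c" if "integrable gauss \<phi>" "\<And>z. \<bar>\<phi> z\<bar> \<le> c" for \<phi> :: "'a \<Rightarrow> real" and c
  proof -
    have "\<bar>\<integral>z. \<phi> z \<partial>gauss\<bar> \<le> (\<integral>z. \<bar>\<phi> z\<bar> \<partial>gauss)" by (rule integral_abs_bound)
    also have "\<dots> \<le> c" using that by (intro integral_le_const) auto
    finally show ?thesis .
  qed
  have 1: "norm (\<integral>z. g (x + s *\<^sub>R z) \<partial>gauss) \<le> K" for x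
  proof -
    have "norm (\<integral>z. g (x + s *\<^sub>R z) \<partial>gauss) \<le> (\<integral>z. norm (g (x + s *\<^sub>R z)) \<partial>gauss)"
      by (rule integral_norm_bound)
    also have "\<dots> \<le> K" using Ig C11D(3)[OF f] by (intro integral_le_const) auto
    finally show ?thesis .
  qed
  have 2: "\<bar>heat s f (x + h) - heat s f x\<bar> \<le> K * norm h" for x h
  proof -
    have "heat s f (x + h) - heat s f x = (\<integral>z. f ((x + s *\<^sub>R z) + h) - f (x + s *\<^sub>R z) \<partial>gauss)"
      unfolding heat_def using If[of "x + h"] If[of x]
      by (subst Bochner_Integration.integral_diff) (auto simp: algebra_simps)
    also have "\<bar>\<dots>\<bar> \<le> K * norm h"
      by (intro avg Bochner_Integration.integrable_diff If If' C11D(4)[OF f])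
    finally show ?thesis .
  qed
  have 3: "\<bar>heat s f (x + h) - heat s f x - (\<integral>z. g (x + s *\<^sub>R z) \<partial>gauss) \<bullet> h\<bar> \<le> K * (norm h)\<^sup>2" for x h
  proof -
    have "heat s f (x + h) - heat s f x - (\<integral>z. g (x + s *\<^sub>R z) \<partial>gauss) \<bullet> h
      = (\<integral>z. f ((x + s *\<^sub>R z) + h) - f (x + s *\<^sub>R z) - g (x + s *\<^sub>R z) \<bullet> h \<partial>gauss)"
      unfolding heat_def using If[of "x + h"] If[of x] Ig[of x]
      by (simp add: algebra_simps)
    also have "\<bar>\<dots>\<bar> \<le> K * (norm h)\<^sup>2"
      by (intro avg Bochner_Integration.integrable_diff integrable_inner_left Ig If If' C11D(5)[OF f])
    finally show ?thesis .
  qed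
  show ?thesis unfolding C11_def using 1 2 3 by auto
qed

text \<open>
  On \<open>[c e, c]\<close> the inverse of \<open>Phi\<close> is smooth with bounded derivatives, since \<open>e > 0\<close> and
  \<open>c < 1\<close> keep away from the two points where it blows up. The gradient is \<open>c G / rho u\<close>, and the
  estimates for \<open>u\<close> are read off from those of \<open>Phi u = c F\<close>. The new constant depends on \<open>K\<close>,
  \<open>c\<close> and \<open>e\<close> only.
\<close>

lemma C11_Psi:
  assumes c: "0 < c" "c < 1" and e: "0 < e" "e \<le> 1"
  shows "\<exists>K'. \<forall>F G :: 'a::euclidean_space \<Rightarrow> _. C11 K F G \<longrightarrow> (\<forall>x. e \<le> F x \<and> F x \<le> 1) \<longrightarrow>
    C11 K' (\<lambda>x. Psi (c * F x)) (\<lambda>x. (c / rho (Psi (c * F x))) *\<^sub>R G x)"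
proof -
  define M where "M = \<bar>Psi (c * e)\<bar> + \<bar>Psi c\<bar>"
  define k where "k = rho M"
  have k: "k > 0" by (simp add: k_def)
  have ce: "0 < c * e" "c * e \<le> c" using c e by (auto simp: mult_left_le)
  define K' where "K' = K / k + \<bar>K\<bar> / k + K\<^sup>2 / k ^ 3"
  have "C11 K' (\<lambda>x. Psi (c * F x)) (\<lambda>x. (c / rho (Psi (c * F x))) *\<^sub>R G x)"
    if F: "C11 K F G" and b: "\<forall>x. e \<le> F x \<and> F x \<le> 1" for F and G :: "'a \<Rightarrow> 'a"
  proof -
    note [measurable] = C11D(1,2)[OF F]
    have K0: "K \<ge> 0" using C11D(3)[OF F, of 0] norm_ge_zero order_trans by blast
    have "0 \<le> K / k" "0 \<le> K\<^sup>2 / k ^ 3" using K0 k by auto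
    then have K': "K / k \<le> K'" "K / k + K\<^sup>2 / k ^ 3 \<le> K'" using K0 unfolding K'_def by linarith+
    define u where "u x = Psi (c * F x)" for x
    have r: "0 < c * F x" "c * F x < 1" "c * e \<le> c * F x" "c * F x \<le> c" for x
      using b[rule_format, of x] c e by (auto simp: mult_left_le intro: le_less_trans[of _ c] mult_pos_pos)
    have Phiu: "Phi (u x) = c * F x" for x using r[of x] by (simp add: u_def Phi_Psi)
    have uM: "\<bar>u x\<bar> \<le> M" for x
    proof -
      have "Psi (c * e) \<le> u x" unfolding u_def by (rule Psi_mono[OF ce(1) r(3) r(2)])
      moreover have "u x \<le> Psi c" unfolding u_def by (rule Psi_mono[OF r(1) r(4) c(2)])
      ultimately show ?thesis unfolding M_def by linarith
    qed
    have ru: "k \<le> rho (u x)" for x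
    proof -
      have "(u x)\<^sup>2 \<le> M\<^sup>2" using uM[of x] abs_le_square_iff[of "u x" M] by auto
      then show ?thesis by (simp add: k_def std_normal_density_def divide_right_mono)
    qed
    have lip: "\<bar>u (x + h) - u x\<bar> \<le> K / k * norm h" for x h
    proof -
      have "k * \<bar>u (x + h) - u x\<bar> \<le> \<bar>c * F (x + h) - c * F x\<bar>"
        using Phi_diff_lower[OF uM[of x] uM[of "x + h"]] by (simp add: k_def Phiu)
      also have "\<dots> = c * \<bar>F (x + h) - F x\<bar>"
        using c by (simp add: abs_mult right_diff_distrib[symmetric])
      also have "\<dots> \<le> 1 * (K * norm h)"
        using c by (intro mult_mono C11D(4)[OF F]) auto
      finally show ?thesis using k by (simp add: field_simps)
    qed
    have second: "\<bar>u (x + h) - u x - ((c / rho (u x)) *\<^sub>R G x) \<bullet> h\<bar> \<le> (K / k + K\<^sup>2 / k ^ 3) * (norm h)\<^sup>2" for x h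
    proof -
      define D where "D = u (x + h) - u x"
      have "\<bar>c * F (x + h) - c * F x - rho (u x) * D\<bar> \<le> D\<^sup>2"
        using Phi_taylor2[of "u (x + h)" "u x"] by (simp add: Phiu D_def)
      moreover have "\<bar>c * (F (x + h) - F x - G x \<bullet> h)\<bar> \<le> 1 * (K * (norm h)\<^sup>2)"
        unfolding abs_mult using c by (intro mult_mono C11D(5)[OF F]) auto
      ultimately have "\<bar>rho (u x) * D - c * (G x \<bullet> h)\<bar> \<le> D\<^sup>2 + K * (norm h)\<^sup>2"
        by (simp add: algebra_simps abs_le_iff)
      also have "D\<^sup>2 \<le> (K / k * norm h)\<^sup>2"
        using power_mono[OF lip[of x h], of 2] by (simp add: D_def)
      finally have *: "\<bar>rho (u x) * D - c * (G x \<bullet> h)\<bar> \<le> (K / k * norm h)\<^sup>2 + K * (norm h)\<^sup>2" by simp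
      have "D - ((c / rho (u x)) *\<^sub>R G x) \<bullet> h = (rho (u x) * D - c * (G x \<bullet> h)) / rho (u x)"
        by (simp add: diff_divide_distrib less_imp_neq[OF rho_pos, symmetric])
      then have "\<bar>D - ((c / rho (u x)) *\<^sub>R G x) \<bullet> h\<bar> = \<bar>rho (u x) * D - c * (G x \<bullet> h)\<bar> / rho (u x)"
        by (simp add: abs_divide)
      also have "\<dots> \<le> ((K / k * norm h)\<^sup>2 + K * (norm h)\<^sup>2) / k"
        using * ru[of x] k K0 by (intro frac_le) auto
      also have "\<dots> = (K / k + K\<^sup>2 / k ^ 3) * (norm h)\<^sup>2"
        using k by (simp add: field_simps power2_eq_square power3_eq_cube)
      finally show ?thesis by (simp add: D_def)
    qed
    have grad: "norm ((c / rho (u x)) *\<^sub>R G x) \<le> K / k" for x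
    proof -
      have "norm ((c / rho (u x)) *\<^sub>R G x) = c * norm (G x) / rho (u x)"
        using c by simp
      also have "\<dots> \<le> K / k"
        using ru[of x] k K0 C11D(3)[OF F, of x] c
        by (intro frac_le) (auto intro: order_trans[OF mult_right_mono[of c 1]])
      finally show ?thesis .
    qed
    have um [measurable]: "u \<in> borel_measurable borel"
    proof -
      have "continuous_on UNIV u"
      proof (rule lipschitz_on_continuous_on)
        show "(K / k)-lipschitz_on UNIV u"
        proof (rule lipschitz_onI)
          fix x y show "dist (u x) (u y) \<le> K / k * dist x y"
            using lip[of y "x - y"] by (simp add: dist_norm)
        qed (use K0 k in auto)
      qed
      then show ?thesis by (rule borel_measurable_continuous_onI)
    qed
    have rm [measurable]: "rho \<in> borel_measurable borel"
      by (rule borel_measurable_continuous_onI[OF rho_continuous])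
    show ?thesis
      unfolding C11_def u_def[symmetric]
    proof (intro conjI allI)
      show "(\<lambda>x. (c / rho (u x)) *\<^sub>R G x) \<in> borel_measurable borel" by measurable
      show "u \<in> borel_measurable borel" by (rule um)
      fix x h
      show "norm ((c / rho (u x)) *\<^sub>R G x) \<le> K'" using grad[of x] K' by linarith
      show "\<bar>u (x + h) - u x\<bar> \<le> K' * norm h"
        using lip[of x h] mult_right_mono[OF K'(1), of "norm h"] by simp
      show "\<bar>u (x + h) - u x - ((c / rho (u x)) *\<^sub>R G x) \<bullet> h\<bar> \<le> K' * (norm h)\<^sup>2"
        using second[of x h] mult_right_mono[OF K'(2), of "(norm h)\<^sup>2"] by simp
    qed
  qed
  then show ?thesis by blast
qed

lemma C11_I:
  assumes "f \<in> borel_measurable borel" "g \<in> borel_measurable borel"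
    "\<And>x. norm (g x) \<le> K" "\<And>x h. \<bar>f (x + h) - f x\<bar> \<le> K * norm h"
    "\<And>x h. \<bar>f (x + h) - f x - g x \<bullet> h\<bar> \<le> K * (norm h)\<^sup>2"
  shows "C11 K f g"
  using assms by (simp add: C11_def)

lemma C11_nonneg: "C11 K f g \<Longrightarrow> 0 \<le> K"
  using C11D(3) norm_ge_zero order_trans by blast

lemma C11_const: "C11 0 (\<lambda>x. c) (\<lambda>x. 0)"
  by (rule C11_I) auto

lemma C11_add:
  assumes f: "C11 K f g" and f': "C11 K' f' g'"
  shows "C11 (K + K') (\<lambda>x. f x + f' x) (\<lambda>x. g x + g' x)"
proof (rule C11_I)
  note [measurable] = C11D(1,2)[OF f] C11D(1,2)[OF f']
  show "(\<lambda>x. f x + f' x) \<in> borel_measurable borel" "(\<lambda>x. g x + g' x) \<in> borel_measurable borel" by measurable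
  fix x h
  show "norm (g x + g' x) \<le> K + K'"
    using norm_triangle_ineq[of "g x" "g' x"] C11D(3)[OF f, of x] C11D(3)[OF f', of x] by linarith
  show "\<bar>f (x + h) + f' (x + h) - (f x + f' x)\<bar> \<le> (K + K') * norm h"
    using C11D(4)[OF f, of x h] C11D(4)[OF f', of x h] unfolding distrib_right by linarith
  show "\<bar>f (x + h) + f' (x + h) - (f x + f' x) - (g x + g' x) \<bullet> h\<bar> \<le> (K + K') * (norm h)\<^sup>2"
    using C11D(5)[OF f, of x h] C11D(5)[OF f', of x h] unfolding distrib_right inner_add_left by linarith
qed

lemma C11_sum:
  assumes "finite J" "\<And>j. j \<in> J \<Longrightarrow> C11 (K j) (f j) (g j)"
  shows "C11 (\<Sum>j\<in>J. K j) (\<lambda>x. \<Sum>j\<in>J. f j x) (\<lambda>x. \<Sum>j\<in>J. g j x)"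
  using assms by (induction rule: finite_induct) (simp_all add: C11_const C11_add)

lemma C11_affine:
  assumes f: "C11 K f g"
  shows "C11 (\<bar>a\<bar> * K) (\<lambda>x. a * f x + b) (\<lambda>x. a *\<^sub>R g x)"
proof (rule C11_I)
  note [measurable] = C11D(1,2)[OF f]
  show "(\<lambda>x. a * f x + b) \<in> borel_measurable borel" "(\<lambda>x. a *\<^sub>R g x) \<in> borel_measurable borel" by measurable
  fix x h
  show "norm (a *\<^sub>R g x) \<le> \<bar>a\<bar> * K"
    using mult_left_mono[OF C11D(3)[OF f, of x] abs_ge_zero[of a]] by simp
  have "a * f (x + h) + b - (a * f x + b) = a * (f (x + h) - f x)" by (simp add: algebra_simps)
  then show "\<bar>a * f (x + h) + b - (a * f x + b)\<bar> \<le> \<bar>a\<bar> * K * norm h"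
    using mult_left_mono[OF C11D(4)[OF f, of x h] abs_ge_zero[of a]] by (simp add: abs_mult mult.assoc)
  have "a * f (x + h) + b - (a * f x + b) - (a *\<^sub>R g x) \<bullet> h = a * (f (x + h) - f x - g x \<bullet> h)"
    by (simp add: algebra_simps)
  then show "\<bar>a * f (x + h) + b - (a * f x + b) - (a *\<^sub>R g x) \<bullet> h\<bar> \<le> \<bar>a\<bar> * K * (norm h)\<^sup>2"
    using mult_left_mono[OF C11D(5)[OF f, of x h] abs_ge_zero[of a]] by (simp add: abs_mult mult.assoc)
qed

lemma C11_projection:
  assumes f: "C11 K f g" and lin: "linear P" and selfadj: "\<And>x y. P x \<bullet> y = x \<bullet> P y"
    and contr: "\<And>x. norm (P x) \<le> norm x"
  shows "C11 K (\<lambda>x. f (P x)) (\<lambda>x. P (g (P x)))"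
proof (rule C11_I)
  note [measurable] = C11D(1,2)[OF f]
  note K = C11_nonneg[OF f]
  have [measurable]: "P \<in> borel_measurable borel"
    by (rule linear_borel_measurable[OF lin])
  show "(\<lambda>x. f (P x)) \<in> borel_measurable borel" "(\<lambda>x. P (g (P x))) \<in> borel_measurable borel" by measurable
  fix x h
  show "norm (P (g (P x))) \<le> K" using contr C11D(3)[OF f] order_trans by blast
  have "\<bar>f (P (x + h)) - f (P x)\<bar> \<le> K * norm (P h)"
    using C11D(4)[OF f, of "P x" "P h"] by (simp add: linear_add[OF lin])
  also have "\<dots> \<le> K * norm h" by (intro mult_left_mono contr K)
  finally show "\<bar>f (P (x + h)) - f (P x)\<bar> \<le> K * norm h" .
  have "\<bar>f (P (x + h)) - f (P x) - P (g (P x)) \<bullet> h\<bar> \<le> K * (norm (P h))\<^sup>2"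
    using C11D(5)[OF f, of "P x" "P h"] by (simp add: linear_add[OF lin] selfadj)
  also have "\<dots> \<le> K * (norm h)\<^sup>2" by (intro mult_left_mono power_mono contr K) auto
  finally show "\<bar>f (P (x + h)) - f (P x) - P (g (P x)) \<bullet> h\<bar> \<le> K * (norm h)\<^sup>2" .
qed

text \<open>
  The simplest function with Lipschitz derivative that vanishes on a half line; the cutoff
  functions are built from it.
\<close>

definition sqpos :: "real \<Rightarrow> real" where "sqpos t = (max 0 t)\<^sup>2"

lemma sqpos_expansion: "\<bar>sqpos t' - sqpos t - 2 * max 0 t * (t' - t)\<bar> \<le> (t' - t)\<^sup>2"
proof -
  consider "0 \<le> t" "0 \<le> t'" | "0 \<le> t" "t' < 0" | "t < 0" "0 \<le> t'" | "t < 0" "t' < 0" by linarith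
  then show ?thesis
  proof cases
    case 1
    then have "sqpos t' - sqpos t - 2 * max 0 t * (t' - t) = (t' - t)\<^sup>2"
      by (simp add: sqpos_def power2_eq_square algebra_simps)
    then show ?thesis by simp
  next
    case 2
    then have "t * t' \<le> 0" by (simp add: mult_nonneg_nonpos)
    moreover have "(t' - t)\<^sup>2 = t'\<^sup>2 + t\<^sup>2 - 2 * (t * t')" by (simp add: power2_diff mult_ac)
    ultimately have "0 \<le> t\<^sup>2 - 2 * (t * t')" "t\<^sup>2 - 2 * (t * t') \<le> (t' - t)\<^sup>2"
      using zero_le_power2[of t] zero_le_power2[of t'] by linarith+
    then show ?thesis using 2 by (simp add: sqpos_def power2_eq_square algebra_simps)
  next
    case 3
    then have "t'\<^sup>2 \<le> (t' - t)\<^sup>2" by (intro power_mono) auto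
    then show ?thesis using 3 by (simp add: sqpos_def)
  qed (simp add: sqpos_def)
qed

lemma sqpos_lipschitz:
  assumes "t \<le> 1" "t' \<le> 1" shows "\<bar>sqpos t' - sqpos t\<bar> \<le> 2 * \<bar>t' - t\<bar>"
proof -
  have "sqpos t' - sqpos t = (max 0 t' - max 0 t) * (max 0 t' + max 0 t)"
    by (simp add: sqpos_def power2_eq_square algebra_simps)
  then have "\<bar>sqpos t' - sqpos t\<bar> = \<bar>max 0 t' - max 0 t\<bar> * \<bar>max 0 t' + max 0 t\<bar>"
    by (simp add: abs_mult)
  also have "\<dots> \<le> \<bar>t' - t\<bar> * 2" using assms by (intro mult_mono) auto
  finally show ?thesis by simp
qed

lemma sqpos_bounds: "0 \<le> sqpos t" "t \<le> 1 \<Longrightarrow> sqpos t \<le> 1"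
  by (auto simp: sqpos_def power_le_one)

lemma C11_sqpos:
  fixes f :: "'a::euclidean_space \<Rightarrow> real"
  assumes f: "C11 K f g" and le: "\<And>x. f x \<le> 1"
  shows "C11 (2 * K + K\<^sup>2) (\<lambda>x. sqpos (f x)) (\<lambda>x. (2 * max 0 (f x)) *\<^sub>R g x)"
proof (rule C11_I)
  note [measurable] = C11D(1,2)[OF f]
  note K = C11_nonneg[OF f]
  show "(\<lambda>x. sqpos (f x)) \<in> borel_measurable borel" unfolding sqpos_def by measurable
  show "(\<lambda>x. (2 * max 0 (f x)) *\<^sub>R g x) \<in> borel_measurable borel" by measurable
  have m: "0 \<le> max 0 (f x)" "max 0 (f x) \<le> 1" for x using le[of x] by auto
  fix x h :: 'a
  have "norm ((2 * max 0 (f x)) *\<^sub>R g x) \<le> 2 * K"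
    using mult_mono[OF m(2)[of x] C11D(3)[OF f, of x]] m(1)[of x] by (simp add: abs_mult)
  then show "norm ((2 * max 0 (f x)) *\<^sub>R g x) \<le> 2 * K + K\<^sup>2"
    using zero_le_power2[of K] by linarith
  have "\<bar>sqpos (f (x + h)) - sqpos (f x)\<bar> \<le> 2 * (K * norm h)"
    by (rule order_trans[OF sqpos_lipschitz[OF le le] mult_left_mono[OF C11D(4)[OF f]]]) simp
  also have "\<dots> \<le> (2 * K + K\<^sup>2) * norm h" by (simp add: distrib_right)
  finally show "\<bar>sqpos (f (x + h)) - sqpos (f x)\<bar> \<le> (2 * K + K\<^sup>2) * norm h" .
  have 1: "\<bar>sqpos (f (x + h)) - sqpos (f x) - 2 * max 0 (f x) * (f (x + h) - f x)\<bar> \<le> (K * norm h)\<^sup>2"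
    using order_trans[OF sqpos_expansion power_mono[OF C11D(4)[OF f, of x h], of 2, simplified]] by simp
  have 2: "\<bar>2 * max 0 (f x) * (f (x + h) - f x - g x \<bullet> h)\<bar> \<le> 2 * (K * (norm h)\<^sup>2)"
    using mult_mono[OF m(2)[of x] C11D(5)[OF f, of x h]] m(1)[of x] by (simp add: abs_mult)
  have 3: "((2 * max 0 (f x)) *\<^sub>R g x) \<bullet> h = 2 * max 0 (f x) * (g x \<bullet> h)" by simp
  have 4: "(2 * K + K\<^sup>2) * (norm h)\<^sup>2 = (K * norm h)\<^sup>2 + 2 * (K * (norm h)\<^sup>2)"
    by (simp add: power_mult_distrib distrib_right)
  show "\<bar>sqpos (f (x + h)) - sqpos (f x) - ((2 * max 0 (f x)) *\<^sub>R g x) \<bullet> h\<bar> \<le> (2 * K + K\<^sup>2) * (norm h)\<^sup>2"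
    using 1 2 unfolding 3 4 right_diff_distrib by linarith
qed

text \<open>
  The argument of \<open>sqpos\<close> is quadratic, hence not globally Lipschitz. Increments \<open>h\<close> larger than
  \<open>r\<close> are harmless since the function has values in \<open>[0, 1]\<close>; for smaller ones the function vanishes
  near \<open>x\<close> unless \<open>x\<close> is within \<open>2 r\<close> of \<open>a\<close>, and there the argument is Lipschitz.
\<close>

lemma C11_bump:
  fixes a :: "'a::euclidean_space"
  assumes r: "0 < r"
  shows "C11 (10 / r + 27 / r\<^sup>2) (\<lambda>x. sqpos (1 - (norm (x - a))\<^sup>2 / r\<^sup>2))
    (\<lambda>x. (- (4 / r\<^sup>2) * max 0 (1 - (norm (x - a))\<^sup>2 / r\<^sup>2)) *\<^sub>R (x - a))" (is "C11 ?K ?f ?g")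
proof (rule C11_I)
  show "?f \<in> borel_measurable borel" unfolding sqpos_def by measurable
  show "?g \<in> borel_measurable borel" by measurable
  define p where "p x = 1 - (norm (x - a))\<^sup>2 / r\<^sup>2" for x
  have p1: "p x \<le> 1" for x by (simp add: p_def)
  have f01: "0 \<le> ?f x" "?f x \<le> 1" for x using sqpos_bounds[of "p x"] p1[of x] by (auto simp: p_def)
  have pneg: "max 0 (p x) = 0" if "r \<le> norm (x - a)" for x
  proof -
    have "r\<^sup>2 \<le> (norm (x - a))\<^sup>2" using that r by (intro power_mono) auto
    then show ?thesis using r by (simp add: p_def max_def)
  qed
  have f0: "?f x = 0" "?g x = 0" if "r \<le> norm (x - a)" for x
    using pneg[OF that] by (simp_all add: sqpos_def p_def)
  have gb: "norm (?g x) \<le> 4 / r" for x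
  proof (cases "r \<le> norm (x - a)")
    case False
    have "norm (?g x) = 4 / r\<^sup>2 * (max 0 (p x) * norm (x - a))"
      by (simp add: p_def abs_mult)
    also have "\<dots> \<le> 4 / r\<^sup>2 * (1 * r)"
      using False p1[of x] by (intro mult_left_mono mult_mono) auto
    finally show ?thesis using r by (simp add: power2_eq_square)
  qed (use f0 r in simp)
  fix x h :: 'a
  have "0 \<le> 27 / r\<^sup>2" "4 / r \<le> 10 / r" using r by (auto simp: field_simps)
  then show "norm (?g x) \<le> ?K" using gb[of x] by linarith
  define t where "t = norm h / r"
  have t0: "0 \<le> t" using r by (simp add: t_def)
  have K1: "10 * t \<le> ?K * norm h" and K2: "27 * t\<^sup>2 \<le> ?K * (norm h)\<^sup>2"
    using r by (auto simp: t_def distrib_right power_divide)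
  consider (big) "r < norm h" | (far) "norm h \<le> r" "2 * r < norm (x - a)" | (near) "norm h \<le> r" "norm (x - a) \<le> 2 * r"
    by linarith
  then have "\<bar>?f (x + h) - ?f x\<bar> \<le> 10 * t \<and> \<bar>?f (x + h) - ?f x - ?g x \<bullet> h\<bar> \<le> 27 * t\<^sup>2"
  proof cases
    case big
    then have t1: "1 \<le> t" using r by (simp add: t_def)
    then have t2: "1 \<le> t\<^sup>2" "t \<le> t\<^sup>2" by (auto simp: power2_eq_square mult_le_cancel_left1 intro: order_trans[OF t1])
    have d: "\<bar>?f (x + h) - ?f x\<bar> \<le> 1" using f01[of x] f01[of "x + h"] by linarith
    have "\<bar>?g x \<bullet> h\<bar> \<le> norm (?g x) * norm h" by (rule Cauchy_Schwarz_ineq2)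
    also have "\<dots> \<le> 4 / r * norm h" by (intro mult_right_mono gb) auto
    also have "\<dots> = 4 * t" by (simp add: t_def)
    finally show ?thesis using d t1 t2 by linarith
  next
    case far
    have "norm (x - a) \<le> norm (x + h - a) + norm h"
      using norm_triangle_ineq4[of "x + h - a" h] by simp
    then have "r \<le> norm (x + h - a)" "r \<le> norm (x - a)" using far r by linarith+
    then have "?f (x + h) = 0" "?f x = 0" "?g x = 0" using f0 by blast+
    then show ?thesis using t0 by (simp only: inner_zero_left) simp
  next
    case near
    have pd: "p (x + h) - p x = - (2 * ((x - a) \<bullet> h) + (norm h)\<^sup>2) / r\<^sup>2"
    proof -
      have "(norm (x + h - a))\<^sup>2 = (norm (x - a))\<^sup>2 + 2 * ((x - a) \<bullet> h) + (norm h)\<^sup>2"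
        using dot_norm[of "x - a" h] by (simp add: algebra_simps)
      then show ?thesis by (simp add: p_def diff_divide_distrib[symmetric] add_divide_distrib[symmetric])
    qed
    have pt: "\<bar>p (x + h) - p x\<bar> \<le> 5 * t"
    proof -
      have "\<bar>(x - a) \<bullet> h\<bar> \<le> 2 * (r * norm h)"
        using Cauchy_Schwarz_ineq2[of "x - a" h] mult_right_mono[OF near(2), of "norm h"] by simp
      moreover have "(norm h)\<^sup>2 \<le> r * norm h"
        using mult_right_mono[OF near(1), of "norm h"] by (simp add: power2_eq_square)
      ultimately have "\<bar>2 * ((x - a) \<bullet> h) + (norm h)\<^sup>2\<bar> \<le> 5 * (r * norm h)"
        using zero_le_power2[of "norm h"] by linarith
      then have "\<bar>2 * ((x - a) \<bullet> h) + (norm h)\<^sup>2\<bar> / r\<^sup>2 \<le> 5 * (r * norm h) / r\<^sup>2"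
        by (intro divide_right_mono) auto
      also have "\<dots> = 5 * t" using r by (simp add: t_def power2_eq_square)
      finally show ?thesis unfolding pd abs_divide abs_minus_cancel by simp
    qed
    have "\<bar>?f (x + h) - ?f x\<bar> \<le> 2 * \<bar>p (x + h) - p x\<bar>"
      using sqpos_lipschitz[OF p1[of x] p1[of "x + h"]] by (simp add: p_def)
    also have "\<dots> \<le> 2 * (5 * t)" by (intro mult_left_mono pt) simp
    finally have 1: "\<bar>?f (x + h) - ?f x\<bar> \<le> 10 * t" by simp
    have "\<bar>?f (x + h) - ?f x - 2 * max 0 (p x) * (p (x + h) - p x)\<bar> \<le> (p (x + h) - p x)\<^sup>2"
      using sqpos_expansion[of "p (x + h)" "p x"] by (simp add: p_def)
    also have "\<dots> \<le> (5 * t)\<^sup>2" using power_mono[OF pt, of 2] by simp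
    finally have 2: "\<bar>?f (x + h) - ?f x - 2 * max 0 (p x) * (p (x + h) - p x)\<bar> \<le> 25 * t\<^sup>2"
      by (simp add: power_mult_distrib)
    have 3: "2 * max 0 (p x) * (p (x + h) - p x) - ?g x \<bullet> h = - (2 * max 0 (p x) * t\<^sup>2)"
    proof -
      define X where "X = (x - a) \<bullet> h"
      have gh: "?g x \<bullet> h = - (4 / r\<^sup>2) * max 0 (p x) * X"
        unfolding X_def p_def inner_scaleR_left by simp
      show ?thesis
        unfolding pd gh X_def[symmetric] using r
        by (simp add: t_def power_divide) (simp add: field_simps)
    qed
    have "max 0 (p x) * t\<^sup>2 \<le> 1 * t\<^sup>2" using p1[of x] by (intro mult_right_mono) auto
    moreover have "0 \<le> max 0 (p x) * t\<^sup>2" by simp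
    ultimately show ?thesis using 1 2 3 by linarith
  qed
  then show "\<bar>?f (x + h) - ?f x\<bar> \<le> ?K * norm h" "\<bar>?f (x + h) - ?f x - ?g x \<bullet> h\<bar> \<le> ?K * (norm h)\<^sup>2"
    using K1 K2 by linarith+
qed

text \<open>
  Bumps at finitely many points of \<open>A\<close> have a sum \<open>S\<close> that is at least \<open>1/2\<close> on \<open>A\<close> and
  vanishes far from \<open>A\<close>. The function \<open>1 - sqpos (1 - 2 S)\<close> levels it off to exactly 1 on
  \<open>A\<close>.
\<close>

lemma C11_cutoff:
  fixes A :: "'a::euclidean_space set"
  assumes A: "compact A" and e: "0 < e"
  shows "\<exists>K f g. C11 K f g \<and> (\<forall>x. 0 \<le> f x \<and> f x \<le> 1) \<and> (\<forall>x\<in>A. f x = 1) \<and>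
    (\<forall>x. 0 < f x \<longrightarrow> (\<exists>a\<in>A. dist a x < e))"
proof -
  obtain J where J: "finite J" "J \<subseteq> A" "A \<subseteq> (\<Union>a\<in>J. ball a (e / 2))"
    using compactE_image[OF A, of A "\<lambda>a. ball a (e / 2)"] e by (metis centre_in_ball half_gt_zero open_ball UN_I subsetI)
  define b where "b a x = sqpos (1 - (norm (x - a))\<^sup>2 / e\<^sup>2)" for a x :: 'a
  have b0: "0 \<le> b a x" for a x by (simp add: b_def sqpos_bounds)
  define S where "S x = (\<Sum>a\<in>J. b a x)" for x
  define gb where "gb a x = (- (4 / e\<^sup>2) * max 0 (1 - (norm (x - a))\<^sup>2 / e\<^sup>2)) *\<^sub>R (x - a)" for a x :: 'a
  have "C11 (10 / e + 27 / e\<^sup>2) (b a) (gb a)" for a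
    unfolding b_def gb_def by (rule C11_bump[OF e])
  then obtain K g where S: "C11 K S g"
    using C11_sum[OF J(1), of "\<lambda>_. 10 / e + 27 / e\<^sup>2" b gb] unfolding S_def[abs_def] by blast
  have T: "C11 (\<bar>- 2\<bar> * K) (\<lambda>x. - 2 * S x + 1) (\<lambda>x. (- 2) *\<^sub>R g x)" by (rule C11_affine[OF S])
  have T1: "- 2 * S x + 1 \<le> 1" for x using b0 by (simp add: S_def sum_nonneg)
  define f where "f x = (- 1) * sqpos (- 2 * S x + 1) + 1" for x
  obtain K' g' where f: "C11 K' f g'"
    using C11_affine[OF C11_sqpos[OF T T1], of "- 1" 1] unfolding f_def[abs_def] by blast
  have "0 \<le> f x \<and> f x \<le> 1" for x using sqpos_bounds[of "- 2 * S x + 1"] T1[of x] by (auto simp: f_def)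
  moreover have "f x = 1" if xA: "x \<in> A" for x
  proof -
    obtain a where "a \<in> J" "x \<in> ball a (e / 2)" using xA J(3) by blast
    then have a: "a \<in> J" "dist a x < e / 2" by simp_all
    have "(norm (x - a))\<^sup>2 \<le> (e / 2)\<^sup>2" using a by (intro power_mono) (auto simp: dist_norm norm_minus_commute)
    then have "(norm (x - a))\<^sup>2 / e\<^sup>2 \<le> 1 / 4" using e by (simp add: field_simps power2_eq_square)
    then have "3 / 4 \<le> max 0 (1 - (norm (x - a))\<^sup>2 / e\<^sup>2)" by linarith
    then have "(3 / 4)\<^sup>2 \<le> b a x" unfolding b_def sqpos_def by (rule power_mono) simp
    also have "\<dots> \<le> S x" unfolding S_def using a J b0 by (intro member_le_sum) auto
    finally show ?thesis by (simp add: f_def sqpos_def power2_eq_square max_def)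
  qed
  moreover have "\<exists>a\<in>A. dist a x < e" if "0 < f x" for x
  proof (rule ccontr)
    assume n: "\<not> (\<exists>a\<in>A. dist a x < e)"
    have "b a x = 0" if "a \<in> J" for a
    proof -
      have "e \<le> norm (x - a)" using n that J(2) by (auto simp: dist_norm norm_minus_commute not_less)
      then have "e\<^sup>2 \<le> (norm (x - a))\<^sup>2" using e by (intro power_mono) auto
      then show ?thesis using e by (simp add: b_def sqpos_def max_def)
    qed
    then have "f x = 0" by (simp add: f_def S_def sqpos_def)
    then show False using that by simp
  qed
  ultimately show ?thesis using f by blast
qed

section \<open>The gap under the heat flow\<close>

text \<open>
  A discrete form of the equation \<open>u_t = (\<Delta> u - u |\<nabla> u|^2) / 2\<close> that \<open>u = Psi (c F)\<close> satisfies
  when \<open>F\<close> satisfies the heat equation. The nonlinear term is the second order coefficient in the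
  expansion of \<open>Phi\<close> at \<open>u x\<close>, where \<open>Phi'' = - u Phi'\<close>. The Laplacian is left in the form of the
  mean of \<open>u\<close>, which keeps the remainder of third order without assuming second derivatives; all
  constants depend on \<open>K\<close> and \<open>M\<close> only.
\<close>

lemma Phi_mean_expansion:
  fixes K M :: real
  shows "\<exists>K1\<ge>0. \<forall>(u::'a::euclidean_space \<Rightarrow> real) g x s u'. C11 K u g \<longrightarrow> (\<forall>x. \<bar>u x\<bar> \<le> M) \<longrightarrow> 0 < s \<longrightarrow> s \<le> 1
     \<longrightarrow> Phi u' = (\<integral>z. Phi (u (x + s *\<^sub>R z)) \<partial>gauss) \<longrightarrow>
     \<bar>u' - ((\<integral>z. u (x + s *\<^sub>R z) \<partial>gauss) - s\<^sup>2 / 2 * u x * (norm (g x))\<^sup>2)\<bar> \<le> K1 * s ^ 3 \<and> \<bar>u' - u x\<bar> \<le> K1 * s\<^sup>2"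
proof -
  interpret prob_space "gauss :: 'a measure" by (rule prob_space_gauss)
  define m2 where "m2 = (\<integral>z. norm (z :: 'a) ^ 2 \<partial>gauss)"
  define m3 where "m3 = (\<integral>z. norm (z :: 'a) ^ 3 \<partial>gauss)"
  have m0: "m2 \<ge> 0" "m3 \<ge> 0" by (auto simp: m2_def m3_def)
  have I2: "integrable gauss (\<lambda>z::'a. norm z ^ 2)" and I3: "integrable gauss (\<lambda>z::'a. norm z ^ 3)"
    by (auto intro: integrable_gauss_norm_power)
  define L where "L = \<bar>K\<bar>" define N where "N = \<bar>M\<bar>"
  have LN: "0 \<le> L" "0 \<le> N" by (auto simp: L_def N_def)
  define T where "T = L * m2 + N * L\<^sup>2"
  have T0: "T \<ge> 0" using m0 LN by (simp add: T_def)
  define E where "E = L ^ 3 * m3 + 3 * N * L\<^sup>2 * m3 + T\<^sup>2"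
  have E0: "E \<ge> 0" using m0 LN by (simp add: E_def)
  define k where "k = rho (N + T)"
  have k0: "k > 0" by (simp add: k_def)
  define K1 where "K1 = E / k + T"
  have K1: "K1 \<ge> 0" "E / k \<le> K1" using E0 k0 T0 by (auto simp: K1_def)
  have "\<bar>u' - ((\<integral>z. u (x + s *\<^sub>R z) \<partial>gauss) - s\<^sup>2 / 2 * u x * (norm (g x))\<^sup>2)\<bar> \<le> K1 * s ^ 3 \<and> \<bar>u' - u x\<bar> \<le> K1 * s\<^sup>2"
    if u: "C11 K u g" and uM: "\<forall>x. \<bar>u x\<bar> \<le> M" and s: "0 < s" "s \<le> 1"
      and u': "Phi u' = (\<integral>z. Phi (u (x + s *\<^sub>R z)) \<partial>gauss)" for u :: "'a \<Rightarrow> real" and g x s u'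
  proof -
    note [measurable] = C11D(1,2)[OF u]
    have KL: "K = L" using C11D(3)[OF u, of 0] norm_ge_zero[of "g 0"] unfolding L_def by linarith
    have MN: "M = N" using uM[rule_format, of 0] unfolding N_def by linarith
    define m where "m = u x"
    define D where "D z = u (x + s *\<^sub>R z) - m" for z
    have Dm [measurable]: "D \<in> borel_measurable borel" by (simp add: D_def[abs_def])
    have D1: "\<bar>D z\<bar> \<le> s * L * norm z" for z
      using C11D(4)[OF u, of x "s *\<^sub>R z"] s by (simp add: D_def m_def KL mult_ac)
    have D2: "\<bar>D z - s * (g x \<bullet> z)\<bar> \<le> s\<^sup>2 * L * norm z ^ 2" for z
      using C11D(5)[OF u, of x "s *\<^sub>R z"] s by (simp add: D_def m_def KL mult_ac power_mult_distrib)
    have gx: "norm (g x) \<le> L" using C11D(3)[OF u, of x] by (simp add: KL)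
    have gz: "\<bar>g x \<bullet> z\<bar> \<le> L * norm z" for z
      using Cauchy_Schwarz_ineq2[of "g x" z] mult_right_mono[OF gx, of "norm z"] by simp
    have ID: "integrable gauss D"
      by (rule integrable_gauss_bounded[of _ "2 * N"]) (use uM in \<open>auto simp: D_def m_def MN abs_le_iff intro: order_trans\<close>, (smt (verit) MN)+)
    have Dbd: "\<bar>D z\<bar> \<le> 2 * N" for z
      using uM[rule_format, of "x + s *\<^sub>R z"] uM[rule_format, of x] unfolding D_def m_def MN by linarith
    have ID2: "integrable gauss (\<lambda>z. (D z)\<^sup>2)"
      by (rule integrable_gauss_bounded[of _ "(2 * N)\<^sup>2"])
         (use power_mono[OF Dbd, of _ 2] in \<open>auto simp: power_mult_distrib\<close>)
    define e where "e = (\<integral>z. D z \<partial>gauss)"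
    define q where "q = (\<integral>z. (D z)\<^sup>2 \<partial>gauss)"
    have e_eq: "e = (\<integral>z. u (x + s *\<^sub>R z) \<partial>gauss) - m"
    proof -
      have "integrable gauss (\<lambda>z. u (x + s *\<^sub>R z))"
        by (rule integrable_gauss_bounded[of _ M]) (use uM in auto)
      then show ?thesis unfolding e_def D_def by (simp add: prob_space[simplified])
    qed
    \<comment> \<open>The linear part has mean 0, so that \<open>e\<close> is of second order although \<open>D\<close> is of first order.\<close>
    have e: "\<bar>e\<bar> \<le> s\<^sup>2 * L * m2"
    proof -
      have "e = (\<integral>z. D z - s * (g x \<bullet> z) \<partial>gauss)"
        unfolding e_def using ID gauss_mean[of "g x"] by simp
      also have "\<bar>\<dots>\<bar> \<le> (\<integral>z. \<bar>D z - s * (g x \<bullet> z)\<bar> \<partial>gauss)" by (rule integral_abs_bound)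
      also have "\<dots> \<le> (\<integral>z. s\<^sup>2 * L * norm (z :: 'a) ^ 2 \<partial>gauss)"
        using ID gauss_mean[of "g x"] I2 D2 by (intro integral_mono) auto
      also have "\<dots> = s\<^sup>2 * L * m2" by (simp add: m2_def)
      finally show ?thesis .
    qed
    have q: "\<bar>q - s\<^sup>2 * (norm (g x))\<^sup>2\<bar> \<le> 2 * L\<^sup>2 * m3 * s ^ 3"
    proof -
      have pt: "\<bar>(D z)\<^sup>2 - s\<^sup>2 * (g x \<bullet> z)\<^sup>2\<bar> \<le> 2 * L\<^sup>2 * s ^ 3 * norm z ^ 3" for z
      proof -
        have "(D z)\<^sup>2 - s\<^sup>2 * (g x \<bullet> z)\<^sup>2 = (D z - s * (g x \<bullet> z)) * (D z + s * (g x \<bullet> z))"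
          by (simp add: algebra_simps power2_eq_square)
        also have "\<bar>\<dots>\<bar> \<le> (s\<^sup>2 * L * norm z ^ 2) * (2 * (s * L * norm z))"
          unfolding abs_mult
        proof (rule mult_mono[OF D2])
          have "\<bar>s * (g x \<bullet> z)\<bar> \<le> s * (L * norm z)"
            unfolding abs_mult using gz[of z] s by (intro mult_mono) auto
          then show "\<bar>D z + s * (g x \<bullet> z)\<bar> \<le> 2 * (s * L * norm z)"
            using D1[of z] by (simp add: mult_ac abs_le_iff)
        qed (use s LN in auto)
        finally show ?thesis by (simp add: power2_eq_square power3_eq_cube mult_ac)
      qed
      have "q - s\<^sup>2 * (norm (g x))\<^sup>2 = (\<integral>z. (D z)\<^sup>2 - s\<^sup>2 * (g x \<bullet> z)\<^sup>2 \<partial>gauss)"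
        unfolding q_def using ID2 gauss_variance[of "g x"] by simp
      also have "\<bar>\<dots>\<bar> \<le> (\<integral>z. \<bar>(D z)\<^sup>2 - s\<^sup>2 * (g x \<bullet> z)\<^sup>2\<bar> \<partial>gauss)" by (rule integral_abs_bound)
      also have "\<dots> \<le> (\<integral>z. 2 * L\<^sup>2 * s ^ 3 * norm (z :: 'a) ^ 3 \<partial>gauss)"
        using ID2 gauss_variance[of "g x"] I3 pt by (intro integral_mono) auto
      also have "\<dots> = 2 * L\<^sup>2 * m3 * s ^ 3" by (simp add: m3_def)
      finally show ?thesis .
    qed
    have P: "\<bar>Phi u' - Phi m - rho m * e + m * rho m / 2 * q\<bar> \<le> L ^ 3 * m3 * s ^ 3"
    proof -
      have IP: "integrable gauss (\<lambda>z. Phi (u (x + s *\<^sub>R z)))"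
        by (rule integrable_gauss_bounded[of _ 1]) (auto simp: less_imp_le abs_of_pos)
      define R where "R z = Phi (u (x + s *\<^sub>R z)) - Phi m - rho m * D z + m * rho m / 2 * (D z)\<^sup>2" for z
      have IR: "integrable gauss R" unfolding R_def[abs_def] using IP ID ID2 by simp
      have "Phi u' - Phi m - rho m * e + m * rho m / 2 * q = (\<integral>z. R z \<partial>gauss)"
        unfolding u' e_def q_def R_def using IP ID ID2 by (simp add: prob_space[simplified])
      then have "\<bar>Phi u' - Phi m - rho m * e + m * rho m / 2 * q\<bar> \<le> (\<integral>z. \<bar>R z\<bar> \<partial>gauss)"
        using integral_abs_bound[of gauss R] by simp
      also have "\<dots> \<le> (\<integral>z. L ^ 3 * s ^ 3 * norm (z :: 'a) ^ 3 \<partial>gauss)"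
      proof (rule integral_mono)
        fix z :: 'a
        have "\<bar>R z\<bar> \<le> \<bar>D z\<bar> ^ 3"
          using Phi_taylor3[of "u (x + s *\<^sub>R z)" m] unfolding R_def D_def .
        also have "\<dots> \<le> (s * L * norm z) ^ 3" by (intro power_mono D1) auto
        also have "\<dots> = L ^ 3 * s ^ 3 * norm z ^ 3" by (simp add: power_mult_distrib)
        finally show "\<bar>R z\<bar> \<le> L ^ 3 * s ^ 3 * norm z ^ 3" .
      qed (use IR I3 in auto)
      also have "\<dots> = L ^ 3 * m3 * s ^ 3" by (simp add: m3_def)
      finally show ?thesis .
    qed
    \<comment> \<open>\<open>m + t\<close> is the claimed value: both \<open>Phi u'\<close> and \<open>Phi (m + t)\<close> agree with the tangent of \<open>Phi\<close> at \<open>m\<close> up to \<open>O(s^3)\<close>.\<close>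
    define t where "t = e - s\<^sup>2 / 2 * m * (norm (g x))\<^sup>2"
    have mN: "\<bar>m\<bar> \<le> N" using uM by (simp add: m_def MN)
    have gx2: "(norm (g x))\<^sup>2 \<le> L\<^sup>2" using gx by (intro power_mono) auto
    have t: "\<bar>t\<bar> \<le> s\<^sup>2 * T"
    proof -
      have "\<bar>s\<^sup>2 / 2 * m * (norm (g x))\<^sup>2\<bar> \<le> s\<^sup>2 * N * L\<^sup>2"
        unfolding abs_mult using mN gx2 LN by (intro mult_mono) auto
      then show ?thesis using e unfolding t_def T_def by (simp add: algebra_simps abs_le_iff)
    qed
    have s2: "s\<^sup>2 \<le> 1" using s by (simp add: power_le_one)
    have A: "\<bar>Phi u' - Phi m - rho m * t\<bar> \<le> (L ^ 3 * m3 + 3 * N * L\<^sup>2 * m3) * s ^ 3"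
    proof -
      have "Phi u' - Phi m - rho m * t = (Phi u' - Phi m - rho m * e + m * rho m / 2 * q)
         - m * rho m / 2 * (q - s\<^sup>2 * (norm (g x))\<^sup>2)"
        by (simp add: t_def algebra_simps)
      moreover have "\<bar>m * rho m / 2 * (q - s\<^sup>2 * (norm (g x))\<^sup>2)\<bar> \<le> (N * 3 / 2) * (2 * L\<^sup>2 * m3 * s ^ 3)"
      proof -
        have "\<bar>m * rho m / 2\<bar> \<le> N * 3 / 2"
          using mult_mono[OF mN rho_le[of m]] LN by (simp add: abs_mult)
        then show ?thesis unfolding abs_mult[of _ "q - _"] using q LN by (intro mult_mono) auto
      qed
      ultimately show ?thesis using P by (simp add: algebra_simps abs_le_iff)
    qed
    have B: "\<bar>Phi (m + t) - Phi m - rho m * t\<bar> \<le> T\<^sup>2 * s ^ 3"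
    proof -
      have "\<bar>Phi (m + t) - Phi m - rho m * t\<bar> \<le> t\<^sup>2" using Phi_taylor2[of "m + t" m] by simp
      also have "\<dots> \<le> (s\<^sup>2 * T)\<^sup>2" using t T0 abs_le_square_iff[of t "s\<^sup>2 * T"] by simp
      also have "\<dots> = T\<^sup>2 * (s ^ 3 * s)" by (simp add: power2_eq_square power3_eq_cube mult_ac)
      also have "\<dots> \<le> T\<^sup>2 * (s ^ 3 * 1)" using s by (intro mult_left_mono) auto
      finally show ?thesis by simp
    qed
    have "\<bar>Phi u' - Phi (m + t)\<bar> \<le> E * s ^ 3"
      using A B by (simp add: E_def algebra_simps abs_le_iff)
    moreover have "k * \<bar>u' - (m + t)\<bar> \<le> \<bar>Phi u' - Phi (m + t)\<bar>"
      unfolding k_def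
    proof (rule Phi_diff_lower)
      have "s\<^sup>2 * T \<le> 1 * T" using s2 T0 by (intro mult_right_mono) auto
      then show "\<bar>m + t\<bar> \<le> N + T" using t mN by linarith
      have "Phi (- N) \<le> Phi u'" "Phi u' \<le> Phi N"
        using heat_bounds[of "\<lambda>y. Phi (u y)" "Phi (- N)" "Phi N" s x] uM
        unfolding u' heat_def by (auto simp: MN abs_le_iff minus_le_iff)
      then show "\<bar>u'\<bar> \<le> N + T" using T0 by auto
    qed
    ultimately have "k * \<bar>u' - (m + t)\<bar> \<le> E * s ^ 3" by linarith
    then have R: "\<bar>u' - (m + t)\<bar> \<le> E / k * s ^ 3" using k0 by (simp add: field_simps)
    have "E / k * s ^ 3 \<le> K1 * s ^ 3" using K1 s by (intro mult_right_mono) auto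
    moreover have "m + t = (\<integral>z. u (x + s *\<^sub>R z) \<partial>gauss) - s\<^sup>2 / 2 * u x * (norm (g x))\<^sup>2"
      by (simp add: t_def e_eq m_def)
    moreover have "\<bar>u' - u x\<bar> \<le> K1 * s\<^sup>2"
    proof -
      have "s ^ 3 = s\<^sup>2 * s" by (simp add: power2_eq_square power3_eq_cube)
      then have "s ^ 3 \<le> s\<^sup>2" using s by (simp add: mult_left_le)
      then have "E / k * s ^ 3 \<le> E / k * s\<^sup>2" using E0 k0 by (intro mult_left_mono) auto
      then show ?thesis using R t unfolding K1_def m_def by (simp add: algebra_simps abs_le_iff)
    qed
    ultimately show ?thesis using R by simp
  qed
  then show ?thesis using K1 by blast
qed

text \<open>
  In the application \<open>P i = B\<^sub>i\<^sup>* B\<^sub>i\<close> is the orthogonal projection to the subspace \<open>E\<^sub>i\<close>, so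
  that all functions live on one space.
\<close>

locale weighted_projections =
  fixes I :: "'i set" and lam :: "'i \<Rightarrow> real" and P :: "'i \<Rightarrow> 'a::euclidean_space \<Rightarrow> 'a"
  assumes fin [simp]: "finite I"
    and lam_nonneg: "i \<in> I \<Longrightarrow> 0 \<le> lam i"
    and lin: "i \<in> I \<Longrightarrow> linear (P i)"
    and selfadj: "i \<in> I \<Longrightarrow> P i x \<bullet> y = x \<bullet> P i y"
    and idem: "i \<in> I \<Longrightarrow> P i (P i x) = P i x"
    and resolution: "(\<Sum>i\<in>I. lam i *\<^sub>R P i x) = x"
begin

lemma norm_P_sq: "i \<in> I \<Longrightarrow> (norm (P i x))\<^sup>2 = x \<bullet> P i x"
  by (simp add: power2_norm_eq_inner selfadj idem)

lemma norm_P_le: assumes "i \<in> I" shows "norm (P i x) \<le> norm x"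
proof -
  have "norm (P i x) * norm (P i x) \<le> norm x * norm (P i x)"
    using norm_P_sq[OF assms, of x] norm_cauchy_schwarz[of x "P i x"] by (simp add: power2_eq_square)
  then show ?thesis by (cases "norm (P i x) = 0") (simp_all add: mult_le_cancel_right)
qed

lemma sum_norm_P_sq: "(\<Sum>i\<in>I. lam i * (norm (P i x))\<^sup>2) = (norm x)\<^sup>2"
proof -
  have "(\<Sum>i\<in>I. lam i * (norm (P i x))\<^sup>2) = x \<bullet> (\<Sum>i\<in>I. lam i *\<^sub>R P i x)"
    unfolding inner_sum_right by (intro sum.cong) (auto simp: norm_P_sq)
  then show ?thesis by (simp add: resolution power2_norm_eq_inner)
qed

definition weighted_sum :: "('i \<Rightarrow> 'a) \<Rightarrow> 'a" where
  "weighted_sum x = (\<Sum>i\<in>I. lam i *\<^sub>R P i (x i))"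

text \<open>
  The functional form of the inequality says that the gap is nonnegative, with \<open>\<phi>\<close> the
  quantile of \<open>c\<close>, \<open>u i = Psi (c f i)\<close> and \<open>v = Psi (c h)\<close>.
\<close>

definition gap :: "real \<Rightarrow> ('a \<Rightarrow> real) \<Rightarrow> ('i \<Rightarrow> 'a \<Rightarrow> real) \<Rightarrow> ('i \<Rightarrow> 'a) \<Rightarrow> real" where
  "gap \<phi> v u x = v (weighted_sum x) - \<phi> - (\<Sum>i\<in>I. lam i * (u i (x i) - \<phi>))"

lemma weighted_sum_shift: "weighted_sum (\<lambda>i. x i + z) = weighted_sum x + z"
proof -
  have "weighted_sum (\<lambda>i. x i + z) = weighted_sum x + (\<Sum>i\<in>I. lam i *\<^sub>R P i z)"
    unfolding weighted_sum_def sum.distrib[symmetric]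
    by (intro sum.cong) (auto simp: linear_add[OF lin] scaleR_add_right)
  then show ?thesis by (simp add: resolution)
qed

lemma weighted_sum_update:
  assumes "i \<in> I" shows "weighted_sum (x(i := x i + h)) = weighted_sum x + lam i *\<^sub>R P i h"
proof -
  have "weighted_sum (x(i := x i + h)) = lam i *\<^sub>R P i (x i + h) + (\<Sum>j\<in>I-{i}. lam j *\<^sub>R P j (x j))"
    unfolding weighted_sum_def using assms by (subst sum.remove[of I i]) (auto intro!: sum.cong)
  moreover have "weighted_sum x = lam i *\<^sub>R P i (x i) + (\<Sum>j\<in>I-{i}. lam j *\<^sub>R P j (x j))"
    unfolding weighted_sum_def using assms by (subst sum.remove[of I i]) auto
  ultimately show ?thesis by (simp add: linear_add[OF lin[OF assms]] scaleR_add_right)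
qed

lemma gap_update:
  assumes "i \<in> I"
  shows "gap \<phi> v u (x(i := x i + h)) - gap \<phi> v u x
    = (v (weighted_sum x + lam i *\<^sub>R P i h) - v (weighted_sum x)) - lam i * (u i (x i + h) - u i (x i))"
proof -
  have "(\<Sum>j\<in>I. lam j * (u j ((x(i := x i + h)) j) - \<phi>))
      = lam i * (u i (x i + h) - \<phi>) + (\<Sum>j\<in>I-{i}. lam j * (u j (x j) - \<phi>))"
    using assms by (subst sum.remove[of I i]) (auto intro!: sum.cong)
  moreover have "(\<Sum>j\<in>I. lam j * (u j (x j) - \<phi>))
      = lam i * (u i (x i) - \<phi>) + (\<Sum>j\<in>I-{i}. lam j * (u j (x j) - \<phi>))"
    using assms by (subst sum.remove[of I i]) auto
  ultimately show ?thesis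
    unfolding gap_def weighted_sum_update[OF assms] by (simp add: algebra_simps)
qed

text \<open>
  At an exact minimum, moving \<open>x i\<close> alone shows that the gradient of \<open>u i\<close> is the projection of
  the gradient of \<open>v\<close>. If the value exceeds the infimum by \<open>O(s\<^sup>2)\<close>, a step of length \<open>s\<close>
  against the difference of the two gradients shows that this difference is \<open>O(s)\<close>. With the factor
  \<open>lam i\<close> on the left, the estimate stays uniform as \<open>lam i\<close> tends to 0.
\<close>

lemma near_minimum_gradients:
  assumes i: "i \<in> I" and v: "C11 K v gv" and u: "C11 K (u i) (gu i)"
    and s: "0 < s" and min: "\<And>x. m \<le> gap \<phi> v u x" and near: "gap \<phi> v u x \<le> m + B * s\<^sup>2"
  shows "lam i * norm (P i (gv (weighted_sum x)) - gu i (x i)) \<le> (B + K * ((lam i)\<^sup>2 + lam i)) * s"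
proof -
  define w where "w = P i (gv (weighted_sum x)) - gu i (x i)"
  define l where "l = lam i"
  have l: "0 \<le> l" using lam_nonneg[OF i] by (simp add: l_def)
  have K: "0 \<le> K" using C11D(3)[OF v, of 0] norm_ge_zero order_trans by blast
  show ?thesis
  proof (cases "w = 0")
    case True
    have "0 \<le> B * s\<^sup>2" using min[of x] near by linarith
    then have "0 \<le> B" using s by (simp add: zero_le_mult_iff)
    then show ?thesis using True K l s by (simp add: w_def[symmetric] l_def[symmetric])
  next
    case False
    define h where "h = - (s / norm w) *\<^sub>R w"
    have nh: "norm h = s" using False s by (simp add: h_def)
    have wh: "w \<bullet> h = - (s * norm w)"
      using False by (simp add: h_def power2_norm_eq_inner[symmetric] power2_eq_square)
    have 1: "v (weighted_sum x + l *\<^sub>R P i h) - v (weighted_sum x) \<le> gv (weighted_sum x) \<bullet> (l *\<^sub>R P i h) + K * (norm (l *\<^sub>R P i h))\<^sup>2"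
      using C11D(5)[OF v, of "weighted_sum x" "l *\<^sub>R P i h"] by (simp add: abs_le_iff)
    have 2: "u i (x i + h) - u i (x i) \<ge> gu i (x i) \<bullet> h - K * (norm h)\<^sup>2"
      using C11D(5)[OF u, of "x i" h] by (simp add: abs_le_iff)
    have "(norm (l *\<^sub>R P i h))\<^sup>2 \<le> (l * s)\<^sup>2"
      using norm_P_le[OF i, of h] l nh by (intro power_mono) (auto intro: mult_left_mono)
    then have 3: "K * (norm (l *\<^sub>R P i h))\<^sup>2 \<le> K * (l\<^sup>2 * s\<^sup>2)"
      using K by (intro mult_left_mono) (auto simp: power_mult_distrib)
    have 4: "gv (weighted_sum x) \<bullet> (l *\<^sub>R P i h) = l * (P i (gv (weighted_sum x)) \<bullet> h)"
      by (simp add: selfadj[OF i])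
    have "m \<le> gap \<phi> v u (x(i := x i + h))" by (rule min)
    also have "\<dots> = gap \<phi> v u x + (v (weighted_sum x + l *\<^sub>R P i h) - v (weighted_sum x)) - l * (u i (x i + h) - u i (x i))"
      using gap_update[OF i, of \<phi> v u x h] by (simp add: l_def)
    also have "\<dots> \<le> (m + B * s\<^sup>2) + (l * (P i (gv (weighted_sum x)) \<bullet> h) + K * (l\<^sup>2 * s\<^sup>2)) - l * (gu i (x i) \<bullet> h - K * (norm h)\<^sup>2)"
      using near 1 3 4 mult_left_mono[OF 2 l] by linarith
    also have "\<dots> = m + B * s\<^sup>2 + l * (w \<bullet> h) + K * (l\<^sup>2 + l) * s\<^sup>2"
      unfolding nh w_def by (simp add: inner_diff_left algebra_simps)
    finally have "l * (s * norm w) \<le> (B + K * (l\<^sup>2 + l)) * s\<^sup>2"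
      unfolding wh by (simp add: algebra_simps)
    then have "s * (l * norm w) \<le> s * ((B + K * (l\<^sup>2 + l)) * s)"
      by (simp add: power2_eq_square mult_ac)
    then have "l * norm w \<le> (B + K * (l\<^sup>2 + l)) * s"
      using s by (simp add: mult_le_cancel_left)
    then show ?thesis by (simp add: w_def l_def)
  qed
qed

text \<open>
  One step of the heat flow, of duration \<open>s\<^sup>2\<close>, costs only \<open>O(s\<^sup>3)\<close>. Each function changes by
  \<open>O(s\<^sup>2)\<close>, so only points \<open>x\<close> within \<open>O(s\<^sup>2)\<close> of the minimum matter. There, moving all
  \<open>x i\<close> by the same Gaussian vector \<open>z\<close> moves their weighted sum by \<open>z\<close> as well, so that the means in
  the expansion contribute at least \<open>m\<close>. Replacing the gradient of \<open>u i\<close> by \<open>P i g\<close> costs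
  \<open>O(s)\<close> in the squared norms, hence \<open>O(s\<^sup>3)\<close> in all. What remains is, with \<open>g\<close> the gradient of \<open>v\<close>, minus
  \<open>s\<^sup>2 / 2\<close> times
  \<open>v |g|^2 - (\<Sum>i. lam i * u i * |P i g|^2)
      = gap * |g|^2 + (\<Sum>i. lam i * (u i - \<phi>) * (|g|^2 - |P i g|^2))\<close>,
  because \<open>|g|^2\<close> is the sum of the \<open>lam i * |P i g|^2\<close>. The last sum is nonpositive since
  \<open>u i \<le> \<phi>\<close>, and \<open>gap\<close> is at most \<open>O(s\<^sup>2)\<close> near the minimum since \<open>m \<le> 0\<close>.
\<close>

lemma gap_heat_step:
  assumes K: "0 \<le> K" and M: "0 \<le> M"
  shows "\<exists>K2\<ge>0. \<forall>v gv u gu s v' u' m. C11 K v gv \<longrightarrow> (\<forall>i\<in>I. C11 K (u i) (gu i)) \<longrightarrow>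
    (\<forall>x. \<bar>v x\<bar> \<le> M) \<longrightarrow> (\<forall>i\<in>I. \<forall>x. \<bar>u i x\<bar> \<le> M \<and> u i x \<le> \<phi>) \<longrightarrow> 0 < s \<longrightarrow> s \<le> 1 \<longrightarrow>
    (\<forall>x. Phi (v' x) = (\<integral>z. Phi (v (x + s *\<^sub>R z)) \<partial>gauss)) \<longrightarrow>
    (\<forall>i\<in>I. \<forall>x. Phi (u' i x) = (\<integral>z. Phi (u i (x + s *\<^sub>R z)) \<partial>gauss)) \<longrightarrow>
    m \<le> 0 \<longrightarrow> (\<forall>x. m \<le> gap \<phi> v u x) \<longrightarrow> (\<forall>x. m - K2 * s ^ 3 \<le> gap \<phi> v' u' x)"
proof -
  interpret prob_space "gauss :: 'a measure" by (rule prob_space_gauss)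
  obtain K1 where K1: "K1 \<ge> 0" and exp: "\<And>(u::'a \<Rightarrow> real) g x s u'. C11 K u g \<Longrightarrow> \<forall>x. \<bar>u x\<bar> \<le> M \<Longrightarrow> 0 < s \<Longrightarrow> s \<le> 1
     \<Longrightarrow> Phi u' = (\<integral>z. Phi (u (x + s *\<^sub>R z)) \<partial>gauss) \<Longrightarrow>
     \<bar>u' - ((\<integral>z. u (x + s *\<^sub>R z) \<partial>gauss) - s\<^sup>2 / 2 * u x * (norm (g x))\<^sup>2)\<bar> \<le> K1 * s ^ 3 \<and> \<bar>u' - u x\<bar> \<le> K1 * s\<^sup>2"
    using Phi_mean_expansion[where K=K and M=M and 'a='a] by blast
  define S where "S = (\<Sum>i\<in>I. lam i)"
  have S0: "0 \<le> S" unfolding S_def by (intro sum_nonneg lam_nonneg)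
  have lamS: "lam i \<le> S" if "i \<in> I" for i
    unfolding S_def using that lam_nonneg by (intro member_le_sum) auto
  define B where "B = K1 * (1 + S)"
  have B0: "0 \<le> B" using K1 S0 by (simp add: B_def)
  define K3 where "K3 = B + K * (S\<^sup>2 + S)"
  have K3: "0 \<le> K3" using B0 K S0 by (simp add: K3_def)
  define K4 where "K4 = B * K\<^sup>2 + real (card I) * (2 * M * K * K3)"
  have K4: "0 \<le> K4" using B0 K K3 M by (simp add: K4_def)
  define K2 where "K2 = K4 / 2 + B"
  have K2: "0 \<le> K2" using K4 B0 by (simp add: K2_def)
  have "m - K2 * s ^ 3 \<le> gap \<phi> v' u' x"
    if v: "C11 K v gv" and u: "\<forall>i\<in>I. C11 K (u i) (gu i)"
      and vM: "\<forall>x. \<bar>v x\<bar> \<le> M" and uM: "\<forall>i\<in>I. \<forall>x. \<bar>u i x\<bar> \<le> M \<and> u i x \<le> \<phi>" and s: "0 < s" "s \<le> 1"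
      and v': "\<forall>x. Phi (v' x) = (\<integral>z. Phi (v (x + s *\<^sub>R z)) \<partial>gauss)"
      and u': "\<forall>i\<in>I. \<forall>x. Phi (u' i x) = (\<integral>z. Phi (u i (x + s *\<^sub>R z)) \<partial>gauss)"
      and m: "m \<le> 0" and min: "\<forall>x. m \<le> gap \<phi> v u x" for v gv u gu s v' u' m x
  proof -
    define y where "y = weighted_sum x"
    define G where "G = gap \<phi> v u x"
    have vx: "\<bar>v' y - ((\<integral>z. v (y + s *\<^sub>R z) \<partial>gauss) - s\<^sup>2 / 2 * v y * (norm (gv y))\<^sup>2)\<bar> \<le> K1 * s ^ 3"
      "\<bar>v' y - v y\<bar> \<le> K1 * s\<^sup>2"
      using exp[OF v vM s v'[rule_format]] by auto
    have ux: "\<bar>u' i (x i) - ((\<integral>z. u i (x i + s *\<^sub>R z) \<partial>gauss) - s\<^sup>2 / 2 * u i (x i) * (norm (gu i (x i)))\<^sup>2)\<bar> \<le> K1 * s ^ 3"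
      "\<bar>u' i (x i) - u i (x i)\<bar> \<le> K1 * s\<^sup>2" if i: "i \<in> I" for i
      using exp[OF u[rule_format, OF i] _ s u'[rule_format, OF i], of "x i"] uM i by auto
    have first: "G - B * s\<^sup>2 \<le> gap \<phi> v' u' x"
    proof -
      have "(\<Sum>i\<in>I. lam i * (u' i (x i) - \<phi>)) \<le> (\<Sum>i\<in>I. lam i * (u i (x i) - \<phi>) + lam i * (K1 * s\<^sup>2))"
      proof (rule sum_mono)
        fix i assume i: "i \<in> I"
        have "u' i (x i) - \<phi> \<le> u i (x i) - \<phi> + K1 * s\<^sup>2" using ux(2)[OF i] by linarith
        from mult_left_mono[OF this lam_nonneg[OF i]]
        show "lam i * (u' i (x i) - \<phi>) \<le> lam i * (u i (x i) - \<phi>) + lam i * (K1 * s\<^sup>2)"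
          by (simp add: distrib_left)
      qed
      also have "\<dots> = (\<Sum>i\<in>I. lam i * (u i (x i) - \<phi>)) + S * (K1 * s\<^sup>2)"
        by (simp add: sum.distrib S_def sum_distrib_right)
      finally show ?thesis
        using vx(2) unfolding G_def gap_def y_def B_def by (simp add: algebra_simps abs_le_iff)
    qed
    show ?thesis
    proof (cases "m + B * s\<^sup>2 \<le> G")
      case True
      have "0 \<le> K2 * s ^ 3" using K2 s by simp
      then show ?thesis using True first by linarith
    next
      case False
      then have near: "gap \<phi> v u x \<le> m + B * s\<^sup>2" by (simp add: G_def)
      define g where "g = gv y"
      have gK: "norm g \<le> K" using C11D(3)[OF v] by (simp add: g_def)
      have g2: "(norm g)\<^sup>2 \<le> K\<^sup>2" using gK by (intro power_mono) auto
      define A where "A = v y * (norm g)\<^sup>2 - (\<Sum>i\<in>I. lam i * (u i (x i) * (norm (gu i (x i)))\<^sup>2))"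
      \<comment> \<open>\<open>A\<close> enters the new gap with a negative sign, hence the upper bound.\<close>
      have A: "A \<le> K4 * s"
      proof -
        have summand: "lam i * (u i (x i) * ((norm (P i g))\<^sup>2 - (norm (gu i (x i)))\<^sup>2)) \<le> 2 * M * K * K3 * s" if i: "i \<in> I" for i
        proof -
          have l: "0 \<le> lam i" "lam i \<le> S" using lam_nonneg[OF i] lamS[OF i] by auto
          have "lam i * norm (P i g - gu i (x i)) \<le> (B + K * ((lam i)\<^sup>2 + lam i)) * s"
            unfolding g_def y_def
            by (rule near_minimum_gradients[OF i v, where u=u and gu=gu and m=m and \<phi>=\<phi>])
              (use u i s min near in auto)
          also have "\<dots> \<le> K3 * s"
            unfolding K3_def using l K s by (intro mult_right_mono add_left_mono mult_left_mono add_mono power_mono) auto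
          finally have grad: "lam i * norm (P i g - gu i (x i)) \<le> K3 * s" .
          have "(norm (P i g))\<^sup>2 - (norm (gu i (x i)))\<^sup>2 = (P i g - gu i (x i)) \<bullet> (P i g + gu i (x i))"
            by (simp add: power2_norm_eq_inner inner_diff_left inner_add_right inner_commute[of "gu i (x i)" "P i g"])
          also have "\<bar>\<dots>\<bar> \<le> norm (P i g - gu i (x i)) * norm (P i g + gu i (x i))"
            by (rule Cauchy_Schwarz_ineq2)
          also have "\<dots> \<le> norm (P i g - gu i (x i)) * (2 * K)"
            using norm_triangle_ineq[of "P i g" "gu i (x i)"] norm_P_le[OF i, of g] gK C11D(3)[OF u[rule_format, OF i], of "x i"]
            by (intro mult_left_mono) auto
          finally have sq: "\<bar>(norm (P i g))\<^sup>2 - (norm (gu i (x i)))\<^sup>2\<bar> \<le> norm (P i g - gu i (x i)) * (2 * K)" .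
          have "lam i * (u i (x i) * ((norm (P i g))\<^sup>2 - (norm (gu i (x i)))\<^sup>2))
             \<le> lam i * (\<bar>u i (x i)\<bar> * \<bar>(norm (P i g))\<^sup>2 - (norm (gu i (x i)))\<^sup>2\<bar>)"
            using l(1) by (intro mult_left_mono) (auto simp: abs_mult[symmetric])
          also have "\<dots> \<le> lam i * (M * (norm (P i g - gu i (x i)) * (2 * K)))"
            using l(1) uM i M by (intro mult_left_mono mult_mono sq) auto
          also have "\<dots> = 2 * M * K * (lam i * norm (P i g - gu i (x i)))" by simp
          also have "\<dots> \<le> 2 * M * K * (K3 * s)" using M K by (intro mult_left_mono grad) auto
          finally show ?thesis by (simp add: mult_ac)
        qed
        have "A = (v y * (norm g)\<^sup>2 - (\<Sum>i\<in>I. lam i * (u i (x i) * (norm (P i g))\<^sup>2)))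
           + (\<Sum>i\<in>I. lam i * (u i (x i) * ((norm (P i g))\<^sup>2 - (norm (gu i (x i)))\<^sup>2)))"
          by (simp add: A_def right_diff_distrib sum_subtractf)
        moreover have "(\<Sum>i\<in>I. lam i * (u i (x i) * ((norm (P i g))\<^sup>2 - (norm (gu i (x i)))\<^sup>2)))
            \<le> real (card I) * (2 * M * K * K3 * s)"
          using sum_bounded_above[of I, OF summand] by simp
        moreover have "v y * (norm g)\<^sup>2 - (\<Sum>i\<in>I. lam i * (u i (x i) * (norm (P i g))\<^sup>2)) \<le> B * K\<^sup>2 * s"
        proof -
          have "v y * (norm g)\<^sup>2 - (\<Sum>i\<in>I. lam i * (u i (x i) * (norm (P i g))\<^sup>2))
            = (v y - \<phi>) * (norm g)\<^sup>2 - (\<Sum>i\<in>I. lam i * ((u i (x i) - \<phi>) * (norm (P i g))\<^sup>2))"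
          proof -
            have "(\<Sum>i\<in>I. lam i * ((u i (x i) - \<phi>) * (norm (P i g))\<^sup>2))
               = (\<Sum>i\<in>I. lam i * (u i (x i) * (norm (P i g))\<^sup>2)) - \<phi> * (\<Sum>i\<in>I. lam i * (norm (P i g))\<^sup>2)"
              by (simp add: sum_distrib_left sum_subtractf[symmetric] algebra_simps)
            then show ?thesis by (simp add: sum_norm_P_sq left_diff_distrib)
          qed
          also have "\<dots> \<le> (v y - \<phi>) * (norm g)\<^sup>2 - (\<Sum>i\<in>I. lam i * ((u i (x i) - \<phi>) * (norm g)\<^sup>2))"
          proof (intro diff_left_mono sum_mono, rule mult_left_mono[OF _ lam_nonneg])
            fix i assume i: "i \<in> I"
            have "(norm (P i g))\<^sup>2 \<le> (norm g)\<^sup>2" using norm_P_le[OF i] by (intro power_mono) auto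
            then show "(u i (x i) - \<phi>) * (norm g)\<^sup>2 \<le> (u i (x i) - \<phi>) * (norm (P i g))\<^sup>2"
              using uM i by (intro mult_left_mono_neg) auto
          qed
          also have "\<dots> = G * (norm g)\<^sup>2"
            by (simp add: G_def gap_def y_def left_diff_distrib sum_distrib_right mult.assoc)
          also have "\<dots> \<le> (B * s\<^sup>2) * (norm g)\<^sup>2"
            using False m by (intro mult_right_mono) auto
          also have "\<dots> \<le> (B * s) * K\<^sup>2"
            using B0 s g2 by (intro mult_mono) (auto simp: power2_eq_square mult_left_le)
          finally show ?thesis by (simp add: mult_ac)
        qed
        moreover have "K4 * s = B * K\<^sup>2 * s + real (card I) * (2 * M * K * K3 * s)"
          by (simp add: K4_def algebra_simps)
        ultimately show ?thesis by linarith
      qed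
      define E where "E = (\<integral>z. v (y + s *\<^sub>R z) \<partial>gauss) - \<phi> - (\<Sum>i\<in>I. lam i * ((\<integral>z. u i (x i + s *\<^sub>R z) \<partial>gauss) - \<phi>))"
      have "m \<le> E"
      proof -
        have meas [measurable]: "v \<in> borel_measurable borel" "\<And>i. i \<in> I \<Longrightarrow> u i \<in> borel_measurable borel"
          using C11D(1)[OF v] u by (auto dest: C11D(1))
        have Iv: "integrable gauss (\<lambda>z. v (y + s *\<^sub>R z))"
          by (rule integrable_gauss_bounded[of _ M]) (use vM in auto)
        have Iu: "integrable gauss (\<lambda>z. u i (x i + s *\<^sub>R z))" if "i \<in> I" for i
          by (rule integrable_gauss_bounded[of _ M]) (use uM that in auto)
        have Is: "integrable gauss (\<lambda>z. \<Sum>i\<in>I. lam i * (u i (x i + s *\<^sub>R z) - \<phi>))"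
          by (intro Bochner_Integration.integrable_sum Bochner_Integration.integrable_mult_right
              Bochner_Integration.integrable_diff Iu) auto
        have gz: "gap \<phi> v u (\<lambda>i. x i + s *\<^sub>R z) = v (y + s *\<^sub>R z) - \<phi> - (\<Sum>i\<in>I. lam i * (u i (x i + s *\<^sub>R z) - \<phi>))" for z
          unfolding gap_def weighted_sum_shift y_def ..
        have "integrable gauss (\<lambda>z. gap \<phi> v u (\<lambda>i. x i + s *\<^sub>R z))"
          unfolding gz using Iv Is by auto
        then have "m \<le> (\<integral>z. gap \<phi> v u (\<lambda>i. x i + s *\<^sub>R z) \<partial>gauss)"
          using min by (intro integral_ge_const) auto
        also have "\<dots> = (\<integral>z. v (y + s *\<^sub>R z) \<partial>gauss) - \<phi> - (\<Sum>i\<in>I. \<integral>z. lam i * (u i (x i + s *\<^sub>R z) - \<phi>) \<partial>gauss)"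
          unfolding gz using Iv Is Iu
          by (subst Bochner_Integration.integral_sum[symmetric]) (auto simp: prob_space[simplified])
        also have "\<dots> = E"
          unfolding E_def using Iu by (simp add: prob_space[simplified])
        finally show ?thesis .
      qed
      moreover have "E - s\<^sup>2 / 2 * A - B * s ^ 3 \<le> gap \<phi> v' u' x"
      proof -
        have "(\<Sum>i\<in>I. lam i * (u' i (x i) - \<phi>)) \<le> (\<Sum>i\<in>I. lam i * ((\<integral>z. u i (x i + s *\<^sub>R z) \<partial>gauss) - \<phi>)
             - s\<^sup>2 / 2 * (lam i * (u i (x i) * (norm (gu i (x i)))\<^sup>2)) + lam i * (K1 * s ^ 3))"
        proof (rule sum_mono)
          fix i assume i: "i \<in> I"
          have "u' i (x i) - \<phi> \<le> (\<integral>z. u i (x i + s *\<^sub>R z) \<partial>gauss) - \<phi> - s\<^sup>2 / 2 * u i (x i) * (norm (gu i (x i)))\<^sup>2 + K1 * s ^ 3"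
            using ux(1)[OF i] by linarith
          from mult_left_mono[OF this lam_nonneg[OF i]]
          show "lam i * (u' i (x i) - \<phi>) \<le> lam i * ((\<integral>z. u i (x i + s *\<^sub>R z) \<partial>gauss) - \<phi>)
             - s\<^sup>2 / 2 * (lam i * (u i (x i) * (norm (gu i (x i)))\<^sup>2)) + lam i * (K1 * s ^ 3)"
            by (simp add: algebra_simps)
        qed
        also have "\<dots> = (\<Sum>i\<in>I. lam i * ((\<integral>z. u i (x i + s *\<^sub>R z) \<partial>gauss) - \<phi>))
             - s\<^sup>2 / 2 * (\<Sum>i\<in>I. lam i * (u i (x i) * (norm (gu i (x i)))\<^sup>2)) + S * (K1 * s ^ 3)"
          by (simp add: sum.distrib sum_subtractf S_def sum_distrib_right sum_distrib_left)
        finally show ?thesis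
          using vx(1) unfolding gap_def y_def[symmetric] E_def A_def B_def g_def
          by (simp add: algebra_simps abs_le_iff)
      qed
      moreover have "s\<^sup>2 / 2 * A \<le> K4 / 2 * s ^ 3"
        using mult_left_mono[OF A, of "s\<^sup>2 / 2"] by (simp add: power2_eq_square power3_eq_cube mult_ac)
      ultimately show ?thesis unfolding K2_def by (simp add: algebra_simps)
    qed
  qed
  then show ?thesis using K2 by blast
qed

end

context weighted_projections
begin

text \<open>
  With \<open>N\<close> steps of duration \<open>1 / N\<close> the total loss is at most \<open>N\<close> times \<open>O(N powr (- 3 / 2))\<close>,
  which tends to 0. At time 1 and at the origin, the heat flow gives the Gaussian integrals.
\<close>

lemma functional_inequality:
  assumes c: "0 < c" "c < 1" and e: "0 < e" "e \<le> 1"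
    and h: "C11 K h gh" and f: "\<And>i. i \<in> I \<Longrightarrow> C11 K (f i) (gf i)"
    and hb: "\<And>x. e \<le> h x \<and> h x \<le> 1" and fb: "\<And>i x. i \<in> I \<Longrightarrow> e \<le> f i x \<and> f i x \<le> 1"
    and init: "\<And>x. 0 \<le> gap (Psi c) (\<lambda>x. Psi (c * h x)) (\<lambda>i x. Psi (c * f i x)) x"
  shows "(\<Sum>i\<in>I. lam i * (Psi (c * (\<integral>z. f i z \<partial>gauss)) - Psi c)) \<le> Psi (c * (\<integral>z. h z \<partial>gauss)) - Psi c"
proof -
  obtain K' where K': "\<And>F G :: 'a \<Rightarrow> _. C11 K F G \<Longrightarrow> (\<forall>x. e \<le> F x \<and> F x \<le> 1) \<Longrightarrow>
    C11 K' (\<lambda>x. Psi (c * F x)) (\<lambda>x. (c / rho (Psi (c * F x))) *\<^sub>R G x)"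
    using C11_Psi[OF c e, of K] by blast
  have K'0: "0 \<le> K'" using C11_nonneg[OF K'[OF h]] hb by blast
  define M where "M = \<bar>Psi (c * e)\<bar> + \<bar>Psi c\<bar>"
  have M0: "0 \<le> M" by (simp add: M_def)
  have range: "0 < c * p \<and> c * p < 1 \<and> \<bar>Psi (c * p)\<bar> \<le> M \<and> Psi (c * p) \<le> Psi c" if "e \<le> p" "p \<le> 1" for p
  proof -
    have 1: "0 < c * e" "c * e \<le> c * p" "c * p \<le> c" using that c e by (auto simp: mult_left_le)
    then have 2: "0 < c * p" "c * p < 1" using c by linarith+
    have "Psi (c * e) \<le> Psi (c * p)" by (rule Psi_mono[OF 1(1,2) 2(2)])
    moreover have "Psi (c * p) \<le> Psi c" by (rule Psi_mono[OF 2(1) 1(3) c(2)])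
    ultimately show ?thesis using 2 unfolding M_def by linarith
  qed
  obtain K2 where K2: "K2 \<ge> 0" and step: "\<And>v gv u gu s v' u' m. C11 K' v gv \<Longrightarrow> (\<forall>i\<in>I. C11 K' (u i) (gu i)) \<Longrightarrow>
    (\<forall>x. \<bar>v x\<bar> \<le> M) \<Longrightarrow> (\<forall>i\<in>I. \<forall>x. \<bar>u i x\<bar> \<le> M \<and> u i x \<le> Psi c) \<Longrightarrow> 0 < s \<Longrightarrow> s \<le> 1 \<Longrightarrow>
    (\<forall>x. Phi (v' x) = (\<integral>z. Phi (v (x + s *\<^sub>R z)) \<partial>gauss)) \<Longrightarrow>
    (\<forall>i\<in>I. \<forall>x. Phi (u' i x) = (\<integral>z. Phi (u i (x + s *\<^sub>R z)) \<partial>gauss)) \<Longrightarrow>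
    m \<le> 0 \<Longrightarrow> (\<forall>x. m \<le> gap (Psi c) v u x) \<Longrightarrow> (\<forall>x. m - K2 * s ^ 3 \<le> gap (Psi c) v' u' x)"
    using gap_heat_step[OF K'0 M0, of "Psi c"] by blast
  define D where "D = Psi (c * (\<integral>z. h z \<partial>gauss)) - Psi c - (\<Sum>i\<in>I. lam i * (Psi (c * (\<integral>z. f i z \<partial>gauss)) - Psi c))"
  have "- (K2 * (1 / sqrt (real (Suc n)))) \<le> D" for n
  proof -
    define N where "N = Suc n"
    define s where "s = 1 / sqrt (real N)"
    have N: "0 < N" by (simp add: N_def)
    have s: "0 < s" "s \<le> 1" and s2: "real N * s\<^sup>2 = 1" using N by (auto simp: s_def power_divide)
    define w where "w j F x = Psi (c * heat (sqrt (real j) * s) F x)" for j :: nat and F :: "'a \<Rightarrow> real" and x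
    have hp: "e \<le> heat t F x \<and> heat t F x \<le> 1" if "C11 K F G" "\<forall>x. e \<le> F x \<and> F x \<le> 1" for t F G x
      using heat_bounds[OF C11D(1)[OF that(1)], of e 1 t x] that(2) by blast
    have wC: "\<exists>G'. C11 K' (w j F) G'" if F: "C11 K F G" "\<forall>x. e \<le> F x \<and> F x \<le> 1" for j F G
    proof -
      have "C11 K (heat (sqrt (real j) * s) F) (\<lambda>x. \<integral>z. G (x + (sqrt (real j) * s) *\<^sub>R z) \<partial>gauss)"
        by (rule C11_heat[OF F(1), of 1]) (use F(2) e in \<open>smt (verit)\<close>)
      from K'[OF this] hp[OF F] show ?thesis unfolding w_def[abs_def] by blast
    qed
    have wb: "\<bar>w j F x\<bar> \<le> M \<and> w j F x \<le> Psi c" if "C11 K F G" "\<forall>x. e \<le> F x \<and> F x \<le> 1" for j F G x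
      unfolding w_def using range hp[OF that] by blast
    have wstep: "Phi (w (Suc j) F x) = (\<integral>z. Phi (w j F (x + s *\<^sub>R z)) \<partial>gauss)"
      if F: "C11 K F G" "\<forall>x. e \<le> F x \<and> F x \<le> 1" for j F G x
    proof -
      have r: "Phi (w j F y) = c * heat (sqrt (real j) * s) F y" for j y
        unfolding w_def using range hp[OF F] by (intro Phi_Psi) blast+
      have "sqrt (s\<^sup>2 + (sqrt (real j) * s)\<^sup>2) = sqrt (real (Suc j) * s\<^sup>2)"
        by (simp add: power_mult_distrib algebra_simps)
      also have "\<dots> = sqrt (real (Suc j)) * s" using s by (simp add: real_sqrt_mult)
      finally have "heat (sqrt (real (Suc j)) * s) F x = heat s (heat (sqrt (real j) * s) F) x"
        using heat_heat[OF C11D(1)[OF F(1)], of 1 s "sqrt (real j) * s" x] F(2) e by (smt (verit))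
      then show ?thesis unfolding r by (simp add: heat_def)
    qed
    obtain Gh where Gh: "\<And>j. C11 K' (w j h) (Gh j)" using wC[OF h] hb by metis
    have "\<forall>j. \<forall>i\<in>I. \<exists>G'. C11 K' (w j (f i)) G'" using wC f fb by blast
    then obtain Gf where Gf: "\<And>j i. i \<in> I \<Longrightarrow> C11 K' (w j (f i)) (Gf j i)" by metis
    have claim: "\<forall>x. - (real j * (K2 * s ^ 3)) \<le> gap (Psi c) (w j h) (\<lambda>i. w j (f i)) x" for j
    proof (induction j)
      case 0
      then show ?case using init by (simp add: w_def[abs_def] gap_def)
    next
      case (Suc j)
      have "\<forall>x. - (real j * (K2 * s ^ 3)) - K2 * s ^ 3 \<le> gap (Psi c) (w (Suc j) h) (\<lambda>i. w (Suc j) (f i)) x"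
      proof (rule step[where s=s and gv="Gh j" and gu="Gf j"])
        show "C11 K' (w j h) (Gh j)" "\<forall>i\<in>I. C11 K' (w j (f i)) (Gf j i)" using Gh Gf by auto
        show "\<forall>x. \<bar>w j h x\<bar> \<le> M" using wb[OF h] hb by blast
        show "\<forall>i\<in>I. \<forall>x. \<bar>w j (f i) x\<bar> \<le> M \<and> w j (f i) x \<le> Psi c" using wb f fb by blast
        show "\<forall>x. Phi (w (Suc j) h x) = (\<integral>z. Phi (w j h (x + s *\<^sub>R z)) \<partial>gauss)" using wstep[OF h] hb by blast
        show "\<forall>i\<in>I. \<forall>x. Phi (w (Suc j) (f i) x) = (\<integral>z. Phi (w j (f i) (x + s *\<^sub>R z)) \<partial>gauss)" using wstep f fb by blast
        show "- (real j * (K2 * s ^ 3)) \<le> 0" using K2 s by simp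
      qed (use s Suc in auto)
      moreover have "- (real (Suc j) * (K2 * s ^ 3)) = - (real j * (K2 * s ^ 3)) - K2 * s ^ 3"
        by (simp add: distrib_right)
      ultimately show ?case by simp
    qed
    have "sqrt (real N) * s = 1" using N by (simp add: s_def)
    then have wN: "w N F 0 = Psi (c * (\<integral>z. F z \<partial>gauss))" for F by (simp add: w_def heat_def)
    have "weighted_sum (\<lambda>_. 0) = 0" unfolding weighted_sum_def by (intro sum.neutral) (auto simp: linear_0[OF lin])
    then have "gap (Psi c) (w N h) (\<lambda>i. w N (f i)) (\<lambda>_. 0) = D"
      by (simp add: gap_def D_def wN)
    then have "- (real N * (K2 * s ^ 3)) \<le> D" using claim[of N] by metis
    also have "real N * (K2 * s ^ 3) = K2 * (real N * s\<^sup>2) * s" by (simp add: power2_eq_square power3_eq_cube)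
    finally show ?thesis unfolding s2 by (simp add: s_def N_def)
  qed
  moreover have "(\<lambda>n. - (K2 * (1 / sqrt (real (Suc n))))) \<longlonglongrightarrow> - (K2 * 0)"
  proof (intro tendsto_minus tendsto_mult tendsto_const)
    have "(\<lambda>n. sqrt (inverse (real (Suc n)))) \<longlonglongrightarrow> sqrt 0"
      by (intro tendsto_real_sqrt LIMSEQ_inverse_real_of_nat)
    then show "(\<lambda>n. 1 / sqrt (real (Suc n))) \<longlonglongrightarrow> 0"
      by (simp add: real_sqrt_inverse inverse_eq_divide[symmetric])
  qed
  ultimately have "- (K2 * 0) \<le> D" by (intro LIMSEQ_le_const2) auto
  then show ?thesis by (simp add: D_def)
qed

end

section \<open>From functions to sets\<close>

context weighted_projections
begin

text \<open>
  The functions \<open>f i\<close> are 1 on \<open>A i\<close> and drop, outside a neighbourhood, to the level where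
  \<open>Psi (c f i)\<close> is \<open>M / lam i\<close> below its maximum \<open>\<phi>\<close>; the function \<open>h\<close> is 1 on a
  neighbourhood of \<open>L\<close> and drops to the level that is \<open>M\<close> below. If every \<open>x i\<close> projects close to
  \<open>A i\<close>, then the weighted sum is close to \<open>L\<close> and \<open>h\<close> is maximal there; otherwise a single term
  already contributes \<open>- M\<close>. In both cases the gap is nonnegative.
\<close>

lemma gauss_smooth_comparison:
  assumes c: "0 < c" "c < 1" and lam: "\<And>i. i \<in> I \<Longrightarrow> 0 < lam i"
    and A: "\<And>i. i \<in> I \<Longrightarrow> compact (A i)" "\<And>i. i \<in> I \<Longrightarrow> 0 < measure gauss {z. P i z \<in> A i}"
    and L: "compact L" "L \<noteq> {}" "\<And>x. (\<And>i. i \<in> I \<Longrightarrow> x i \<in> A i) \<Longrightarrow> weighted_sum x \<in> L"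
    and M: "0 < M" and r: "0 < r"
  shows "Phi (Psi c + (\<Sum>i\<in>I. lam i * (Psi (c * measure gauss {z. P i z \<in> A i}) - Psi c)))
    \<le> Phi (Psi c - M) + c * measure gauss {z. infdist z L \<le> r}"
proof -
  interpret prob_space "gauss :: 'a measure" by (rule prob_space_gauss)
  define S where "S = (\<Sum>i\<in>I. lam i)"
  have S0: "0 \<le> S" unfolding S_def by (intro sum_nonneg lam_nonneg)
  \<comment> \<open>Points within \<open>e\<close> of the \<open>A i\<close> have a weighted sum within \<open>S * e\<close> of \<open>L\<close>; the cutoff of that neighbourhood needs another \<open>e\<close>.\<close>
  define e where "e = r / (S + 1)"
  have "(S + 1) * e = r" using S0 by (simp add: e_def)
  then have e2: "S * e + e = r" by (simp add: distrib_right)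
  have "0 < e" using r S0 by (simp add: e_def)
  note e = this e2
  define \<phi> where "\<phi> = Psi c"
  have Phi\<phi>: "Phi \<phi> = c" using c by (simp add: \<phi>_def Phi_Psi)
  \<comment> \<open>The value of a function \<open>f\<close> for which \<open>Psi (c * f)\<close> is \<open>t\<close> below its maximum.\<close>
  define \<eta> where "\<eta> t = Phi (\<phi> - t) / c" for t
  have \<eta>: "0 < \<eta> t" "\<eta> t < 1" "Psi (c * \<eta> t) = \<phi> - t" if "0 < t" for t
  proof -
    have "Phi (\<phi> - t) < Phi \<phi>" using that by simp
    then show "\<eta> t < 1" using c by (simp add: \<eta>_def Phi\<phi>)
    show "0 < \<eta> t" using c by (simp add: \<eta>_def)
    show "Psi (c * \<eta> t) = \<phi> - t" using c by (simp add: \<eta>_def)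
  qed
  define T where "T = {z. infdist z L \<le> S * e}"
  have T: "compact T"
  proof (cases "S = 0")
    case True
    have "z \<in> T \<longleftrightarrow> z \<in> L" for z
      using in_closed_iff_infdist_zero[OF compact_imp_closed[OF L(1)] L(2), of z] infdist_nonneg[of z L] True
      by (auto simp: T_def)
    then have "T = L" by blast
    then show ?thesis using L by simp
  next
    case False
    then show ?thesis unfolding T_def using L S0 e by (intro compact_infdist_le) auto
  qed
  obtain Kh bh gh where bh: "C11 Kh bh gh" "\<And>x. 0 \<le> bh x \<and> bh x \<le> 1" "\<And>x. x \<in> T \<Longrightarrow> bh x = 1"
    "\<And>x. 0 < bh x \<Longrightarrow> \<exists>a\<in>T. dist a x < e"
    using C11_cutoff[OF T e(1)] by blast
  have "\<forall>i\<in>I. \<exists>K b g. C11 K b g \<and> (\<forall>x. 0 \<le> b x \<and> b x \<le> 1) \<and> (\<forall>x\<in>A i. b x = 1) \<and>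
    (\<forall>x. 0 < b x \<longrightarrow> (\<exists>a\<in>A i. dist a x < e))"
    using C11_cutoff[OF A(1) e(1)] by blast
  then obtain Kb b gb where b: "\<And>i. i \<in> I \<Longrightarrow> C11 (Kb i) (b i) (gb i)" "\<And>i x. i \<in> I \<Longrightarrow> 0 \<le> b i x \<and> b i x \<le> 1"
    "\<And>i x. i \<in> I \<Longrightarrow> x \<in> A i \<Longrightarrow> b i x = 1"
    "\<And>i x. i \<in> I \<Longrightarrow> 0 < b i x \<Longrightarrow> \<exists>a\<in>A i. dist a x < e"
    by metis
  define f where "f i x = (1 - \<eta> (M / lam i)) * b i (P i x) + \<eta> (M / lam i)" for i x
  define h where "h x = (1 - \<eta> M) * bh x + \<eta> M" for x
  have Mi: "0 < M / lam i" if "i \<in> I" for i using M lam[OF that] by simp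
  define K where "K = \<bar>1 - \<eta> M\<bar> * Kh + (\<Sum>i\<in>I. \<bar>1 - \<eta> (M / lam i)\<bar> * Kb i)"
  have nn: "0 \<le> \<bar>1 - \<eta> (M / lam i)\<bar> * Kb i" if "i \<in> I" for i
    using C11_nonneg[OF b(1)[OF that]] by simp
  have nh: "0 \<le> \<bar>1 - \<eta> M\<bar> * Kh" using C11_nonneg[OF bh(1)] by simp
  have hC: "\<exists>G. C11 K h G"
  proof -
    have "\<bar>1 - \<eta> M\<bar> * Kh \<le> K" unfolding K_def using nn by (simp add: sum_nonneg)
    from C11_mono[OF C11_affine[OF bh(1), of "1 - \<eta> M" "\<eta> M"] this] show ?thesis
      unfolding h_def[abs_def] by blast
  qed
  have fC: "\<exists>G. C11 K (f i) G" if i: "i \<in> I" for i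
  proof -
    have "\<bar>1 - \<eta> (M / lam i)\<bar> * Kb i \<le> (\<Sum>i\<in>I. \<bar>1 - \<eta> (M / lam i)\<bar> * Kb i)"
      using i nn by (intro member_le_sum) auto
    then have "\<bar>1 - \<eta> (M / lam i)\<bar> * Kb i \<le> K" unfolding K_def using nh by linarith
    moreover have "C11 (\<bar>1 - \<eta> (M / lam i)\<bar> * Kb i) (f i) (\<lambda>x. (1 - \<eta> (M / lam i)) *\<^sub>R P i (gb i (P i x)))"
      unfolding f_def[abs_def]
      by (rule C11_affine[OF C11_projection[OF b(1)[OF i] lin[OF i] selfadj[OF i] norm_P_le[OF i]]])
    ultimately show ?thesis using C11_mono by blast
  qed
  have mix: "t \<le> (1 - t) * y + t \<and> (1 - t) * y + t \<le> 1" if "0 < t" "t < 1" "0 \<le> y" "y \<le> 1" for t y :: real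
  proof -
    have "0 \<le> (1 - t) * y" "(1 - t) * y \<le> (1 - t) * 1" using that by (auto intro: mult_left_mono)
    then show ?thesis by auto
  qed
  have hb: "\<eta> M \<le> h x \<and> h x \<le> 1" for x
    unfolding h_def using mix[OF \<eta>(1)[OF M] \<eta>(2)[OF M]] bh(2) by blast
  have fb: "\<eta> (M / lam i) \<le> f i x \<and> f i x \<le> 1" if "i \<in> I" for i x
    unfolding f_def using mix[OF \<eta>(1)[OF Mi[OF that]] \<eta>(2)[OF Mi[OF that]]] b(2)[OF that] by blast
  define e0 where "e0 = Min (insert (\<eta> M) ((\<lambda>i. \<eta> (M / lam i)) ` I))"
  have e0: "0 < e0" "e0 \<le> \<eta> M" "\<And>i. i \<in> I \<Longrightarrow> e0 \<le> \<eta> (M / lam i)"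
    unfolding e0_def using \<eta>(1)[OF M] \<eta>(1)[OF Mi] by auto
  have Psimono: "Psi (c * p) \<le> Psi (c * q)" if "0 < p" "p \<le> q" "q \<le> 1" for p q
  proof (rule Psi_mono)
    have "c * q \<le> c" using c that by (simp add: mult_left_le)
    then show "c * q < 1" using c by linarith
  qed (use c that in auto)
  have init: "0 \<le> gap (Psi c) (\<lambda>x. Psi (c * h x)) (\<lambda>i x. Psi (c * f i x)) x" for x
  proof -
    have fle: "Psi (c * f i (x i)) \<le> \<phi>" if "i \<in> I" for i
      using Psimono[of "f i (x i)" 1] fb[OF that, of "x i"] \<eta>(1)[OF Mi[OF that]] by (simp add: \<phi>_def)
    have hge: "\<phi> - M \<le> Psi (c * h (weighted_sum x))"
      using Psimono[of "\<eta> M" "h (weighted_sum x)"] hb[of "weighted_sum x"] \<eta>[OF M] by simp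
    show ?thesis
    proof (cases "\<forall>i\<in>I. 0 < b i (P i (x i))")
      case True
      then have "\<forall>i\<in>I. \<exists>a\<in>A i. dist a (P i (x i)) < e" using b(4) by blast
      then obtain a where a: "\<And>i. i \<in> I \<Longrightarrow> a i \<in> A i" "\<And>i. i \<in> I \<Longrightarrow> dist (a i) (P i (x i)) < e" by metis
      have "weighted_sum a \<in> L" by (rule L(3)) (rule a(1))
      then have "infdist (weighted_sum x) L \<le> dist (weighted_sum x) (weighted_sum a)" by (rule infdist_le)
      also have "\<dots> = norm (\<Sum>i\<in>I. lam i *\<^sub>R P i (P i (x i) - a i))"
        unfolding dist_norm weighted_sum_def sum_subtractf[symmetric]
        by (intro arg_cong[where f=norm] sum.cong) (auto simp: linear_diff[OF lin] idem scaleR_diff_right)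
      also have "\<dots> \<le> (\<Sum>i\<in>I. lam i * e)"
      proof (rule sum_norm_le)
        fix i assume i: "i \<in> I"
        have "norm (P i (P i (x i) - a i)) \<le> norm (P i (x i) - a i)" by (rule norm_P_le[OF i])
        also have "\<dots> \<le> e" using a(2)[OF i] by (simp add: dist_norm norm_minus_commute)
        finally show "norm (lam i *\<^sub>R P i (P i (x i) - a i)) \<le> lam i * e"
          using lam_nonneg[OF i] by (simp add: mult_left_mono)
      qed
      also have "\<dots> = S * e" by (simp add: S_def sum_distrib_right)
      finally have "h (weighted_sum x) = 1" using bh(3)[of "weighted_sum x"] by (simp add: T_def h_def)
      moreover have "(\<Sum>i\<in>I. lam i * (Psi (c * f i (x i)) - \<phi>)) \<le> 0"
        using fle lam_nonneg by (intro sum_nonpos) (simp add: mult_nonneg_nonpos)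
      ultimately show ?thesis by (simp add: gap_def \<phi>_def)
    next
      case False
      then obtain i where i: "i \<in> I" "\<not> 0 < b i (P i (x i))" by blast
      then have "b i (P i (x i)) = 0" using b(2)[OF i(1), of "P i (x i)"] by linarith
      then have "Psi (c * f i (x i)) = \<phi> - M / lam i" by (simp add: f_def \<eta>(3)[OF Mi[OF i(1)]])
      then have "lam i * (Psi (c * f i (x i)) - \<phi>) = - M" using lam[OF i(1)] by simp
      moreover have "(\<Sum>j\<in>I - {i}. lam j * (Psi (c * f j (x j)) - \<phi>)) \<le> 0"
        using fle lam_nonneg by (intro sum_nonpos) (simp add: mult_nonneg_nonpos)
      ultimately have "(\<Sum>j\<in>I. lam j * (Psi (c * f j (x j)) - \<phi>)) \<le> - M"
        using i(1) by (subst sum.remove[of I i]) auto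
      then show ?thesis using hge by (simp add: gap_def \<phi>_def)
    qed
  qed
  obtain G where G: "C11 K h G" using hC by blast
  obtain Gf where Gf: "\<And>i. i \<in> I \<Longrightarrow> C11 K (f i) (Gf i)" using fC by metis
  have main: "(\<Sum>i\<in>I. lam i * (Psi (c * (\<integral>z. f i z \<partial>gauss)) - Psi c)) \<le> Psi (c * (\<integral>z. h z \<partial>gauss)) - Psi c"
  proof (rule functional_inequality[OF c e0(1) _ G Gf])
    show "e0 \<le> 1" using e0(2) \<eta>(2)[OF M] by linarith
    show "e0 \<le> h x \<and> h x \<le> 1" for x using hb[of x] e0(2) by linarith
    show "e0 \<le> f i x \<and> f i x \<le> 1" if "i \<in> I" for i x using fb[OF that, of x] e0(3)[OF that] by linarith
  qed (auto intro: init)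
  have lower: "Psi (c * measure gauss {z. P i z \<in> A i}) \<le> Psi (c * (\<integral>z. f i z \<partial>gauss))" if i: "i \<in> I" for i
  proof -
    have Pm [measurable]: "P i \<in> borel_measurable borel"
      by (rule linear_borel_measurable[OF lin[OF i]])
    have [measurable]: "A i \<in> sets borel" using A(1)[OF i] by (simp add: compact_imp_closed)
    have set: "{z. P i z \<in> A i} \<in> sets borel" by measurable
    have fint: "integrable gauss (f i)"
      by (rule integrable_gauss_bounded[OF C11D(1)[OF Gf[OF i]], of 1])
        (use fb[OF i] \<eta>(1)[OF Mi[OF i]] in \<open>smt (verit)\<close>)
    have "measure gauss {z. P i z \<in> A i} = (\<integral>z. indicator {z. P i z \<in> A i} z \<partial>gauss)"
      using set by simp
    also have "\<dots> \<le> (\<integral>z. f i z \<partial>gauss)"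
    proof (rule integral_mono[OF _ fint])
      show "integrable gauss (indicat_real {z. P i z \<in> A i})" using set by (simp add: emeasure_eq_measure)
      fix z show "indicat_real {z. P i z \<in> A i} z \<le> f i z"
        using b(3)[OF i, of "P i z"] fb[OF i, of z] \<eta>(1)[OF Mi[OF i]] by (auto simp: indicator_def f_def)
    qed
    finally show ?thesis
      using integral_le_const[OF fint, of 1] fb[OF i] by (intro Psimono A(2) i) auto
  qed
  have hint: "integrable gauss h"
    by (rule integrable_gauss_bounded[OF C11D(1)[OF G], of 1]) (use hb \<eta>(1)[OF M] in \<open>smt (verit)\<close>)
  have h0: "0 < (\<integral>z. h z \<partial>gauss)" "(\<integral>z. h z \<partial>gauss) \<le> 1"
  proof -
    have "\<eta> M \<le> (\<integral>z. h z \<partial>gauss)" using hb by (intro integral_ge_const hint) auto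
    then show "0 < (\<integral>z. h z \<partial>gauss)" using \<eta>(1)[OF M] by linarith
    show "(\<integral>z. h z \<partial>gauss) \<le> 1" using hb by (intro integral_le_const hint) auto
  qed
  have cl: "{z. infdist z L \<le> r} \<in> sets borel"
    by (intro borel_closed closed_Collect_le continuous_intros)
  have upper: "(\<integral>z. h z \<partial>gauss) \<le> \<eta> M + measure gauss {z. infdist z L \<le> r}"
  proof -
    have "(\<integral>z. h z \<partial>gauss) \<le> (\<integral>z. \<eta> M + indicat_real {z. infdist z L \<le> r} z \<partial>gauss)"
    proof (rule integral_mono[OF hint])
      show "integrable gauss (\<lambda>z. \<eta> M + indicat_real {z. infdist z L \<le> r} z)"
        using cl by (simp add: emeasure_eq_measure)
      fix z
      show "h z \<le> \<eta> M + indicat_real {z. infdist z L \<le> r} z"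
      proof (cases "0 < bh z")
        case True
        then obtain y where y: "y \<in> T" "dist y z < e" using bh(4) by blast
        have "infdist z L \<le> infdist y L + dist z y" by (rule infdist_triangle)
        also have "\<dots> \<le> r" using y e(2) by (simp add: T_def dist_commute)
        finally show ?thesis using hb[of z] \<eta>(1)[OF M] by simp
      next
        case False
        then have "bh z = 0" using bh(2)[of z] by linarith
        then show ?thesis by (simp add: h_def)
      qed
    qed
    also have "\<dots> = \<eta> M + measure gauss {z. infdist z L \<le> r}"
      using cl by (simp add: prob_space[simplified] emeasure_eq_measure)
    finally show ?thesis .
  qed
  have "(\<Sum>i\<in>I. lam i * (Psi (c * measure gauss {z. P i z \<in> A i}) - Psi c))
    \<le> (\<Sum>i\<in>I. lam i * (Psi (c * (\<integral>z. f i z \<partial>gauss)) - Psi c))"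
    using lower lam_nonneg by (intro sum_mono mult_left_mono) auto
  with main have "Psi c + (\<Sum>i\<in>I. lam i * (Psi (c * measure gauss {z. P i z \<in> A i}) - Psi c)) \<le> Psi (c * (\<integral>z. h z \<partial>gauss))"
    by linarith
  then have "Phi (Psi c + (\<Sum>i\<in>I. lam i * (Psi (c * measure gauss {z. P i z \<in> A i}) - Psi c))) \<le> Phi (Psi (c * (\<integral>z. h z \<partial>gauss)))"
    by simp
  also have "\<dots> = c * (\<integral>z. h z \<partial>gauss)"
  proof (rule Phi_Psi)
    have "c * (\<integral>z. h z \<partial>gauss) \<le> c" using c h0 by (simp add: mult_left_le)
    then show "c * (\<integral>z. h z \<partial>gauss) < 1" using c by linarith
  qed (use c h0 in simp)
  also have "\<dots> \<le> c * (\<eta> M + measure gauss {z. infdist z L \<le> r})"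
    using upper c by (intro mult_left_mono) auto
  also have "\<dots> = Phi (Psi c - M) + c * measure gauss {z. infdist z L \<le> r}"
    using c by (simp add: distrib_left \<eta>_def \<phi>_def)
  finally show ?thesis .
qed

text \<open>
  Let the levels tend to 0 and the neighbourhoods shrink to the compact set \<open>L\<close>.
\<close>

lemma gauss_compact_inequality:
  assumes c: "0 < c" "c < 1" and lam: "\<And>i. i \<in> I \<Longrightarrow> 0 < lam i"
    and A: "\<And>i. i \<in> I \<Longrightarrow> compact (A i)" "\<And>i. i \<in> I \<Longrightarrow> 0 < measure gauss {z. P i z \<in> A i}"
    and L: "compact L" "L \<noteq> {}" "\<And>x. (\<And>i. i \<in> I \<Longrightarrow> x i \<in> A i) \<Longrightarrow> weighted_sum x \<in> L"
  shows "Phi (Psi c + (\<Sum>i\<in>I. lam i * (Psi (c * measure gauss {z. P i z \<in> A i}) - Psi c)))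
    \<le> c * measure gauss L" (is "?lhs \<le> _")
proof -
  interpret prob_space "gauss :: 'a measure" by (rule prob_space_gauss)
  have "?lhs \<le> Phi (Psi c - real (Suc n)) + c * measure gauss {z. infdist z L \<le> inverse (real (Suc n))}" for n
    by (rule gauss_smooth_comparison[OF c lam A L]) auto
  moreover have "(\<lambda>n. Phi (Psi c - real (Suc n)) + c * measure gauss {z. infdist z L \<le> inverse (real (Suc n))})
      \<longlonglongrightarrow> 0 + c * measure gauss L"
  proof (intro tendsto_add tendsto_mult tendsto_const)
    have "filterlim (\<lambda>n. Psi c - real (Suc n)) at_bot sequentially"
      by real_asymp
    then show "(\<lambda>n. Phi (Psi c - real (Suc n))) \<longlonglongrightarrow> 0"
      by (rule filterlim_compose[OF Phi_bot])
    have "(\<Inter>n. {z. infdist z L \<le> inverse (real (Suc n))}) = L"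
    proof (intro equalityI subsetI)
      fix z assume "z \<in> (\<Inter>n. {z. infdist z L \<le> inverse (real (Suc n))})"
      then have "infdist z L \<le> 0"
        by (intro LIMSEQ_le_const[OF LIMSEQ_inverse_real_of_nat]) auto
      then show "z \<in> L"
        using L(1,2) infdist_nonneg[of z L] by (simp add: in_closed_iff_infdist_zero[OF compact_imp_closed])
    qed auto
    moreover have "decseq (\<lambda>n. {z. infdist z L \<le> inverse (real (Suc n))})"
    proof (rule decseq_SucI)
      fix n
      have "inverse (real (Suc (Suc n))) \<le> inverse (real (Suc n))" by (intro le_imp_inverse_le) auto
      then show "{z. infdist z L \<le> inverse (real (Suc (Suc n)))} \<subseteq> {z. infdist z L \<le> inverse (real (Suc n))}"
        using order_trans by blast
    qed
    moreover have "range (\<lambda>n. {z. infdist z L \<le> inverse (real (Suc n))}) \<subseteq> sets gauss"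
      by (auto intro!: borel_closed closed_Collect_le continuous_intros)
    ultimately show "(\<lambda>n. measure gauss {z. infdist z L \<le> inverse (real (Suc n))}) \<longlonglongrightarrow> measure gauss L"
      using finite_Lim_measure_decseq by metis
  qed
  ultimately show ?thesis by (intro LIMSEQ_le_const) auto
qed

lemma compact_weighted_sum_image:
  assumes "\<And>i. i \<in> I \<Longrightarrow> compact (A i)"
  shows "compact {weighted_sum x | x. \<forall>i\<in>I. x i \<in> A i}"
proof -
  have "compactin (product_topology (\<lambda>i. euclidean) UNIV) (PiE UNIV (\<lambda>i. if i \<in> I then A i else {0}))"
    using assms by (subst compactin_PiE) auto
  then have "compact (PiE UNIV (\<lambda>i. if i \<in> I then A i else {0}))"
    by (simp add: euclidean_product_topology)
  moreover have "continuous_on UNIV weighted_sum"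
    unfolding weighted_sum_def[abs_def]
  proof (intro continuous_on_sum continuous_on_scaleR continuous_on_const)
    fix i assume "i \<in> I"
    then have "continuous_on UNIV (P i)" using lin by (simp add: linear_continuous_on linear_conv_bounded_linear)
    then show "continuous_on UNIV (\<lambda>x. P i (x i))"
      by (rule continuous_on_compose2[OF _ continuous_on_product_coordinates]) auto
  qed
  ultimately have "compact (weighted_sum ` PiE UNIV (\<lambda>i. if i \<in> I then A i else {0}))"
    by (intro compact_continuous_image) (auto intro: continuous_on_subset)
  also have "weighted_sum ` PiE UNIV (\<lambda>i. if i \<in> I then A i else {0}) = {weighted_sum x | x. \<forall>i\<in>I. x i \<in> A i}"
  proof (intro equalityI subsetI)
    fix y assume "y \<in> {weighted_sum x | x. \<forall>i\<in>I. x i \<in> A i}"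
    then obtain x where x: "y = weighted_sum x" "\<forall>i\<in>I. x i \<in> A i" by blast
    have "weighted_sum x = weighted_sum (\<lambda>i. if i \<in> I then x i else 0)" unfolding weighted_sum_def by (intro sum.cong) auto
    then show "y \<in> weighted_sum ` PiE UNIV (\<lambda>i. if i \<in> I then A i else {0})" using x by auto
  next
    fix y assume "y \<in> weighted_sum ` PiE UNIV (\<lambda>i. if i \<in> I then A i else {0})"
    then obtain x where x: "y = weighted_sum x" "x \<in> PiE UNIV (\<lambda>i. if i \<in> I then A i else {0})" by blast
    have "x i \<in> A i" if "i \<in> I" for i using PiE_mem[OF x(2), of i] that by simp
    then show "y \<in> {weighted_sum x | x. \<forall>i\<in>I. x i \<in> A i}" using x(1) by blast
  qed
  finally show ?thesis .
qed

text \<open>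
  Inner regularity gives compact subsets of the \<open>A i\<close> of measure greater than \<open>t\<close> times that of
  \<open>A i\<close>, with \<open>t\<close> tending to 1; the quantile function is continuous at the points in question.
  The set \<open>S\<close> is compared only with the compact sets of weighted sums that it contains; so it
  may be measurable in the completed sense only.
\<close>

lemma gauss_borel_inequality:
  assumes c: "0 < c" "c < 1" and lam: "\<And>i. i \<in> I \<Longrightarrow> 0 < lam i"
    and A: "\<And>i. i \<in> I \<Longrightarrow> A i \<in> sets borel" "\<And>i. i \<in> I \<Longrightarrow> 0 < measure gauss {z. P i z \<in> A i}"
    and S: "S \<in> sets (completion gauss)" "\<And>x. (\<And>i. i \<in> I \<Longrightarrow> x i \<in> A i) \<Longrightarrow> weighted_sum x \<in> S"
  shows "Phi (Psi c + (\<Sum>i\<in>I. lam i * (Psi (c * measure gauss {z. P i z \<in> A i}) - Psi c)))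
    \<le> c * measure (completion gauss) S"
proof -
  interpret prob_space "gauss :: 'a measure" by (rule prob_space_gauss)
  interpret cg: prob_space "completion (gauss :: 'a measure)" by (rule prob_space_completion)
  define p where "p i = measure gauss {z. P i z \<in> A i}" for i
  have p: "0 < p i" "p i \<le> 1" if "i \<in> I" for i using A(2)[OF that] by (auto simp: p_def)
  have bound: "Phi (Psi c + (\<Sum>i\<in>I. lam i * (Psi (c * (t * p i)) - Psi c))) \<le> c * measure (completion gauss) S"
    if t: "0 < t" "t < 1" for t
  proof -
    have "\<exists>K. compact K \<and> K \<subseteq> A i \<and> t * p i < measure gauss {z. P i z \<in> K}" if i: "i \<in> I" for i
    proof -
      have Pm [measurable]: "P i \<in> borel_measurable borel"
        by (rule linear_borel_measurable[OF lin[OF i]])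
      interpret D: prob_space "distr gauss borel (P i)" by (rule prob_space_distr) simp
      have eqm: "emeasure (distr gauss borel (P i)) X = ennreal (measure gauss {z. P i z \<in> X})" if "X \<in> sets borel" for X
        using that by (simp add: emeasure_distr emeasure_eq_measure vimage_def)
      have "ennreal (t * p i) < emeasure (distr gauss borel (P i)) (A i)"
        using t p[OF i] by (subst eqm[OF A(1)[OF i]]) (simp add: p_def[symmetric] ennreal_less_iff)
      also have "\<dots> = (SUP K \<in> {K. K \<subseteq> A i \<and> compact K}. emeasure (distr gauss borel (P i)) K)"
        by (rule inner_regular) (auto simp: A(1)[OF i])
      finally obtain K where K: "K \<subseteq> A i" "compact K" "ennreal (t * p i) < emeasure (distr gauss borel (P i)) K"
        unfolding less_SUP_iff by blast
      have "K \<in> sets borel" using K(2) by (simp add: compact_imp_closed)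
      then have "t * p i < measure gauss {z. P i z \<in> K}"
        using K(3) t p[OF i] by (simp add: eqm ennreal_less_iff)
      then show ?thesis using K by blast
    qed
    then obtain K where K: "\<And>i. i \<in> I \<Longrightarrow> compact (K i)" "\<And>i. i \<in> I \<Longrightarrow> K i \<subseteq> A i"
      "\<And>i. i \<in> I \<Longrightarrow> t * p i < measure gauss {z. P i z \<in> K i}" by metis
    have tp: "0 < t * p i" if "i \<in> I" for i using t p[OF that] by simp
    define L where "L = {weighted_sum x | x. \<forall>i\<in>I. x i \<in> K i}"
    have L: "compact L" unfolding L_def by (rule compact_weighted_sum_image) (rule K(1))
    have "K i \<noteq> {}" if "i \<in> I" for i using K(3)[OF that] tp[OF that] by auto
    then have "\<forall>i\<in>I. \<exists>a. a \<in> K i" by blast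
    then obtain a where "\<And>i. i \<in> I \<Longrightarrow> a i \<in> K i" by metis
    then have Lne: "L \<noteq> {}" unfolding L_def by blast
    have LS: "L \<subseteq> S" unfolding L_def using S(2) K(2) by blast
    have cp: "c * measure gauss {z. P i z \<in> K i} < 1" for i
    proof -
      have "c * measure gauss {z. P i z \<in> K i} \<le> c * 1" using c by (intro mult_left_mono) auto
      then show ?thesis using c by linarith
    qed
    have "Phi (Psi c + (\<Sum>i\<in>I. lam i * (Psi (c * (t * p i)) - Psi c)))
      \<le> Phi (Psi c + (\<Sum>i\<in>I. lam i * (Psi (c * measure gauss {z. P i z \<in> K i}) - Psi c)))"
      unfolding Phi_le_iff
    proof (intro add_left_mono sum_mono mult_left_mono diff_right_mono lam_nonneg)
      fix i assume i: "i \<in> I"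
      show "Psi (c * (t * p i)) \<le> Psi (c * measure gauss {z. P i z \<in> K i})"
        using c tp[OF i] K(3)[OF i] by (intro Psi_mono cp) auto
    qed
    also have "\<dots> \<le> c * measure gauss L"
    proof (rule gauss_compact_inequality[OF c lam K(1) _ L Lne])
      show "0 < measure gauss {z. P i z \<in> K i}" if "i \<in> I" for i using K(3)[OF that] tp[OF that] by linarith
      show "weighted_sum x \<in> L" if "\<And>i. i \<in> I \<Longrightarrow> x i \<in> K i" for x unfolding L_def using that by blast
    qed
    also have "measure gauss L = measure (completion gauss) L"
      using L by (simp add: compact_imp_closed)
    also have "c * \<dots> \<le> c * measure (completion gauss) S"
      using c S(1) LS by (intro mult_left_mono cg.finite_measure_mono) auto
    finally show ?thesis .
  qed
  have lim: "((\<lambda>t. Phi (Psi c + (\<Sum>i\<in>I. lam i * (Psi (c * (t * p i)) - Psi c)))) \<longlongrightarrow>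
      Phi (Psi c + (\<Sum>i\<in>I. lam i * (Psi (c * (1 * p i)) - Psi c)))) (at_left 1)"
  proof (rule isCont_tendsto_compose[OF DERIV_isCont[OF Phi_has_derivative]],
      intro tendsto_add tendsto_sum tendsto_mult tendsto_diff tendsto_const)
    fix i assume i: "i \<in> I"
    have "0 < c * (1 * p i)" "c * (1 * p i) < 1"
    proof -
      have "c * p i \<le> c * 1" using c p[OF i] by (intro mult_left_mono) auto
      then show "c * (1 * p i) < 1" unfolding mult_1 using c by linarith
    qed (use c p[OF i] in simp)
    then show "((\<lambda>t. Psi (c * (t * p i))) \<longlongrightarrow> Psi (c * (1 * p i))) (at_left 1)"
      by (intro isCont_tendsto_compose[OF Psi_continuous] tendsto_intros)
  qed
  have "Phi (Psi c + (\<Sum>i\<in>I. lam i * (Psi (c * (1 * p i)) - Psi c))) \<le> c * measure (completion gauss) S"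
  proof (rule tendsto_upperbound[OF lim])
    show "\<forall>\<^sub>F t in at_left 1. Phi (Psi c + (\<Sum>i\<in>I. lam i * (Psi (c * (t * p i)) - Psi c))) \<le> c * measure (completion gauss) S"
      unfolding eventually_at_left_field using bound by (intro exI[of _ 0]) auto
  qed simp
  then show ?thesis by (simp add: p_def)
qed

end

section \<open>Measurability of Minkowski combinations\<close>

text \<open>
  Analytic sets, as projections of closed sets along the Baire space. In this form preimages under
  continuous maps between arbitrary topological spaces are immediate.
\<close>

definition souslin :: "'a::topological_space set \<Rightarrow> bool" where
  "souslin S \<longleftrightarrow> (\<exists>C :: ('a \<times> (nat \<Rightarrow> nat)) set. closed C \<and> S = fst ` C)"

lemma souslin_closed: "closed S \<Longrightarrow> souslin S"
  unfolding souslin_def by (rule exI[of _ "S \<times> UNIV"]) (auto intro: closed_Times)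

text \<open>
  The first entry of the sequence selects the member of the union.
\<close>

lemma souslin_UN:
  fixes S :: "nat \<Rightarrow> 'a::topological_space set"
  assumes "\<And>n. souslin (S n)"
  shows "souslin (\<Union>n. S n)"
proof -
  obtain C :: "nat \<Rightarrow> ('a \<times> (nat \<Rightarrow> nat)) set" where C: "\<And>n. closed (C n)" "\<And>n. S n = fst ` C n"
    using assms unfolding souslin_def by metis
  define D where "D = (\<Inter>n. {p. snd p 0 \<noteq> n} \<union> (\<lambda>p. (fst p, \<lambda>k. snd p (Suc k))) -` C n)"
  have c: "continuous_on UNIV (\<lambda>p :: 'a \<times> (nat \<Rightarrow> nat). snd p k)" for k
    by (rule continuous_on_product_then_coordinatewise) (intro continuous_intros)
  have "closed {p :: 'a \<times> (nat \<Rightarrow> nat). snd p 0 \<noteq> n}" for n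
  proof -
    have "closed ((\<lambda>p :: 'a \<times> (nat \<Rightarrow> nat). snd p 0) -` (- {n}))"
      by (intro closed_vimage c) (simp add: closed_def discrete_topology_class.open_discrete)
    then show ?thesis by (simp add: vimage_def)
  qed
  moreover have "closed ((\<lambda>p. (fst p, \<lambda>k. snd p (Suc k))) -` C n)" for n
    by (intro closed_vimage C continuous_on_Pair continuous_on_fst continuous_on_id
          continuous_on_coordinatewise_then_product c)
  ultimately have "closed D"
    unfolding D_def by (intro closed_INT closed_Un) auto
  moreover have "(\<Union>n. S n) = fst ` D"
  proof (intro equalityI subsetI)
    fix x assume "x \<in> (\<Union>n. S n)"
    then obtain n t where "(x, t) \<in> C n" using C(2) by force
    then have "(x, case_nat n t) \<in> D" by (auto simp: D_def)
    then show "x \<in> fst ` D" by force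
  next
    fix x assume "x \<in> fst ` D"
    then obtain t where "(x, t) \<in> D" by force
    then have "(x, \<lambda>k. t (Suc k)) \<in> C (t 0)" by (auto simp: D_def)
    then show "x \<in> (\<Union>n. S n)" using C(2) by force
  qed
  ultimately show ?thesis unfolding souslin_def by blast
qed

text \<open>
  One sequence codes countably many by a pairing function.
\<close>

lemma souslin_INT:
  fixes S :: "nat \<Rightarrow> 'a::topological_space set"
  assumes "\<And>n. souslin (S n)"
  shows "souslin (\<Inter>n. S n)"
proof -
  obtain C :: "nat \<Rightarrow> ('a \<times> (nat \<Rightarrow> nat)) set" where C: "\<And>n. closed (C n)" "\<And>n. S n = fst ` C n"
    using assms unfolding souslin_def by metis
  define D where "D = (\<Inter>n. (\<lambda>p. (fst p, \<lambda>k. snd p (prod_encode (n, k)))) -` C n)"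
  have c: "continuous_on UNIV (\<lambda>p :: 'a \<times> (nat \<Rightarrow> nat). snd p k)" for k
    by (rule continuous_on_product_then_coordinatewise) (intro continuous_intros)
  have "closed D"
    unfolding D_def
    by (intro closed_INT ballI closed_vimage C continuous_on_Pair continuous_on_fst continuous_on_id
          continuous_on_coordinatewise_then_product c)
  moreover have "(\<Inter>n. S n) = fst ` D"
  proof (intro equalityI subsetI)
    fix x assume "x \<in> (\<Inter>n. S n)"
    then have "\<forall>n. \<exists>t. (x, t) \<in> C n" using C(2) by force
    then obtain t where "\<And>n. (x, t n) \<in> C n" by metis
    then have "(x, \<lambda>j. case prod_decode j of (n, k) \<Rightarrow> t n k) \<in> D" by (auto simp: D_def)
    then show "x \<in> fst ` D" by force
  next
    fix x assume "x \<in> fst ` D"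
    then obtain t where "(x, t) \<in> D" by force
    then have "(x, \<lambda>k. t (prod_encode (n, k))) \<in> C n" for n by (auto simp: D_def)
    then show "x \<in> (\<Inter>n. S n)" using C(2) by force
  qed
  ultimately show ?thesis unfolding souslin_def by blast
qed

lemma souslin_open:
  fixes S :: "'a::metric_space set"
  assumes "open S" shows "souslin S"
proof -
  have "fsigma_in euclidean S"
    using assms by (simp add: open_imp_fsigma_in metrizable_space_euclidean)
  then obtain F :: "nat \<Rightarrow> 'a set" where "\<And>n. closed (F n)" "\<Union> (range F) = S"
    unfolding fsigma_in_ascending by auto
  then show ?thesis using souslin_UN[of F] souslin_closed by auto
qed

text \<open>
  The class of all \<open>S\<close> such that \<open>S\<close> and its complement are analytic is a \<open>\<sigma>\<close>-algebra that
  contains the open sets.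
\<close>

lemma souslin_borel:
  fixes S :: "'a::metric_space set"
  assumes "S \<in> sets borel" shows "souslin S"
proof -
  have "S \<in> sigma_sets UNIV {S. open S}" using assms by (simp add: sets_borel)
  then have "souslin S \<and> souslin (- S)"
  proof induction
    case (Basic a)
    then show ?case by (auto intro: souslin_open souslin_closed)
  next
    case Empty
    then show ?case by (auto intro: souslin_closed)
  next
    case (Compl a)
    have "UNIV - a = - a" by auto
    with Compl show ?case by simp
  next
    case (Union a)
    then show ?case by (auto intro: souslin_UN souslin_INT)
  qed
  then show ?thesis ..
qed

lemma souslin_vimage:
  fixes f :: "'a::topological_space \<Rightarrow> 'b::topological_space"
  assumes "souslin S" "continuous_on UNIV f" shows "souslin (f -` S)"
proof -
  obtain C :: "('b \<times> (nat \<Rightarrow> nat)) set" where C: "closed C" "S = fst ` C"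
    using assms unfolding souslin_def by metis
  have "closed ((\<lambda>p. (f (fst p), snd p)) -` C)"
    by (intro closed_vimage C continuous_on_Pair continuous_on_compose2[OF assms(2)]
        continuous_on_fst continuous_on_snd continuous_on_id) auto
  moreover have "f -` S = fst ` ((\<lambda>p. (f (fst p), snd p)) -` C)"
  proof (intro equalityI subsetI)
    fix x assume "x \<in> f -` S"
    then obtain t where "(f x, t) \<in> C" using C(2) by auto
    then show "x \<in> fst ` ((\<lambda>p. (f (fst p), snd p)) -` C)"
      by (intro image_eqI[of _ _ "(x, t)"]) auto
  next
    fix x assume "x \<in> fst ` ((\<lambda>p. (f (fst p), snd p)) -` C)"
    then obtain t where "(f x, t) \<in> C" by auto
    from imageI[OF this, of fst] show "x \<in> f -` S" by (simp add: C(2))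
  qed
  ultimately show ?thesis unfolding souslin_def by blast
qed

lemma compact_box_nat: "compact {s :: nat \<Rightarrow> nat. \<forall>i. s i \<le> b i}"
proof -
  have "compactin (product_topology (\<lambda>i. euclidean) UNIV) (PiE UNIV (\<lambda>i. {..b i}))"
    by (subst compactin_PiE) (auto intro: finite_imp_compact)
  moreover have "PiE UNIV (\<lambda>i. {..b i}) = {s :: nat \<Rightarrow> nat. \<forall>i. s i \<le> b i}"
    by (auto simp: PiE_def extensional_def)
  ultimately show ?thesis by (simp add: euclidean_product_topology)
qed

text \<open>
  Choquet's capacity argument. The closed set \<open>C\<close> is cut down by restricting first the point
  to some \<open>K n\<close> and then, one after another, the entries of the sequence to a bound; outer measure is
  continuous along increasing unions, so each bound can be chosen with outer measure staying above
  \<open>e\<close>. The closures of the images have an intersection of measure at least \<open>e\<close>, and compactness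
  shows that a point in this intersection is the image of a point of \<open>C\<close>.
\<close>

lemma continuous_image_souslin_inner_compact:
  fixes f :: "'x::{first_countable_topology, t2_space} \<Rightarrow> 'a::{metric_space}"
  assumes S: "souslin S" and f: "continuous_on UNIV f"
    and K: "\<And>n. compact (K n)" "incseq K" "S \<subseteq> (\<Union>n. K n)"
    and M: "finite_measure M" "sets M = sets borel"
    and e: "e < outer_measure_of M (f ` S)"
  shows "\<exists>L. L \<in> sets borel \<and> L \<subseteq> f ` S \<and> e \<le> emeasure M L"
proof -
  interpret finite_measure M by fact
  have spM: "space M = UNIV" using sets_eq_imp_space_eq[OF M(2)] by simp
  obtain C :: "('x \<times> (nat \<Rightarrow> nat)) set" where C: "closed C" "S = fst ` C"
    using S unfolding souslin_def by metis
  define D where "D i n = (case i of 0 \<Rightarrow> {p :: 'x \<times> (nat \<Rightarrow> nat). fst p \<in> K n} | Suc j \<Rightarrow> {p. snd p j \<le> n})" for i n :: nat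
  have Dinc: "incseq (D i)" for i
    using K(2) by (auto simp: D_def incseq_def split: nat.split)
  have Dun: "C \<subseteq> (\<Union>n. D i n)" for i
  proof
    fix p assume "p \<in> C"
    then obtain n where "fst p \<in> K n" using K(3) C(2) by blast
    then show "p \<in> (\<Union>n. D i n)" by (cases i) (auto simp: D_def)
  qed
  have "\<exists>T. \<forall>j. (T j \<subseteq> C \<and> e < outer_measure_of M ((\<lambda>p. f (fst p)) ` T j)) \<and> (\<exists>n. T (Suc j) = T j \<inter> D j n)"
  proof (rule dependent_nat_choice)
    show "\<exists>T. T \<subseteq> C \<and> e < outer_measure_of M ((\<lambda>p. f (fst p)) ` T)"
      using e C(2) by (intro exI[of _ C]) (simp add: image_image)
  next
    fix T j assume T: "T \<subseteq> C \<and> e < outer_measure_of M ((\<lambda>p. f (fst p)) ` T)"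
    have inc: "incseq (\<lambda>n. (\<lambda>p. f (fst p)) ` (T \<inter> D j n))"
      using Dinc[of j] unfolding incseq_def by (intro allI impI image_mono Int_mono) auto
    have "(\<lambda>p. f (fst p)) ` T = (\<Union>n. (\<lambda>p. f (fst p)) ` (T \<inter> D j n))"
      using T Dun[of j] by blast
    then have "e < (SUP n. outer_measure_of M ((\<lambda>p. f (fst p)) ` (T \<inter> D j n)))"
      using T inc by (subst SUP_outer_measure_of_incseq) (auto simp: spM)
    then obtain n where "e < outer_measure_of M ((\<lambda>p. f (fst p)) ` (T \<inter> D j n))"
      by (auto simp: less_SUP_iff)
    then show "\<exists>T'. (T' \<subseteq> C \<and> e < outer_measure_of M ((\<lambda>p. f (fst p)) ` T')) \<and> (\<exists>n. T' = T \<inter> D j n)"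
      using T by (intro exI[of _ "T \<inter> D j n"]) auto
  qed
  then obtain T where TC: "\<And>j. T j \<subseteq> C" and Te: "\<And>j. e < outer_measure_of M ((\<lambda>p. f (fst p)) ` T j)"
    and "\<And>j. \<exists>n. T (Suc j) = T j \<inter> D j n" by blast
  then obtain m where m: "\<And>j. T (Suc j) = T j \<inter> D j (m j)" by metis
  have Tdec: "decseq T" by (rule decseq_SucI) (auto simp: m)
  have TD: "T j \<subseteq> D i (m i)" if "i < j" for i j
    using decseqD[OF Tdec, of "Suc i" j] that m[of i] by auto
  define cl where "cl j = closure ((\<lambda>p. f (fst p)) ` T j)" for j
  define L where "L = (\<Inter>j. cl j)"
  have "decseq cl"
    using Tdec unfolding cl_def decseq_def by (intro allI impI closure_mono image_mono) auto
  moreover have clb: "cl j \<in> sets borel" for j by (simp add: cl_def)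
  ultimately have "emeasure M L = (INF j. emeasure M (cl j))"
    unfolding L_def by (intro INF_emeasure_decseq[symmetric]) (auto simp: M clb)
  moreover have "e \<le> emeasure M (cl j)" for j
  proof -
    have "e \<le> outer_measure_of M (cl j)"
      by (rule order_trans[OF less_imp_le[OF Te[of j]] outer_measure_of_mono]) (auto simp: cl_def closure_subset)
    then show ?thesis by (simp add: outer_measure_of_eq M cl_def)
  qed
  ultimately have "e \<le> emeasure M L" by (auto intro: INF_greatest)
  moreover have "L \<in> sets borel" by (auto simp: L_def cl_def)
  moreover have "L \<subseteq> f ` S"
  proof
    fix y assume "y \<in> L"
    have "\<exists>p\<in>T (Suc j). dist (f (fst p)) y < inverse (Suc j)" for j
    proof -
      have "y \<in> closure ((\<lambda>p. f (fst p)) ` T (Suc j))" using \<open>y \<in> L\<close> by (auto simp: L_def cl_def)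
      moreover have "0 < inverse (real (Suc j))" by simp
      ultimately show ?thesis unfolding closure_approachable by blast
    qed
    then obtain p where p: "\<And>j. p j \<in> T (Suc j)" and py: "\<And>j. dist (f (fst (p j))) y < inverse (Suc j)"
      by metis
    \<comment> \<open>The bound on entry \<open>i\<close> holds only from some index on; taking the finitely many earlier members into account makes it hold for all.\<close>
    define b where "b i = Max (insert (m (Suc i)) ((\<lambda>j. snd (p j) i) ` {..i}))" for i
    have pb: "snd (p j) i \<le> b i" for i j
    proof (cases "j \<le> i")
      case True then show ?thesis unfolding b_def by (intro Max_ge) auto
    next
      case False
      then have "snd (p j) i \<le> m (Suc i)" using TD[of "Suc i" "Suc j"] p[of j] by (auto simp: D_def)
      also have "\<dots> \<le> b i" unfolding b_def by (intro Max_ge) auto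
      finally show ?thesis .
    qed
    have p0: "fst (p j) \<in> K (m 0)" for j
      using TD[of 0 "Suc j"] p[of j] by (auto simp: D_def)
    have "seq_compact (K (m 0) \<times> {s :: nat \<Rightarrow> nat. \<forall>i. s i \<le> b i})"
      by (intro compact_imp_seq_compact compact_Times K compact_box_nat)
    moreover have "\<forall>j. p j \<in> K (m 0) \<times> {s. \<forall>i. s i \<le> b i}"
      using p0 pb by (auto simp: mem_Times_iff)
    ultimately obtain l r where r: "strict_mono (r :: nat \<Rightarrow> nat)" and l: "(p \<circ> r) \<longlonglongrightarrow> l"
      by (rule seq_compactE) auto
    have "l \<in> C"
      using closed_sequentially[OF C(1), of "p \<circ> r" l] l p TC by auto
    have "(\<lambda>j. f (fst ((p \<circ> r) j))) \<longlonglongrightarrow> f (fst l)"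
      by (rule continuous_on_tendsto_compose[OF f tendsto_fst[OF l]]) auto
    moreover have "(\<lambda>j. f (fst (p j))) \<longlonglongrightarrow> y"
    proof (rule iffD2[OF tendsto_dist_iff], rule tendsto_sandwich[OF _ _ tendsto_const LIMSEQ_inverse_real_of_nat])
      show "\<forall>\<^sub>F j in sequentially. dist (f (fst (p j))) y \<le> inverse (real (Suc j))"
        using py by (intro always_eventually allI less_imp_le)
    qed auto
    then have "(\<lambda>j. f (fst ((p \<circ> r) j))) \<longlonglongrightarrow> y"
      using LIMSEQ_subseq_LIMSEQ[OF _ r] by (simp add: comp_def)
    ultimately have "y = f (fst l)" using LIMSEQ_unique by blast
    then show "y \<in> f ` S" using \<open>l \<in> C\<close> C(2) by blast
  qed
  ultimately show ?thesis by blast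
qed

text \<open>
  A countable union of such inner approximations and a measurable hull of the image have the same
  measure.
\<close>

lemma continuous_image_souslin_completion:
  fixes f :: "'x::{first_countable_topology, t2_space} \<Rightarrow> 'a::{metric_space}"
  assumes "souslin S" and "continuous_on UNIV f"
    and "\<And>n. compact (K n)" "incseq K" "S \<subseteq> (\<Union>n. K n)"
    and M: "finite_measure M" "sets M = sets borel"
  shows "f ` S \<in> sets (completion M)"
proof (cases "outer_measure_of M (f ` S) = 0")
  case True
  interpret finite_measure M by fact
  have spM: "space M = UNIV" using sets_eq_imp_space_eq[OF M(2)] by simp
  obtain E where E: "E \<in> sets M" "f ` S \<subseteq> E" "outer_measure_of M (f ` S) = emeasure M E"
    using outer_measure_of_attain[of "f ` S" M] by (auto simp: spM)
  then have "E \<in> null_sets M" using True by auto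
  then have "f ` S \<in> null_sets (completion M)"
    using null_sets_completionI[of E M] null_sets_completion_subset[OF E(2)] by auto
  then show ?thesis by auto
next
  case False
  interpret finite_measure M by fact
  have spM: "space M = UNIV" using sets_eq_imp_space_eq[OF M(2)] by simp
  obtain E where E: "E \<in> sets M" "f ` S \<subseteq> E" "outer_measure_of M (f ` S) = emeasure M E"
    using outer_measure_of_attain[of "f ` S" M] by (auto simp: spM)
  obtain a :: "nat \<Rightarrow> ennreal" where a: "\<And>n. a n < emeasure M E" "a \<longlonglongrightarrow> emeasure M E"
    using approx_from_below_dense_linorder[of 0 "emeasure M E"] False E(3) by (auto simp: zero_less_iff_neq_zero)
  have "\<exists>L. L \<in> sets borel \<and> L \<subseteq> f ` S \<and> a n \<le> emeasure M L" for n
    by (rule continuous_image_souslin_inner_compact[OF assms]) (use a E in auto)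
  then obtain L where L: "\<And>n. L n \<in> sets borel" "\<And>n. L n \<subseteq> f ` S" "\<And>n. a n \<le> emeasure M (L n)" by metis
  define U where "U = (\<Union>n. L n)"
  have U: "U \<in> sets M" "U \<subseteq> f ` S" using L by (auto simp: U_def M)
  have "a n \<le> emeasure M U" for n
    using L(3)[of n] emeasure_mono[of "L n" U M] U by (auto simp: U_def intro: order_trans)
  then have "emeasure M E \<le> emeasure M U"
    using a(2) LIMSEQ_le_const2 by blast
  then have "emeasure M (E - U) = 0"
    using U E emeasure_Diff[of M U E] by (auto simp: diff_eq_0_iff_ennreal less_top[symmetric])
  then have "E - U \<in> null_sets M" using E U by auto
  then have "f ` S - U \<in> null_sets (completion M)"
    using null_sets_completionI[of "E - U" M] null_sets_completion_subset[of "f ` S - U" "E - U" M] E(2) by auto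
  then have "U \<union> (f ` S - U) \<in> sets (completion M)"
    by (intro sets.Un sets_completionI_sets U(1) null_setsD2)
  also have "U \<union> (f ` S - U) = f ` S" using U by auto
  finally show ?thesis .
qed

text \<open>
  The combination is the image of a Borel set of sequences under a continuous map. Sequences
  vanishing outside \<open>{1..k}\<close> suffice, which makes the domain a countable union of compact boxes.
\<close>

lemma minkowski_comb_completion:
  fixes A :: "nat \<Rightarrow> (real^'n) set"
  assumes A: "\<And>i. i \<in> {1..k} \<Longrightarrow> A i \<in> sets borel"
    and M: "finite_measure M" "sets M = sets borel"
  shows "minkowski_comb k lam A \<in> sets (completion M)"
proof -
  define S where "S = {x. (\<forall>i. i \<in> {1..k} \<longrightarrow> x i \<in> A i) \<and> (\<forall>i. i \<notin> {1..k} \<longrightarrow> x i = 0)}"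
  define f where "f x = (\<Sum>i=1..k. lam i *\<^sub>R x i)" for x :: "nat \<Rightarrow> real^'n"
  define K where "K n = PiE UNIV (\<lambda>i. if i \<in> {1..k} then cball (0::real^'n) (real n) else {0})" for n
  have "S = (\<Inter>i. (\<lambda>x. x i) -` (if i \<in> {1..k} then A i else {0}))"
    by (auto simp: S_def split: if_splits)
  also have "souslin \<dots>"
    by (intro souslin_INT souslin_vimage souslin_borel) (use A in auto)
  finally have "souslin S" .
  moreover have "continuous_on UNIV f"
    unfolding f_def by (intro continuous_on_sum continuous_on_scaleR continuous_on_const continuous_on_product_coordinates)
  moreover have "compact (K n)" for n
  proof -
    have "compactin (product_topology (\<lambda>i. euclidean) UNIV) (K n)"
      unfolding K_def by (subst compactin_PiE) auto
    then show ?thesis by (simp add: euclidean_product_topology)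
  qed
  moreover have "incseq K"
    unfolding incseq_def K_def by (intro allI impI PiE_mono) (auto split: if_splits)
  moreover have "S \<subseteq> (\<Union>n. K n)"
  proof
    fix x assume "x \<in> S"
    obtain n :: nat where n: "(\<Sum>i=1..k. norm (x i)) \<le> real n" using real_arch_simple by blast
    have "norm (x i) \<le> real n" if "i \<in> {1..k}" for i
      using member_le_sum[of i "{1..k}" "\<lambda>i. norm (x i)"] that n by auto
    then have "x \<in> K n" using \<open>x \<in> S\<close> by (auto simp: K_def S_def)
    then show "x \<in> (\<Union>n. K n)" by blast
  qed
  ultimately have "f ` S \<in> sets (completion M)"
    by (intro continuous_image_souslin_completion M)
  also have "f ` S = minkowski_comb k lam A"
  proof (intro equalityI subsetI)
    fix y assume "y \<in> minkowski_comb k lam A"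
    then obtain x where x: "y = (\<Sum>i=1..k. lam i *\<^sub>R x i)" "\<forall>i\<in>{1..k}. x i \<in> A i"
      by (auto simp: minkowski_comb_def)
    have "y = f (\<lambda>i. if i \<in> {1..k} then x i else 0)"
      unfolding f_def x(1) by (intro sum.cong) auto
    then show "y \<in> f ` S" using x(2) by (auto simp: S_def)
  qed (auto simp: minkowski_comb_def f_def S_def)
  finally show ?thesis .
qed

section \<open>The inequality for subspaces\<close>

text \<open>
  The rows of a coisometry form an orthonormal family.
\<close>

lemma linear_coord_adj_frame:
  fixes f :: "real^'n \<Rightarrow> nat \<Rightarrow> real"
  assumes f: "linear_coord m f" and co: "\<And>y. y \<in> coord_space m \<Longrightarrow> f (adj m f y) = y"
  obtains b where "\<And>i j. i < m \<Longrightarrow> j < m \<Longrightarrow> b i \<bullet> b j = (if i = j then 1 else (0::real))"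
    "\<And>z. f z = (\<lambda>j\<in>{..<m}. b j \<bullet> z)"
proof -
  define u where "u j = (\<lambda>i\<in>{..<m}. if i = j then 1 else (0::real))" for j
  have u: "u j \<in> coord_space m" for j by (auto simp: u_def)
  define b where "b j = adj m f (u j)" for j
  have bz: "b j \<bullet> z = f z j" if "j < m" for j z
  proof -
    have "b j \<bullet> z = (\<Sum>i<m. f z i * u j i)"
      unfolding b_def using adj_works[OF f, of z "u j"] by (simp add: inner_commute)
    also have "\<dots> = (\<Sum>i<m. if i = j then f z i else 0)" by (intro sum.cong) (auto simp: u_def)
    also have "\<dots> = f z j" using that by simp
    finally show ?thesis .
  qed
  have "b i \<bullet> b j = (if i = j then 1 else 0)" if "i < m" "j < m" for i j
    unfolding bz[OF that(1)] unfolding b_def co[OF u] using that by (auto simp: u_def)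
  moreover have "f z = (\<lambda>j\<in>{..<m}. b j \<bullet> z)" for z
  proof -
    have "f z \<in> coord_space m" using f by (simp add: linear_coord_def)
    then show ?thesis using bz by (auto simp: fun_eq_iff restrict_def PiE_def extensional_def)
  qed
  ultimately show thesis using that by blast
qed

lemma adj_measurable: "adj m f \<in> coord_gauss m \<rightarrow>\<^sub>M (borel :: (real^'n) measure)"
proof (subst borel_measurable_euclidean_space, intro ballI)
  fix e :: "real^'n" assume "e \<in> Basis"
  then obtain a where e: "e = axis a 1" by (auto simp: Basis_vec_def)
  have "(\<lambda>y. y j) \<in> borel_measurable (coord_gauss m)" if "j < m" for j
  proof -
    have "(\<lambda>y. y j) \<in> coord_gauss m \<rightarrow>\<^sub>M N01"
      unfolding coord_gauss_def using that by (intro measurable_component_singleton) auto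
    then show ?thesis by simp
  qed
  then show "(\<lambda>y. adj m f y \<bullet> e) \<in> borel_measurable (coord_gauss m)"
    unfolding e by (auto simp: inner_axis adj_def intro!: borel_measurable_sum borel_measurable_times)
qed

text \<open>
  A coisometry maps the standard Gaussian measure to the standard Gaussian measure, so the measure
  inside the subspace is that of the preimage under the projection.
\<close>

lemma subspace_gauss_eq:
  fixes f :: "real^'n \<Rightarrow> nat \<Rightarrow> real"
  assumes f: "linear_coord m f" and co: "\<And>y. y \<in> coord_space m \<Longrightarrow> f (adj m f y) = y"
    and A: "A \<in> sets borel"
  shows "subspace_gauss m f A = measure gauss {z. adj m f (f z) \<in> A}"
proof -
  obtain b where b: "\<And>i j. i < m \<Longrightarrow> j < m \<Longrightarrow> b i \<bullet> b j = (if i = j then 1 else (0::real))"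
    and fz: "\<And>z. f z = (\<lambda>j\<in>{..<m}. b j \<bullet> z)"
    using linear_coord_adj_frame[OF f co] by blast
  have D: "distr gauss (coord_gauss m) f = coord_gauss m"
    unfolding fz[abs_def] coord_gauss_def by (rule distr_gauss_orthonormal) (auto simp: b)
  have fm: "f \<in> gauss \<rightarrow>\<^sub>M coord_gauss m"
    unfolding fz[abs_def] coord_gauss_def by measurable
  have X: "{y \<in> coord_space m. adj m f y \<in> A} \<in> sets (coord_gauss m)"
    using measurable_sets[OF adj_measurable[of m f] A] by (simp add: space_coord_gauss vimage_def Int_def conj_commute)
  have "subspace_gauss m f A = measure (distr gauss (coord_gauss m) f) {y \<in> coord_space m. adj m f y \<in> A}"
    unfolding D subspace_gauss_def ..
  also have "\<dots> = measure gauss (f -` {y \<in> coord_space m. adj m f y \<in> A} \<inter> space gauss)"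
    by (rule measure_distr[OF fm X])
  also have "f -` {y \<in> coord_space m. adj m f y \<in> A} \<inter> space gauss = {z. adj m f (f z) \<in> A}"
    using f by (auto simp: linear_coord_def)
  finally show ?thesis .
qed

lemma adj_projection:
  fixes f :: "real^'n \<Rightarrow> nat \<Rightarrow> real"
  assumes f: "linear_coord m f"
  shows "linear (\<lambda>x. adj m f (f x))" and "adj m f (f x) \<bullet> y = x \<bullet> adj m f (f y)"
proof -
  have ip: "adj m f (f x) \<bullet> y = (\<Sum>j<m. f y j * f x j)" for x y
    using adj_works[OF f, of y "f x"] by (simp add: inner_commute)
  then show "adj m f (f x) \<bullet> y = x \<bullet> adj m f (f y)"
    by (simp add: inner_commute[of x] mult.commute)
  have lin: "linear (\<lambda>x. f x j)" if "j < m" for j using f that by (simp add: linear_coord_def)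
  show "linear (\<lambda>x. adj m f (f x))"
  proof (rule linearI)
    fix x y show "adj m f (f (x + y)) = adj m f (f x) + adj m f (f y)"
      by (subst vector_eq_rdot[symmetric])
         (auto simp: ip inner_add_left linear_add[OF lin] distrib_left sum.distrib[symmetric] intro!: sum.cong)
  next
    fix r x show "adj m f (f (r *\<^sub>R x)) = r *\<^sub>R adj m f (f x)"
      by (subst vector_eq_rdot[symmetric])
         (auto simp: ip linear_scale[OF lin] sum_distrib_left mult_ac intro!: sum.cong)
  qed
qed

theorem corollary4p3:
  fixes k :: nat
    and lam :: "nat \<Rightarrow> real"
    and d :: "nat \<Rightarrow> nat"
    and B :: "nat \<Rightarrow> real^'n \<Rightarrow> (nat \<Rightarrow> real)"
    and A :: "nat \<Rightarrow> (real^'n) set"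
    and c :: real
  assumes "\<forall>i\<in>{1..k}. lam i \<ge> 0"
    and "\<forall>i\<in>{1..k}. linear_coord (d i) (B i)"
    and "\<forall>x. (\<Sum>i=1..k. lam i *\<^sub>R adj (d i) (B i) (B i x)) = x"
    and "\<forall>i\<in>{1..k}. \<forall>y\<in>coord_space (d i). B i (adj (d i) (B i) y) = y"
    and "0 < c" and "c < 1"
    and "\<forall>i\<in>{1..k}. A i \<in> sets borel \<and> A i \<subseteq> adj (d i) (B i) ` coord_space (d i)"
  shows "(\<Sum>i=1..k. scale_ext (lam i) (Phi_c_inv c (subspace_gauss (d i) (B i) (A i))))
    \<le> Phi_c_inv c (measure (completion vec_gauss) (minkowski_comb k lam A))"
proof -
  define P where "P i x = adj (d i) (B i) (B i x)" for i x
  define p where "p i = measure gauss {z. P i z \<in> A i}" for i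
  define S where "S = minkowski_comb k lam A"
  \<comment> \<open>The cutoff levels are \<open>M / lam i\<close> below the maximum, hence the restriction to positive weights.\<close>
  define I where "I = {i \<in> {1..k}. 0 < lam i}"
  interpret G: prob_space "gauss :: (real^'n) measure" by (rule prob_space_gauss)
  interpret cG: prob_space "completion (gauss :: (real^'n) measure)" by (rule G.prob_space_completion)
  have c: "0 < c" "c < 1" by fact+
  have lamI: "lam i = 0" if "i \<in> {1..k} - I" for i
  proof -
    have "0 \<le> lam i" "\<not> 0 < lam i" using assms(1) that by (auto simp: I_def)
    then show ?thesis by simp
  qed
  have IK: "I \<subseteq> {1..k}" by (auto simp: I_def)
  have co: "B i (adj (d i) (B i) y) = y" if "i \<in> {1..k}" "y \<in> coord_space (d i)" for i y
    using assms(4) that by blast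
  have Bc: "B i x \<in> coord_space (d i)" if "i \<in> {1..k}" for i x
    using assms(2) that by (simp add: linear_coord_def)
  have idem: "P i (P i x) = P i x" if "i \<in> {1..k}" for i x
    using co[OF that Bc[OF that]] by (simp add: P_def)
  have PA: "P i a = a" if i: "i \<in> {1..k}" and a: "a \<in> A i" for i a
  proof -
    have "A i \<subseteq> adj (d i) (B i) ` coord_space (d i)" using assms(7) i by blast
    then obtain y where "y \<in> coord_space (d i)" "a = adj (d i) (B i) y" using a by blast
    then show ?thesis using co[OF i] by (simp add: P_def)
  qed
  interpret weighted_projections I lam P
  proof (rule weighted_projections.intro)
    show "finite I" by (simp add: I_def)
    show "0 \<le> lam i" if "i \<in> I" for i using that by (simp add: I_def)
    show "linear (P i)" if "i \<in> I" for i
      unfolding P_def[abs_def] using adj_projection(1) assms(2) that IK by blast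
    show "P i x \<bullet> y = x \<bullet> P i y" if "i \<in> I" for i x y
      unfolding P_def using adj_projection(2) assms(2) that IK by blast
    show "P i (P i x) = P i x" if "i \<in> I" for i x using idem that IK by blast
    have "(\<Sum>i\<in>I. lam i *\<^sub>R P i x) = (\<Sum>i=1..k. lam i *\<^sub>R P i x)" for x
      by (rule sum.mono_neutral_left) (use IK lamI in auto)
    then show "(\<Sum>i\<in>I. lam i *\<^sub>R P i x) = x" for x using assms(3) by (simp add: P_def)
  qed
  have pe: "subspace_gauss (d i) (B i) (A i) = p i" if "i \<in> {1..k}" for i
    unfolding p_def P_def using assms(2,7) that co[OF that] by (intro subspace_gauss_eq) auto
  have p1: "0 \<le> p i" "p i \<le> 1" for i by (auto simp: p_def)
  have cp: "c * p i < 1" for i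
  proof -
    have "c * p i \<le> c * 1" using c p1[of i] by (intro mult_left_mono) auto
    then show ?thesis using c by linarith
  qed
  have Pc: "Phi_inv c = ereal (Psi c)" using c by (simp add: Phi_inv_def Psi_def)
  have pos: "Phi_c_inv c (p i) = ereal (Psi (c * p i) - Psi c)" if "0 < p i" for i
    unfolding Phi_c_inv_def Pc using that c cp[of i] by (simp add: Phi_inv_def Psi_def mult_le_0_iff not_le)
  have nul: "Phi_c_inv c (p i) = -\<infinity>" if "\<not> 0 < p i" for i
    unfolding Phi_c_inv_def Pc using that p1[of i] by (simp add: Phi_inv_def)
  have le0: "Psi (c * p i) - Psi c \<le> 0" if "0 < p i" for i
    using Psi_mono[of "c * p i" c] that c p1[of i] by (simp add: mult_left_le)
  show ?thesis
  proof (cases "\<forall>i\<in>{1..k}. 0 < p i")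
    case False
    then obtain i where i: "i \<in> {1..k}" "\<not> 0 < p i" by blast
    define t where "t i = scale_ext (lam i) (Phi_c_inv c (subspace_gauss (d i) (B i) (A i)))" for i
    have ti: "t i = -\<infinity>" unfolding t_def pe[OF i(1)] nul[OF i(2)] by (simp add: scale_ext_def)
    have t0: "t j \<le> 0" if "j \<in> {1..k}" for j
    proof (cases "0 < p j")
      case True
      have "lam j * (Psi (c * p j) - Psi c) \<le> 0"
        using assms(1) that le0[OF True] by (intro mult_nonneg_nonpos) auto
      then show ?thesis unfolding t_def pe[OF that] pos[OF True] by (simp add: scale_ext_def)
    next
      case False
      then show ?thesis unfolding t_def pe[OF that] nul[OF False] by (simp add: scale_ext_def)
    qed
    have "(\<Sum>j=1..k. t j) = t i + (\<Sum>j\<in>{1..k} - {i}. t j)"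
      using i(1) by (intro sum.remove) auto
    moreover have "(\<Sum>j\<in>{1..k} - {i}. t j) \<le> 0" using t0 by (intro sum_nonpos) auto
    ultimately have "(\<Sum>j=1..k. t j) = -\<infinity>" unfolding ti by auto
    then show ?thesis unfolding t_def by simp
  next
    case True
    define Q where "Q = (\<Sum>i\<in>I. lam i * (Psi (c * p i) - Psi c))"
    have "(\<Sum>i=1..k. scale_ext (lam i) (Phi_c_inv c (subspace_gauss (d i) (B i) (A i))))
      = (\<Sum>i=1..k. ereal (lam i * (Psi (c * p i) - Psi c)))"
      using True by (intro sum.cong refl) (simp add: pe pos scale_ext_def)
    also have "\<dots> = ereal (\<Sum>i=1..k. lam i * (Psi (c * p i) - Psi c))" by simp
    also have "(\<Sum>i=1..k. lam i * (Psi (c * p i) - Psi c)) = Q"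
      unfolding Q_def by (rule sum.mono_neutral_right) (use IK lamI in auto)
    finally have lhs: "(\<Sum>i=1..k. scale_ext (lam i) (Phi_c_inv c (subspace_gauss (d i) (B i) (A i)))) = ereal Q" .
    define q where "q = measure (completion gauss) S"
    have q1: "q \<le> 1" unfolding q_def by (rule cG.prob_le_1)
    have SM: "S \<in> sets (completion gauss)"
      unfolding S_def using assms(7) G.finite_measure_axioms by (intro minkowski_comb_completion) auto
    have ne: "A i \<noteq> {}" if "i \<in> {1..k}" for i
    proof
      assume "A i = {}"
      then have "p i = 0" by (simp add: p_def)
      moreover have "0 < p i" using True that by blast
      ultimately show False by simp
    qed
    then have "\<forall>i\<in>{1..k}. \<exists>a. a \<in> A i" by blast
    then obtain a where a: "\<And>i. i \<in> {1..k} \<Longrightarrow> a i \<in> A i" by metis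
    have "Phi (Psi c + Q) \<le> c * q"
      unfolding Q_def p_def q_def
    proof (rule gauss_borel_inequality[OF c])
      show "0 < lam i" if "i \<in> I" for i using that by (simp add: I_def)
      show "A i \<in> sets borel" if "i \<in> I" for i using assms(7) that IK by blast
      show "0 < measure gauss {z. P i z \<in> A i}" if "i \<in> I" for i
        using True that IK unfolding p_def by blast
      show "weighted_sum x \<in> S" if x: "\<And>i. i \<in> I \<Longrightarrow> x i \<in> A i" for x
      proof -
        \<comment> \<open>Indices with weight 0 contribute nothing, but the Minkowski combination still asks for a point of each \<open>A i\<close>.\<close>
        define x' where "x' i = (if i \<in> I then x i else a i)" for i
        have "weighted_sum x = (\<Sum>i\<in>I. lam i *\<^sub>R x' i)"
          unfolding weighted_sum_def using x PA IK by (intro sum.cong) (auto simp: x'_def subset_iff)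
        also have "\<dots> = (\<Sum>i=1..k. lam i *\<^sub>R x' i)"
          by (rule sum.mono_neutral_left) (use IK lamI in auto)
        finally have "weighted_sum x = (\<Sum>i=1..k. lam i *\<^sub>R x' i)" .
        moreover have "\<forall>i\<in>{1..k}. x' i \<in> A i" using x a by (auto simp: x'_def)
        ultimately show ?thesis unfolding S_def minkowski_comb_def by blast
      qed
    qed (rule SM)
    moreover have q01: "0 < c * q" "c * q < 1"
    proof -
      show "0 < c * q" using calculation Phi_pos[of "Psi c + Q"] by linarith
      have "c * q \<le> c * 1" using c q1 by (intro mult_left_mono) auto
      then show "c * q < 1" using c by linarith
    qed
    ultimately have "Psi c + Q \<le> Psi (c * q)"
      using Psi_mono[of "Phi (Psi c + Q)" "c * q"] by simp
    then have "ereal Q \<le> ereal (Psi (c * q)) - ereal (Psi c)" by simp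
    also have "\<dots> = Phi_c_inv c q"
      unfolding Phi_c_inv_def Pc using q01 by (simp add: Phi_inv_def Psi_def)
    finally show ?thesis
      unfolding lhs q_def S_def vec_gauss_eq_gauss .
  qed
qed

end
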